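(* For integers $r \ge r_* \ge 1$, assume the model $b = \mathcal{A}(M_* ) + \xi \in \mathbb{R}^n$ for some rank-$r_*$ matrix $M_* \in \mathbb{R}^{d_1 \times d_2}$, and suppose the linear operator $\mathcal{A} \colon \mathbb{R}^{d_1 \times d_2} \to \mathbb{R}^n$ has $(k, \delta_k)$-RIP with $$\delta_k < \delta_{\mathrm{crit}} := \frac{1}{1 + \sqrt{r_*/r}} \quad \text{for} \quad k \ge r + r_*.$$ Then, for any $\lambda \ge 0$, any second-order critical point $(U, V)$ of the problem $$\min_{U \in \mathbb{R}^{d_1 \times r},\ V \in \mathbb{R}^{d_2 \times r}} \ f_\lambda(U, V) := \frac{1}{2} \| \mathcal{A}(U V^\top) - b \|^2 + \lambda \frac{\|U\|_F^2 + \|V\|_F^2}{2}$$ satisfies $$\| U V^\top - M_* \|_F \le \frac{6 \sqrt{r_*}\, \lambda + \sqrt{r + r_*}\, \big( \|\mathcal{A}^*(\xi)\|_{\mathrm{op}} - \lambda \big)_+}{\delta_{\mathrm{crit}} - \delta_k}.$$ The dependence on $r$ and $r_*$ is sharp in the thresholds for $\delta_k$ and $k$ (that is, in the condition $\delta_k < \delta_{\mathrm{crit}}$ for $k \ge r + r_*$) and is also sharp in the error bound above. In particular, $(k, \delta_k)$-RIP for $k < r + r_*$ does not, in general, suffice to ensure the absence of spurious local optima.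
   Context: $\xi \in \mathbb{R}^n$ is a noise vector. $\|\cdot\|$ is the Euclidean norm on $\mathbb{R}^n$, $\|\cdot\|_F$ the Frobenius norm, $\|\cdot\|_{\mathrm{op}}$ the operator (spectral) norm of a matrix, and $x_+ = \max\{x, 0\}$ for $x \in \mathbb{R}$. $\mathcal{A}^*$ is the adjoint of $\mathcal{A}$ with respect to the trace inner product on $\mathbb{R}^{d_1 \times d_2}$ and the standard inner product on $\mathbb{R}^n$. $\mathcal{A}$ has $(k, \delta_k)$-RIP (restricted isometry property) if, for every $E \in \mathbb{R}^{d_1 \times d_2}$ with $\operatorname{rank}(E) \le k$, $$(1 - \delta_k) \|E\|_F^2 \le \|\mathcal{A}(E)\|^2 \le (1 + \delta_k) \|E\|_F^2 .$$ A second-order critical point of $f_\lambda$ is a point $(U,V)$ with $\nabla f_\lambda(U, V) = 0$ and $\nabla^2 f_\lambda(U, V) \succeq 0$ (positive semidefinite Hessian). A spurious local optimum is a local minimum of $f_\lambda$ that is not a global minimum. *)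

theory Defs
  imports "HOL-Analysis.Analysis"
begin

text \<open>
  A \<open>d1 \<times> d2\<close> real matrix has type \<open>real^'d2^'d1\<close>. On this type \<^const>\<open>norm\<close> is the
  Frobenius norm and \<^const>\<open>inner\<close> the trace inner product, so \<^const>\<open>adjoint\<close> is the
  adjoint with respect to the trace inner product. The factor pair \<open>(U, V)\<close> lives in the
  Euclidean product space \<open>(real^'r^'d1) \<times> (real^'r^'d2)\<close>.
\<close>

definition op_norm :: "real^'d2^'d1 \<Rightarrow> real" where
  "op_norm B = onorm ((*v) B)"

definition RIP :: "nat \<Rightarrow> real \<Rightarrow> (real^'d2^'d1 \<Rightarrow> real^'n) \<Rightarrow> bool" where
  "RIP k \<delta> A \<longleftrightarrow>
     (\<forall>E. rank E \<le> k \<longrightarrow>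
        (1 - \<delta>) * (norm E)\<^sup>2 \<le> (norm (A E))\<^sup>2 \<and>
        (norm (A E))\<^sup>2 \<le> (1 + \<delta>) * (norm E)\<^sup>2)"

definition delta_crit :: "nat \<Rightarrow> nat \<Rightarrow> real" where
  "delta_crit r r_star = 1 / (1 + sqrt (real r_star / real r))"

definition objective ::
  "(real^'d2^'d1 \<Rightarrow> real^'n) \<Rightarrow> real^'n \<Rightarrow> real \<Rightarrow> (real^'r^'d1) \<times> (real^'r^'d2) \<Rightarrow> real" where
  "objective A b lam = (\<lambda>(U, V).
     1 / 2 * (norm (A (U ** transpose V) - b))\<^sup>2 + lam * (((norm U)\<^sup>2 + (norm V)\<^sup>2) / 2))"

text \<open>
  Below, \<open>g\<close> is the gradient field of \<open>f\<close> near \<open>x\<close> and \<open>H\<close> its Frechet derivative at \<open>x\<close>,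
  that is, the Hessian as a linear map; both are unique where they exist.
\<close>

definition second_order_critical :: "('a::real_inner \<Rightarrow> real) \<Rightarrow> 'a \<Rightarrow> bool" where
  "second_order_critical f x \<longleftrightarrow>
     (\<exists>g H. (\<forall>\<^sub>F y in nhds x. GDERIV f y :> g y) \<and>
            g x = 0 \<and>
            (g has_derivative H) (at x) \<and>
            (\<forall>h. 0 \<le> h \<bullet> H h))"

definition local_minimum :: "('a::topological_space \<Rightarrow> real) \<Rightarrow> 'a \<Rightarrow> bool" where
  "local_minimum f x \<longleftrightarrow> (\<forall>\<^sub>F y in nhds x. f x \<le> f y)"

definition global_minimum :: "('a \<Rightarrow> real) \<Rightarrow> 'a \<Rightarrow> bool" where
  "global_minimum f x \<longleftrightarrow> (\<forall>y. f x \<le> f y)"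

definition spurious_local_optimum :: "('a::topological_space \<Rightarrow> real) \<Rightarrow> 'a \<Rightarrow> bool" where
  "spurious_local_optimum f x \<longleftrightarrow> local_minimum f x \<and> \<not> global_minimum f x"

text \<open>The noise enters the error bound only through \<open>noise\<close>, the operator norm of \<open>A\<^sup>* \<xi>\<close>.\<close>

definition error_bound :: "nat \<Rightarrow> nat \<Rightarrow> real \<Rightarrow> real \<Rightarrow> real \<Rightarrow> real" where
  "error_bound r r_star \<delta> lam noise =
     (6 * sqrt (real r_star) * lam + sqrt (real (r + r_star)) * max (noise - lam) 0)
       / (delta_crit r r_star - \<delta>)"

end

theory Submission
  imports Defs
begin

text \<open>
  Error bound. Let \<open>X = U V\<^sup>T\<close> have rank \<open>r\<close> with least singular value \<open>\<sigma>\<close>, let \<open>a\<close> be the part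
  of \<open>X - M\<close> tangent to the rank-\<open>r\<close> matrices at \<open>X\<close> and \<open>M2\<close> the normal part of \<open>M\<close>, with
  singular values \<open>s\<close>. The first-order conditions control the product of \<open>A (X - M)\<close> with \<open>A a\<close>;
  the second-order conditions bound the residual on the singular vectors of \<open>M2\<close> by
  \<open>(1 + \<delta>) \<sigma> + lam\<close>. With \<open>d\<close> the critical constant, the RIP is applied to the pair
  \<open>X - M\<close>, \<open>a - d\<^sup>2 M2\<close>, and the threshold comes out because \<open>\<parallel>a\<parallel>\<^sup>2 + d\<^sup>2 \<parallel>M2\<parallel>\<^sup>2\<close> is at least
  \<open>2 d \<surd>(r / r_star) \<sigma> (\<Sum> s)\<close>, an Eckart-Young type estimate that uses \<open>rank M = r_star\<close>.
  If \<open>X\<close> has rank below \<open>r\<close>, the residual has operator norm at most \<open>lam\<close> and the point solves the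
  convex LASSO. In both cases the noise is split into a part of operator norm at most \<open>lam\<close>,
  handled by the LASSO cone condition, and a remainder paired with a matrix of rank at most
  \<open>r + r_star\<close>.

  Sharpness. All examples have \<open>X\<close> and \<open>M\<close> with orthogonal row and column spaces and constant
  singular values, and \<open>A\<^sup>*A\<close> equal to \<open>(1 + \<delta>) I - 2 \<delta> w w\<^sup>T\<close> up to scaling, where \<open>w\<close> is the
  normalised difference of the directions of \<open>X\<close> and \<open>M\<close>.
\<close>

text \<open>Testing the residual against \<open>X - M = a - M2\<close> itself would weigh tangent
  and normal part equally. With weight \<open>d\<^sup>2\<close> on \<open>M2\<close>, put
  \<open>z = a - d\<^sup>2 M2\<close>, \<open>h = X - M\<close> and let \<open>Y\<close> be their
  product: then \<open>(norm z)\<^sup>2 + d\<^sup>2 (norm h)\<^sup>2\<close> is exactly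
  \<open>(1 + d\<^sup>2) Y\<close>, so \<open>d * norm z * norm h\<close> uses up only
  \<open>(1 + d\<^sup>2) / 2\<close> of \<open>Y\<close>. The remaining
  \<open>(1 - d\<^sup>2) / 2\<close> of \<open>Y\<close> has to pay for the curvature term
  \<open>(1 + \<delta>) d\<^sup>2 \<sigma> S\<close>, where \<open>S\<close> is the sum of the
  normal singular values. Given \<open>Y \<ge> 2 d c \<sigma> S\<close> with
  \<open>c = sqrt (r / r_star)\<close>, this works when \<open>(1 - d) c = d\<close>, that is
  \<open>d = c / (c + 1)\<close>, the critical constant. These estimates are tight when
  \<open>norm a = d * norm M2\<close>, which is the geometry of the example at the
  threshold.\<close>

subsection \<open>Outer products, rank and orthonormal families\<close>

text \<open>Products stay in the form \<open>transpose A *v x\<close>, so that facts about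
  \<open>transpose A\<close> as a matrix keep applying.\<close>

declare transpose_matrix_vector [simp del]

definition outer :: "real^'m \<Rightarrow> real^'n \<Rightarrow> real^'n^'m" where
  "outer x y = (\<chi> i j. x $ i * y $ j)"

lemma outer_mult_vec [simp]: "outer x y *v z = (y \<bullet> z) *\<^sub>R x"
  by (simp add: outer_def vec_eq_iff matrix_vector_mult_def inner_vec_def
      sum_distrib_left mult_ac)

lemma inner_outer: "outer x y \<bullet> B = x \<bullet> (B *v y)"
  by (simp add: outer_def inner_vec_def matrix_vector_mult_def sum_distrib_left mult_ac)

lemma inner_outer_right: "B \<bullet> outer x y = x \<bullet> (B *v y)"
  by (metis inner_outer inner_commute)

lemma inner_outer_outer: "outer x y \<bullet> outer x' y' = (x \<bullet> x') * (y \<bullet> y')"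
  by (simp add: inner_outer inner_commute)

lemma norm_outer: "norm (outer x y) = norm x * norm y"
  by (simp add: norm_eq_sqrt_inner inner_outer_outer real_sqrt_mult)

lemma transpose_outer [simp]: "transpose (outer x y) = outer y x"
  by (simp add: outer_def transpose_def vec_eq_iff mult.commute)

lemma transpose_add: "transpose (A + B) = transpose A + transpose B"
  by (simp add: transpose_def vec_eq_iff)

lemma transpose_diff: "transpose (A - B) = transpose A - transpose (B :: 'a::ab_group_add^'n^'m)"
  by (simp add: transpose_def vec_eq_iff)

lemma transpose_scaleR: "transpose (c *\<^sub>R A) = c *\<^sub>R transpose A"
  by (simp add: transpose_def vec_eq_iff)

lemma transpose_sum: "transpose (sum f S) = (\<Sum>i\<in>S. transpose (f i))"
  by (simp add: transpose_def vec_eq_iff)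

lemma matrix_mult_outer: "(A :: real^'n^'m) ** outer x y = outer (A *v x) y"
  by (simp add: matrix_eq matrix_vector_mul_assoc[symmetric] matrix_vector_mult_scaleR)

lemma outer_matrix_mult: "outer x y ** (A :: real^'n^'m) = outer x (transpose A *v y)"
  by (metis matrix_mult_outer matrix_transpose_mul transpose_outer transpose_transpose)

lemma inner_transpose_mult: "x \<bullet> (transpose A *v y) = (A *v x) \<bullet> (y :: real^'m)"
  by (metis dot_lmul_matrix inner_commute transpose_matrix_vector)

lemma inner_matrix_mult_vec: "x \<bullet> (A *v y) = (transpose A *v x) \<bullet> (y :: real^'m)"
  by (metis inner_transpose_mult transpose_transpose)

lemma sum_matrix_vector_mult: "sum f S *v x = (\<Sum>i\<in>S. f i *v (x :: real^'n))"
  by (induction S rule: infinite_finite_induct) (auto simp: matrix_vector_mult_add_rdistrib)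

lemma minus_matrix_vector_mult: "(- A) *v x = - (A *v (x :: real^'n))"
  using matrix_vector_mult_diff_rdistrib[of 0 A x] by simp

lemma norm_matrix_vec_le: "norm (A *v x) \<le> norm A * norm (x :: real^'n)"
proof -
  have "norm (A *v x)^2 = A \<bullet> outer (A *v x) x"
    by (simp add: inner_outer_right power2_norm_eq_inner)
  also have "\<dots> \<le> norm A * (norm (A *v x) * norm x)"
    by (metis norm_cauchy_schwarz norm_outer)
  finally show ?thesis
    by (cases "norm (A *v x) = 0") (auto simp: power2_eq_square mult_ac)
qed

lemma rank_le_dim_subspace:
  fixes B :: "real^'n^'m"
  assumes "\<And>x. B *v x \<in> S" "dim S \<le> k"
  shows "rank B \<le> k"
proof -
  have "dim (range ((*v) B)) \<le> dim S"
    by (intro dim_subset) (use assms in auto)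
  then show ?thesis
    using assms by (simp add: rank_dim_range)
qed

lemma dim_Un_le: "dim (S \<union> T) \<le> dim S + dim (T :: 'a::euclidean_space set)"
proof -
  have "dim (S \<union> T) = dim (span (S \<union> T))" by simp
  also have "span (S \<union> T) = {x + y |x y. x \<in> span S \<and> y \<in> span T}"
    by (auto simp: span_Un)
  also have "dim \<dots> \<le> dim (span S) + dim (span T)"
    using dim_sums_Int[of "span S" "span T"] by simp
  finally show ?thesis by simp
qed

lemma rank_add: "rank (A + B) \<le> rank A + rank (B :: real^'n^'m)"
proof (rule rank_le_dim_subspace)
  show "(A + B) *v x \<in> span (range ((*v) A) \<union> range ((*v) B))" for x
    by (simp add: matrix_vector_mult_add_rdistrib span_add span_base)
  show "dim (span (range ((*v) A) \<union> range ((*v) B))) \<le> rank A + rank B"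
    by (simp add: rank_dim_range dim_Un_le)
qed

lemma rank_outer: "rank (outer x y) \<le> 1"
proof (rule rank_le_dim_subspace)
  show "outer x y *v z \<in> span {x}" for z
    by (simp add: span_base span_scale)
  show "dim (span {x}) \<le> 1"
    using dim_le_card[of "{x}" "{x}"] by (simp add: span_base)
qed

lemma rank_scaleR: "rank (c *\<^sub>R B) \<le> rank (B :: real^'n^'m)"
proof -
  have "c *\<^sub>R B = (c *\<^sub>R mat 1) ** B"
    by (simp add: matrix_eq matrix_vector_mul_assoc[symmetric] scaleR_matrix_vector_assoc[symmetric])
  then show ?thesis by (metis rank_mul_le_right)
qed

lemma rank_minus [simp]: "rank (- B) = rank (B :: real^'n^'m)"
  using rank_scaleR[of "-1" B] rank_scaleR[of "-1" "-B"] by simp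

lemma rank_diff: "rank (A - B) \<le> rank A + rank (B :: real^'n^'m)"
  using rank_add[of A "-B"] by simp

lemma rank_sum_outer: "rank (\<Sum>i<k. outer (u i) (v i) :: real^'n^'m) \<le> k"
proof (induction k)
  case (Suc k)
  then show ?case
    using rank_add[of "\<Sum>i<k. outer (u i) (v i)" "outer (u k) (v k)"] rank_outer[of "u k" "v k"]
    by simp
qed simp

text \<open>Indexing by an initial segment of the naturals lets left vectors, right vectors and
  singular values be matched by index, extended by one and concatenated.\<close>

definition orthonormal_upto :: "nat \<Rightarrow> (nat \<Rightarrow> 'a::real_inner) \<Rightarrow> bool" where
  "orthonormal_upto n u \<longleftrightarrow> (\<forall>i<n. \<forall>j<n. u i \<bullet> u j = (if i = j then 1 else 0))"

lemma orthonormal_uptoD: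
  "orthonormal_upto n u \<Longrightarrow> i < n \<Longrightarrow> j < n \<Longrightarrow> u i \<bullet> u j = (if i = j then 1 else 0)"
  by (auto simp: orthonormal_upto_def)

lemma orthonormal_upto_norm: "orthonormal_upto n u \<Longrightarrow> i < n \<Longrightarrow> norm (u i) = 1"
  by (simp add: orthonormal_uptoD norm_eq_sqrt_inner)

lemma orthonormal_extend:
  assumes "orthonormal_upto n u" "norm x = 1" "\<And>i. i < n \<Longrightarrow> x \<bullet> u i = 0"
  shows "orthonormal_upto (Suc n) (u(n := x))"
  using assms by (simp add: orthonormal_upto_def less_Suc_eq inner_commute norm_eq_1)

lemma orthonormal_inner_sum:
  assumes "orthonormal_upto n u" "i < n"
  shows "u i \<bullet> (\<Sum>j<n. c j *\<^sub>R u j) = c i"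
proof -
  have "u i \<bullet> (\<Sum>j<n. c j *\<^sub>R u j) = (\<Sum>j<n. if i = j then c j else 0)"
    unfolding inner_sum_right using assms
    by (intro sum.cong) (auto simp: orthonormal_uptoD)
  also have "\<dots> = c i" using assms(2) by simp
  finally show ?thesis .
qed

lemma orthonormal_norm_sum:
  assumes "orthonormal_upto n u"
  shows "(norm (\<Sum>j<n. c j *\<^sub>R u j))\<^sup>2 = (\<Sum>j<n. (c j)\<^sup>2)"
proof -
  have "(norm (\<Sum>j<n. c j *\<^sub>R u j))\<^sup>2 = (\<Sum>i<n. c i * (u i \<bullet> (\<Sum>j<n. c j *\<^sub>R u j)))"
    unfolding power2_norm_eq_inner by (subst inner_sum_left) simp
  also have "\<dots> = (\<Sum>i<n. (c i)\<^sup>2)"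
    by (intro sum.cong) (auto simp: orthonormal_inner_sum[OF assms] power2_eq_square)
  finally show ?thesis .
qed

lemma orthonormal_bessel:
  assumes "orthonormal_upto n u"
  shows "(\<Sum>j<n. (u j \<bullet> x)\<^sup>2) \<le> (norm x)\<^sup>2"
proof -
  let ?p = "\<Sum>j<n. (u j \<bullet> x) *\<^sub>R u j"
  have "(norm (x - ?p))\<^sup>2 = (norm x)\<^sup>2 - 2 * (x \<bullet> ?p) + (norm ?p)\<^sup>2"
    by (simp add: power2_norm_eq_inner inner_diff_left inner_diff_right inner_commute)
  moreover have "x \<bullet> ?p = (\<Sum>j<n. (u j \<bullet> x)\<^sup>2)"
    by (simp add: inner_sum_right inner_commute power2_eq_square)
  moreover note orthonormal_norm_sum[OF assms, of "\<lambda>j. u j \<bullet> x"]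
  moreover have "0 \<le> (norm (x - ?p))\<^sup>2" by simp
  ultimately show ?thesis by linarith
qed

lemma orthonormal_injective:
  assumes "orthonormal_upto n u"
  shows "inj_on u {..<n}"
  by (rule inj_onI) (metis assms lessThan_iff orthonormal_uptoD zero_neq_one)

lemma orthonormal_dim_span:
  fixes u :: "nat \<Rightarrow> 'a::euclidean_space"
  assumes "orthonormal_upto n u"
  shows "dim (span (u ` {..<n})) = n"
proof -
  have "pairwise orthogonal (u ` {..<n})"
    unfolding pairwise_def orthogonal_def using assms
    by (auto simp: orthonormal_uptoD)
  moreover have "0 \<notin> u ` {..<n}"
    using orthonormal_upto_norm[OF assms] by force
  ultimately have "independent (u ` {..<n})"
    by (rule pairwise_orthogonal_independent)
  then show ?thesis
    using orthonormal_injective[OF assms] by (simp add: dim_eq_card_independent card_image)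
qed

lemma orthonormal_span_expansion:
  assumes "orthonormal_upto n u" "x \<in> span (u ` {..<n})"
  shows "(\<Sum>j<n. (u j \<bullet> x) *\<^sub>R u j) = x"
  using assms(2)
proof (induction rule: span_induct_alt)
  case base
  then show ?case by simp
next
  case (step c y z)
  then obtain i where i: "i < n" "y = u i" by auto
  have "(\<Sum>j<n. (u j \<bullet> y) *\<^sub>R u j) = (\<Sum>j<n. if j = i then u j else 0)"
    using i assms(1) by (intro sum.cong) (auto simp: orthonormal_uptoD)
  also have "\<dots> = y" using i by simp
  finally show ?case
    using step(2)
    by (simp add: inner_add_right scaleR_add_left sum.distrib scaleR_sum_right[symmetric]
        flip: scaleR_scaleR)
qed

lemma orthonormal_parseval:
  assumes "orthonormal_upto n u" "x \<in> span (u ` {..<n})"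
  shows "(\<Sum>j<n. (u j \<bullet> x)\<^sup>2) = (norm x)\<^sup>2"
  using orthonormal_norm_sum[OF assms(1), of "\<lambda>j. u j \<bullet> x"] orthonormal_span_expansion[OF assms]
  by simp

subsection \<open>Singular value decomposition\<close>

text \<open>The form \<open>x \<bullet> (B *v y)\<close> attains its maximum \<open>s\<close> on the
  compact product of unit spheres, and the equality case of Cauchy-Schwarz turns a maximiser into a
  singular pair.\<close>

lemma max_singular_pair:
  fixes B :: "real^'n^'m"
  assumes "B \<noteq> 0"
  obtains s u v where "s > 0" "norm u = 1" "norm v = 1" "B *v v = s *\<^sub>R u"
    "transpose B *v u = s *\<^sub>R v"
proof -
  let ?S = "sphere 0 1 \<times> sphere 0 1 :: ((real^'m) \<times> (real^'n)) set"
  have "compact ?S" by (intro compact_Times compact_sphere)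
  moreover have "?S \<noteq> {}"
    using vector_choose_size[of 1, where 'a = "real^'m"] vector_choose_size[of 1, where 'a = "real^'n"]
    by auto
  moreover have "continuous_on ?S (\<lambda>(x, y). x \<bullet> (B *v y))"
    unfolding case_prod_unfold
    by (intro continuous_on_inner bounded_linear.continuous_on[OF matrix_vector_mul_bounded_linear]
        continuous_on_fst continuous_on_snd continuous_on_id)
  ultimately obtain u v where uv: "norm u = 1" "norm v = 1"
    and max: "\<And>x y. norm x = 1 \<Longrightarrow> norm y = 1 \<Longrightarrow> x \<bullet> (B *v y) \<le> u \<bullet> (B *v v)"
    using continuous_attains_sup[of ?S "\<lambda>(x, y). x \<bullet> (B *v y)"] by fastforce
  define s where "s = u \<bullet> (B *v v)"
  have le: "x \<bullet> (B *v y) \<le> s * norm x * norm y" for x y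
  proof (cases "x = 0 \<or> y = 0")
    case False
    then have "(x /\<^sub>R norm x) \<bullet> (B *v (y /\<^sub>R norm y)) \<le> s"
      unfolding s_def by (intro max) auto
    then show ?thesis
      using False by (simp add: matrix_vector_mult_scaleR field_simps)
  qed auto
  obtain y where y: "B *v y \<noteq> 0"
    using assms by (metis matrix_eq matrix_vector_mult_0)
  have "0 < (B *v y) \<bullet> (B *v y)" using y by simp
  also have "\<dots> \<le> s * (norm (B *v y) * norm y)" using le[of "B *v y" y] by simp
  finally have s: "s > 0"
    by (metis mult_nonneg_nonneg norm_ge_zero not_less zero_less_mult_pos2 mult_nonpos_nonneg)
  \<comment> \<open>\<open>w\<close> has norm at most \<open>s\<close> and component
    \<open>s\<close> along the unit vector \<open>e\<close>, which leaves no room for an orthogonal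
    component.\<close>
  have aux: "w = s *\<^sub>R e" if "norm e = 1" "e \<bullet> w = s" "w \<bullet> w \<le> s * norm w" for e w :: "'z::real_inner"
  proof -
    have "norm w \<le> s"
      using that(3) s by (cases "w = 0") (auto simp: power2_norm_eq_inner[symmetric] power2_eq_square)
    then have "w \<bullet> w \<le> s\<^sup>2"
      by (metis norm_ge_zero power2_norm_eq_inner power_mono)
    moreover have "(w - s *\<^sub>R e) \<bullet> (w - s *\<^sub>R e) = w \<bullet> w - 2 * s * (e \<bullet> w) + s\<^sup>2 * (norm e)\<^sup>2"
      by (simp add: inner_diff_left inner_diff_right inner_commute power2_norm_eq_inner)
        (simp add: power2_eq_square)
    ultimately have "(w - s *\<^sub>R e) \<bullet> (w - s *\<^sub>R e) \<le> 0"
      using that by (simp add: power2_eq_square)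
    then show ?thesis by (metis eq_iff_diff_eq_0 inner_ge_zero inner_eq_zero_iff order_antisym)
  qed
  have "B *v v = s *\<^sub>R u"
    using le[of "B *v v" v] uv by (intro aux) (auto simp: s_def)
  moreover have "transpose B *v u = s *\<^sub>R v"
  proof (rule aux)
    show "v \<bullet> (transpose B *v u) = s"
      by (simp add: inner_transpose_mult s_def inner_commute)
    show "(transpose B *v u) \<bullet> (transpose B *v u) \<le> s * norm (transpose B *v u)"
      using le[of u "transpose B *v u"] uv inner_transpose_mult[of "transpose B *v u" B u]
      by (simp add: inner_commute)
  qed fact
  ultimately show thesis using that s uv by blast
qed

text \<open>The reduced form: only strictly positive values, in no particular order, so that one may
  divide by every \<open>s i\<close>.\<close>

definition svd :: "nat \<Rightarrow> (nat \<Rightarrow> real) \<Rightarrow> (nat \<Rightarrow> real^'m) \<Rightarrow> (nat \<Rightarrow> real^'n) \<Rightarrow> real^'n^'m \<Rightarrow> bool" where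
  "svd n s u v B \<longleftrightarrow> (\<forall>i<n. s i > 0) \<and> orthonormal_upto n u \<and> orthonormal_upto n v \<and>
     B = (\<Sum>i<n. s i *\<^sub>R outer (u i) (v i))"

lemma svd_mult_vec: "svd n s u v B \<Longrightarrow> B *v y = (\<Sum>i<n. (s i * (v i \<bullet> y)) *\<^sub>R u i)"
  by (simp add: svd_def sum_matrix_vector_mult scaleR_matrix_vector_assoc[symmetric])

lemma svd_transpose: "svd n s u v B \<Longrightarrow> svd n s v u (transpose B)"
  by (simp add: svd_def transpose_sum transpose_scaleR)

lemma svd_right:
  assumes "svd n s u v B" "i < n"
  shows "B *v v i = s i *\<^sub>R u i"
proof -
  have "B *v v i = (\<Sum>j<n. if j = i then s j *\<^sub>R u j else 0)"
    unfolding svd_mult_vec[OF assms(1)] using assms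
    by (intro sum.cong) (auto simp: svd_def orthonormal_uptoD)
  then show ?thesis using assms(2) by simp
qed

lemma svd_left:
  assumes "svd n s u v B" "i < n"
  shows "transpose B *v u i = s i *\<^sub>R v i"
  using svd_right[OF svd_transpose[OF assms(1)] assms(2)] .

lemma svd_inner: "svd n s u v B \<Longrightarrow> B \<bullet> C = (\<Sum>i<n. s i * (u i \<bullet> (C *v v i)))"
  by (simp add: svd_def inner_sum_left inner_outer)

lemma svd_norm:
  assumes "svd n s u v B"
  shows "(norm B)\<^sup>2 = (\<Sum>i<n. (s i)\<^sup>2)"
proof -
  have "B \<bullet> B = (\<Sum>i<n. s i * (u i \<bullet> (B *v v i)))"
    by (rule svd_inner[OF assms])
  also have "\<dots> = (\<Sum>i<n. (s i)\<^sup>2)"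
  proof (intro sum.cong refl)
    fix i assume "i \<in> {..<n}"
    moreover have "orthonormal_upto n u" using assms by (simp add: svd_def)
    ultimately show "s i * (u i \<bullet> (B *v v i)) = (s i)\<^sup>2"
      by (simp add: svd_right[OF assms] orthonormal_uptoD power2_eq_square)
  qed
  finally show ?thesis by (simp add: power2_norm_eq_inner)
qed

text \<open>Deflation: subtracting a maximal singular pair leaves \<open>C\<close> with range
  orthogonal to \<open>u\<close>, while \<open>u\<close> and the range of \<open>C\<close> together
  span the range of \<open>B\<close>. Hence the rank drops by exactly one.\<close>

theorem svd_exists:
  fixes B :: "real^'n^'m"
  obtains s u v where "svd (rank B) s u v B"
proof -
  have "\<exists>s u v. svd n s u v B" if "rank B = n" for n and B :: "real^'n^'m"
    using that
  proof (induction n arbitrary: B)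
    case 0
    then show ?case by (simp add: rank_eq_0 svd_def orthonormal_upto_def)
  next
    case (Suc n)
    then have "B \<noteq> 0" by auto
    then obtain s u v where s: "s > 0" and u: "norm u = 1" and v: "norm v = 1"
      and Bv: "B *v v = s *\<^sub>R u" and Bu: "transpose B *v u = s *\<^sub>R v"
      by (rule max_singular_pair)
    define C where "C = B - s *\<^sub>R outer u v"
    have C: "C *v y = B *v y - (s * (v \<bullet> y)) *\<^sub>R u" for y
      by (simp add: C_def matrix_vector_mult_diff_rdistrib scaleR_matrix_vector_assoc[symmetric])
    have Ct: "transpose C *v y = transpose B *v y - (s * (u \<bullet> y)) *\<^sub>R v" for y
      by (simp add: C_def matrix_vector_mult_diff_rdistrib scaleR_matrix_vector_assoc[symmetric]
          transpose_diff transpose_scaleR)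
    have Cv: "C *v v = 0" using v by (simp add: C Bv norm_eq_1)
    have Cu: "transpose C *v u = 0" using u by (simp add: Ct Bu norm_eq_1)
    have uC: "u \<bullet> (C *v y) = 0" for y by (simp add: inner_matrix_mult_vec Cu)
    have "dim (insert u (range ((*v) C))) = Suc (rank C)"
    proof -
      have "u \<notin> span (range ((*v) C))"
      proof
        have *: "u \<bullet> w = 0" if "w \<in> span (range ((*v) C))" for w
          using that by (induction rule: span_induct_alt) (auto simp: inner_add_right uC)
        assume "u \<in> span (range ((*v) C))"
        then have "u \<bullet> u = 0" by (rule *)
        with u show False by auto
      qed
      then show ?thesis by (simp add: dim_insert rank_dim_range)
    qed
    moreover have "span (insert u (range ((*v) C))) = span (range ((*v) B))"
    proof (rule span_eq[THEN iffD2], intro conjI subsetI)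
      have "(1 / s) *\<^sub>R (B *v v) \<in> span (range ((*v) B))"
        by (intro span_scale span_base) simp
      then have uB: "u \<in> span (range ((*v) B))" using s by (simp add: Bv)
      fix x assume "x \<in> insert u (range ((*v) C))"
      then consider "x = u" | y where "x = C *v y" by auto
      then show "x \<in> span (range ((*v) B))"
      proof cases
        case 2
        have "B *v y - (s * (v \<bullet> y)) *\<^sub>R u \<in> span (range ((*v) B))"
          by (intro span_diff span_scale uB span_base) simp
        then show ?thesis by (simp add: 2 C)
      qed (use uB in simp)
    next
      fix x assume "x \<in> range ((*v) B)"
      then obtain y where "x = C *v y + (s * (v \<bullet> y)) *\<^sub>R u" by (auto simp: C)
      moreover have "C *v y + (s * (v \<bullet> y)) *\<^sub>R u \<in> span (insert u (range ((*v) C)))"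
        by (intro span_add span_scale span_base) simp_all
      ultimately show "x \<in> span (insert u (range ((*v) C)))" by simp
    qed
    ultimately have "rank C = n"
      by (metis Suc.prems Suc_inject dim_span rank_dim_range)
    then obtain s' u' v' where sv: "svd n s' u' v' C" using Suc.IH by blast
    have orth: "u \<bullet> u' i = 0" "v \<bullet> v' i = 0" if "i < n" for i
    proof -
      have "s' i > 0" using sv that by (simp add: svd_def)
      moreover have "u \<bullet> (s' i *\<^sub>R u' i) = 0" unfolding svd_right[OF sv that, symmetric] by (rule uC)
      moreover have "v \<bullet> (s' i *\<^sub>R v' i) = 0"
        unfolding svd_left[OF sv that, symmetric] by (simp add: inner_transpose_mult Cv)
      ultimately show "u \<bullet> u' i = 0" "v \<bullet> v' i = 0" by simp_all
    qed
    have "orthonormal_upto (Suc n) (u'(n := u))"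
      using orthonormal_extend[of n u' u] sv u orth(1) by (simp add: svd_def norm_eq_1)
    moreover have "orthonormal_upto (Suc n) (v'(n := v))"
      using orthonormal_extend[of n v' v] sv v orth(2) by (simp add: svd_def norm_eq_1)
    moreover have "B = (\<Sum>i<n. s' i *\<^sub>R outer (u' i) (v' i)) + s *\<^sub>R outer u v"
      using sv by (simp add: svd_def C_def algebra_simps)
    moreover have "\<forall>i<n. s' i > 0" using sv by (simp add: svd_def)
    ultimately have "svd (Suc n) (s'(n := s)) (u'(n := u)) (v'(n := v)) B"
      unfolding svd_def lessThan_Suc using s by (auto simp: less_Suc_eq)
    then show ?case by (intro exI)
  qed
  then show ?thesis using that by metis
qed

subsection \<open>Operator norm bounds\<close>

lemma sum_le_sqrt_card_L2:
  fixes s :: "nat \<Rightarrow> real"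
  shows "(\<Sum>i<n. s i) \<le> sqrt n * sqrt (\<Sum>i<n. (s i)\<^sup>2)"
proof -
  have "(\<Sum>i<n. s i)\<^sup>2 \<le> (\<Sum>i<n. (s i)\<^sup>2) * card {..<n}"
    by (rule sum_squared_le_sum_of_squares)
  then have "(\<Sum>i<n. s i) \<le> sqrt ((\<Sum>i<n. (s i)\<^sup>2) * card {..<n})"
    by (rule real_le_rsqrt)
  then show ?thesis by (simp add: real_sqrt_mult mult.commute)
qed

text \<open>The nuclear norm against the Frobenius norm.\<close>

lemma svd_sum_le:
  assumes "svd n s u v B"
  shows "(\<Sum>i<n. s i) \<le> sqrt n * norm B"
  using sum_le_sqrt_card_L2[of s n] svd_norm[OF assms]
  by (metis norm_ge_zero real_sqrt_abs abs_of_nonneg)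

text \<open>The operator norm bound as a bound on the bilinear form: directly additive, and
  evaluated at singular vectors without passing through \<open>onorm\<close>.\<close>

definition op_le :: "real^'n^'m \<Rightarrow> real \<Rightarrow> bool" where
  "op_le B c \<longleftrightarrow> (\<forall>x y. x \<bullet> (B *v y) \<le> c * (norm x * norm y))"

lemma op_leD: "op_le B c \<Longrightarrow> x \<bullet> (B *v y) \<le> c * (norm x * norm y)"
  by (simp add: op_le_def)

lemma op_le_op_norm: "op_le B (op_norm B)"
  unfolding op_le_def op_norm_def
proof (intro allI)
  fix x y
  have "x \<bullet> (B *v y) \<le> norm x * norm (B *v y)" by (rule norm_cauchy_schwarz)
  also have "\<dots> \<le> norm x * (onorm ((*v) B) * norm y)"
    by (intro mult_left_mono onorm matrix_vector_mul_bounded_linear) simp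
  finally show "x \<bullet> (B *v y) \<le> onorm ((*v) B) * (norm x * norm y)" by (simp add: mult_ac)
qed

lemma op_le_scaleR: "op_le B c \<Longrightarrow> t \<ge> 0 \<Longrightarrow> op_le (t *\<^sub>R B) (t * c)"
  by (auto simp: op_le_def scaleR_matrix_vector_assoc[symmetric] mult.assoc intro: mult_left_mono)

lemma op_le_mono: "op_le B c \<Longrightarrow> c \<le> c' \<Longrightarrow> op_le B c'"
  unfolding op_le_def by (meson mult_right_mono mult_nonneg_nonneg norm_ge_zero order_trans)

lemma op_le_minus: "op_le B c \<Longrightarrow> op_le (- B) c"
  unfolding op_le_def
  by (metis inner_minus_left inner_minus_right minus_matrix_vector_mult norm_minus_cancel)

lemma op_le_add: "op_le B c \<Longrightarrow> op_le C c' \<Longrightarrow> op_le (B + C) (c + c')"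
  by (simp add: op_le_def matrix_vector_mult_add_rdistrib inner_add_right distrib_right add_mono)

lemma op_le_diff: "op_le B c \<Longrightarrow> op_le C c' \<Longrightarrow> op_le (B - C) (c + c')"
  using op_le_add[of B c "-C" c'] op_le_minus[of C c'] by simp

lemma op_le_unitI:
  fixes B :: "real^'n^'m"
  assumes "\<And>x y. norm x = 1 \<Longrightarrow> norm y = 1 \<Longrightarrow> x \<bullet> (B *v y) \<le> c"
  shows "op_le B c"
  unfolding op_le_def
proof (intro allI)
  fix x :: "real^'m" and y :: "real^'n"
  show "x \<bullet> (B *v y) \<le> c * (norm x * norm y)"
  proof (cases "x = 0 \<or> y = 0")
    case False
    then have "(x /\<^sub>R norm x) \<bullet> (B *v (y /\<^sub>R norm y)) \<le> c"
      by (intro assms) auto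
    then show ?thesis
      using False by (simp add: matrix_vector_mult_scaleR field_simps)
  qed auto
qed

text \<open>Duality of operator and nuclear norm, the latter being at most \<open>sqrt k\<close>
  times the Frobenius norm.\<close>

lemma inner_le_op_rank:
  assumes "op_le \<Psi> c" "0 \<le> c" "rank B \<le> k"
  shows "\<Psi> \<bullet> B \<le> c * sqrt k * norm B"
proof -
  obtain s u v where sv: "svd (rank B) s u v B" by (rule svd_exists)
  have "\<Psi> \<bullet> B = (\<Sum>i<rank B. s i * (u i \<bullet> (\<Psi> *v v i)))"
    by (simp add: inner_commute[of \<Psi>] svd_inner[OF sv])
  also have "\<dots> \<le> (\<Sum>i<rank B. s i * c)"
  proof (intro sum_mono mult_left_mono)
    fix i assume "i \<in> {..<rank B}"
    then have "norm (u i) = 1" "norm (v i) = 1" "s i > 0"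
      using sv orthonormal_upto_norm by (auto simp: svd_def)
    then show "u i \<bullet> (\<Psi> *v v i) \<le> c" "0 \<le> s i"
      using op_leD[OF assms(1), of "u i" "v i"] by auto
  qed
  also have "\<dots> = c * (\<Sum>i<rank B. s i)" by (simp add: sum_distrib_left mult.commute)
  also have "\<dots> \<le> c * (sqrt (rank B) * norm B)"
    by (intro mult_left_mono svd_sum_le[OF sv] assms)
  also have "\<dots> \<le> c * (sqrt k * norm B)"
    using assms by (intro mult_left_mono mult_right_mono) auto
  finally show ?thesis by (simp add: mult.assoc)
qed

lemma norm_le_op_rank:
  assumes "op_le B c" "0 \<le> c" "rank B \<le> k"
  shows "norm B \<le> c * sqrt k"
proof -
  have "norm B * norm B \<le> (c * sqrt k) * norm B"
    using inner_le_op_rank[OF assms(1,2), of B k] assms(3)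
    by (simp add: power2_norm_eq_inner[symmetric] power2_eq_square)
  moreover have "0 \<le> c * sqrt k" using assms by simp
  ultimately show ?thesis
    by (cases "norm B = 0") (auto simp: mult_le_cancel_right)
qed

section \<open>Orthogonal projections and the LASSO cone condition\<close>

definition perp :: "nat \<Rightarrow> (nat \<Rightarrow> real^'m) \<Rightarrow> real^'m^'m" where
  "perp n u = mat 1 - (\<Sum>i<n. outer (u i) (u i))"

lemma perp_mult_vec: "perp n u *v x = x - (\<Sum>i<n. (u i \<bullet> x) *\<^sub>R u i)"
  by (simp add: perp_def matrix_vector_mult_diff_rdistrib sum_matrix_vector_mult)

lemma perp_fixes: "(\<And>i. i < n \<Longrightarrow> u i \<bullet> x = 0) \<Longrightarrow> perp n u *v x = x"
  by (simp add: perp_mult_vec)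

lemma transpose_perp [simp]: "transpose (perp n u) = perp n u"
  by (simp add: perp_def transpose_diff transpose_sum)

lemma inner_perp: "orthonormal_upto n u \<Longrightarrow> i < n \<Longrightarrow> u i \<bullet> (perp n u *v x) = 0"
  using orthonormal_inner_sum[of n u i "\<lambda>j. u j \<bullet> x"] by (simp add: perp_mult_vec inner_diff_right)

lemma perp_base: "orthonormal_upto n u \<Longrightarrow> i < n \<Longrightarrow> perp n u *v u i = 0"
proof -
  assume a: "orthonormal_upto n u" "i < n"
  have "x \<bullet> (perp n u *v u i) = 0" for x
    using inner_perp[OF a, of x] inner_transpose_mult[of x "perp n u" "u i"]
    by (simp add: inner_commute)
  then show ?thesis by (metis inner_eq_zero_iff)
qed

lemma perp_pythagoras:
  assumes "orthonormal_upto n u"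
  shows "(\<Sum>i<n. (u i \<bullet> x)\<^sup>2) + (norm (perp n u *v x))\<^sup>2 = (norm x)\<^sup>2"
proof -
  let ?p = "\<Sum>j<n. (u j \<bullet> x) *\<^sub>R u j"
  have "(norm (x - ?p))\<^sup>2 = (norm x)\<^sup>2 - 2 * (x \<bullet> ?p) + (norm ?p)\<^sup>2"
    by (simp add: power2_norm_eq_inner inner_diff_left inner_diff_right inner_commute)
  moreover have "x \<bullet> ?p = (\<Sum>j<n. (u j \<bullet> x)\<^sup>2)"
    by (simp add: inner_sum_right inner_commute power2_eq_square)
  moreover note orthonormal_norm_sum[OF assms, of "\<lambda>j. u j \<bullet> x"]
  ultimately show ?thesis by (simp add: perp_mult_vec)
qed

lemma cauchy_schwarz_2: "a * b + c * d \<le> sqrt (a\<^sup>2 + c\<^sup>2) * sqrt (b\<^sup>2 + d\<^sup>2)" for a b c d :: real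
proof -
  have "(a * b + c * d)\<^sup>2 \<le> (a\<^sup>2 + c\<^sup>2) * (b\<^sup>2 + d\<^sup>2)"
    using zero_le_power2[of "a * d - b * c"] by (simp add: power2_eq_square algebra_simps)
  then show ?thesis by (simp add: real_le_rsqrt flip: real_sqrt_mult)
qed

text \<open>The two summands act between orthogonal pairs of subspaces, so the form splits into two
  parts that recombine by Cauchy-Schwarz in the plane and Pythagoras. Such matrices are
  \<open>c\<close> times subgradients of the nuclear norm at a matrix with singular vectors
  \<open>u\<close>, \<open>v\<close>.\<close>

lemma op_le_completion:
  assumes "op_le \<Psi> c" "0 \<le> c" "orthonormal_upto n u" "orthonormal_upto n v"
  shows "op_le (c *\<^sub>R (\<Sum>i<n. outer (u i) (v i)) + perp n u ** \<Psi> ** perp n v) c"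
  unfolding op_le_def
proof (intro allI)
  fix x y
  let ?a = "sqrt (\<Sum>i<n. (u i \<bullet> x)\<^sup>2)" and ?b = "sqrt (\<Sum>i<n. (v i \<bullet> y)\<^sup>2)"
  let ?c = "norm (perp n u *v x)" and ?d = "norm (perp n v *v y)"
  have "(\<Sum>i<n. (u i \<bullet> x) * (v i \<bullet> y)) \<le> (\<Sum>i<n. \<bar>u i \<bullet> x\<bar> * \<bar>v i \<bullet> y\<bar>)"
    by (intro sum_mono) (simp flip: abs_mult)
  also have "\<dots> \<le> ?a * ?b" using L2_set_mult_ineq[of "\<lambda>i. u i \<bullet> x" "\<lambda>i. v i \<bullet> y" "{..<n}"]
    by (simp add: L2_set_def)
  finally have 1: "(\<Sum>i<n. (u i \<bullet> x) * (v i \<bullet> y)) \<le> ?a * ?b" .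
  have "x \<bullet> ((c *\<^sub>R (\<Sum>i<n. outer (u i) (v i)) + perp n u ** \<Psi> ** perp n v) *v y)
      = c * (\<Sum>i<n. (u i \<bullet> x) * (v i \<bullet> y)) + (perp n u *v x) \<bullet> (\<Psi> *v (perp n v *v y))"
    using inner_matrix_mult_vec[of x "perp n u" "\<Psi> *v (perp n v *v y)"]
    by (simp add: matrix_vector_mult_add_rdistrib scaleR_matrix_vector_assoc[symmetric]
        sum_matrix_vector_mult matrix_vector_mul_assoc[symmetric] inner_add_right inner_sum_right
        mult.commute inner_commute)
  also have "\<dots> \<le> c * (?a * ?b) + c * (?c * ?d)"
    by (intro add_mono mult_left_mono 1 assms op_leD[OF assms(1)])
  also have "\<dots> = c * (?a * ?b + ?c * ?d)" by (simp add: distrib_left)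
  also have "\<dots> \<le> c * (sqrt (?a\<^sup>2 + ?c\<^sup>2) * sqrt (?b\<^sup>2 + ?d\<^sup>2))"
    by (intro mult_left_mono cauchy_schwarz_2 assms)
  also have "\<dots> = c * (norm x * norm y)"
    using perp_pythagoras[OF assms(3), of x] perp_pythagoras[OF assms(4), of y]
    by (simp add: sum_nonneg)
  finally show "x \<bullet> ((c *\<^sub>R (\<Sum>i<n. outer (u i) (v i)) + perp n u ** \<Psi> ** perp n v) *v y)
      \<le> c * (norm x * norm y)" .
qed

lemma op_le_0: "0 \<le> c \<Longrightarrow> op_le 0 c"
  by (simp add: op_le_def)

lemma op_le_polar:
  assumes "0 \<le> c" "orthonormal_upto n u" "orthonormal_upto n v"
  shows "op_le (c *\<^sub>R (\<Sum>i<n. outer (u i) (v i))) c"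
  using op_le_completion[OF op_le_0 assms(1) assms(2,3)] assms(1) by simp

text \<open>
  If \<open>W / c\<close> is a subgradient of the nuclear norm at \<open>X\<close>, then this is the cone condition of the
  matrix LASSO. The competitor \<open>Z\<close> agrees with \<open>\<Psi>\<close> outside the tangent space at \<open>M\<close> and
  is a subgradient at \<open>M\<close>, so that \<open>\<Psi> - Z\<close> has rank at most \<open>2 rank M\<close>.
\<close>

lemma lasso_cone_bound:
  fixes X M :: "real^'n^'m"
  assumes "0 \<le> c" "op_le \<Psi> c" "op_le W c" "\<And>Z. op_le Z c \<Longrightarrow> Z \<bullet> X \<le> W \<bullet> X" "rank M \<le> k"
  shows "(\<Psi> - W) \<bullet> (X - M) \<le> 2 * c * sqrt (2 * k) * norm (X - M)"
proof -
  obtain s u v where sv: "svd (rank M) s u v M" by (rule svd_exists)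
  define n where "n = rank M"
  have u: "orthonormal_upto n u" and v: "orthonormal_upto n v" and sp: "\<And>i. i < n \<Longrightarrow> s i > 0"
    using sv by (auto simp: svd_def n_def)
  let ?T = "\<Sum>i<n. outer (u i) (v i)"
  define Z where "Z = c *\<^sub>R ?T + perp n u ** \<Psi> ** perp n v"
  have Z: "op_le Z c" unfolding Z_def by (rule op_le_completion[OF assms(2,1) u v])
  have T_v: "?T *v v i = u i" if "i < n" for i
  proof -
    have "?T *v v i = (\<Sum>j<n. if j = i then u j else 0)"
      unfolding sum_matrix_vector_mult outer_mult_vec
      by (intro sum.cong) (auto simp: orthonormal_uptoD[OF v] that)
    then show ?thesis using that by simp
  qed
  have "Z *v v i = c *\<^sub>R u i" if "i < n" for i
    by (simp add: Z_def matrix_vector_mult_add_rdistrib scaleR_matrix_vector_assoc[symmetric] T_v that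
        matrix_vector_mul_assoc[symmetric] perp_base[OF v])
  then have "M \<bullet> Z = (\<Sum>i<n. s i * c)"
    using svd_inner[OF sv, of Z] orthonormal_uptoD[OF u] by (simp add: n_def[symmetric])
  moreover have "M \<bullet> W \<le> (\<Sum>i<n. s i * c)"
    unfolding svd_inner[OF sv] n_def[symmetric]
  proof (intro sum_mono mult_left_mono)
    fix i assume "i \<in> {..<n}"
    then show "u i \<bullet> (W *v v i) \<le> c" "0 \<le> s i"
      using op_leD[OF assms(3), of "u i" "v i"] orthonormal_upto_norm[OF u] orthonormal_upto_norm[OF v]
        sp by (auto simp: less_imp_le)
  qed
  ultimately have "W \<bullet> M \<le> Z \<bullet> M" by (simp add: inner_commute)
  \<comment> \<open>Monotonicity of subgradients: \<open>W\<close> is optimal at \<open>X\<close>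
    and \<open>Z\<close> at \<open>M\<close>, so the product of \<open>W - Z\<close> with
    \<open>X - M\<close> is nonnegative.\<close>
  with assms(4)[OF Z] have "(\<Psi> - W) \<bullet> (X - M) \<le> (\<Psi> - Z) \<bullet> (X - M)"
    by (simp add: inner_diff_left inner_diff_right)
  also have "\<dots> \<le> norm (\<Psi> - Z) * norm (X - M)" by (rule norm_cauchy_schwarz)
  also have "\<dots> \<le> ((c + c) * sqrt (2 * k)) * norm (X - M)"
  proof (intro mult_right_mono norm_le_op_rank[THEN order_trans, OF op_le_diff[OF assms(2) Z] _ order_refl])
    let ?U = "\<Sum>i<n. outer (u i) (u i)" and ?V = "\<Sum>i<n. outer (v i) (v i)"
    have uT: "?U ** ?T = ?T"
    proof -
      have "?U ** ?T = ?T - perp n u ** ?T"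
        by (simp add: perp_def matrix_eq matrix_vector_mult_diff_rdistrib
            matrix_vector_mul_assoc[symmetric])
      also have "perp n u ** ?T = 0"
        unfolding matrix_eq
        by (simp add: matrix_vector_mul_assoc[symmetric] sum_matrix_vector_mult
            linear_sum[OF matrix_vector_mul_linear] matrix_vector_mult_scaleR perp_base[OF u])
      finally show ?thesis by simp
    qed
    \<comment> \<open>Each summand contains a projection onto an \<open>n\<close>-dimensional space
      of singular vectors, hence has rank at most \<open>n\<close>.\<close>
    have "\<Psi> - Z = ?U ** (\<Psi> - c *\<^sub>R ?T) + perp n u ** \<Psi> ** ?V"
      unfolding Z_def matrix_eq
      by (simp add: perp_def matrix_vector_mult_diff_rdistrib matrix_vector_mult_add_rdistrib
        matrix_vector_mul_assoc[symmetric] matrix_vector_mult_diff_distrib matrix_vector_mult_scaleR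
        scaleR_matrix_vector_assoc[symmetric])
       (simp add: matrix_vector_mul_assoc uT)
    moreover have "rank (?U ** (\<Psi> - c *\<^sub>R ?T)) \<le> n"
      using rank_mul_le_left rank_sum_outer order_trans by blast
    moreover have "rank (perp n u ** \<Psi> ** ?V) \<le> n"
      using rank_mul_le_right rank_sum_outer order_trans by blast
    ultimately have "rank (\<Psi> - Z) \<le> 2 * k"
      using rank_add[of "?U ** (\<Psi> - c *\<^sub>R ?T)" "perp n u ** \<Psi> ** ?V"] assms(5) by (simp add: n_def)
    then show "(c + c) * sqrt (rank (\<Psi> - Z)) \<le> (c + c) * sqrt (2 * k)"
      using assms(1) by (intro mult_left_mono) auto
  qed (use assms(1) in auto)
  finally show ?thesis by simp
qed

subsection \<open>Distance to matrices of lower rank\<close>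

lemma bessel_finite:
  fixes B :: "'a::real_inner set"
  assumes "finite B" "pairwise orthogonal B" "\<And>x. x \<in> B \<Longrightarrow> norm x = 1"
  shows "(\<Sum>y\<in>B. (y \<bullet> x)\<^sup>2) \<le> (norm x)\<^sup>2"
proof -
  obtain u where u: "bij_betw u {..<card B} B"
    using ex_bij_betw_nat_finite[OF assms(1)] by (auto simp: atLeast0LessThan)
  have "orthonormal_upto (card B) u"
    unfolding orthonormal_upto_def
  proof (intro allI impI)
    fix i j assume "i < card B" "j < card B"
    then show "u i \<bullet> u j = (if i = j then 1 else 0)"
      using u assms(2,3) unfolding bij_betw_def inj_on_def pairwise_def orthogonal_def
      by (metis (no_types, lifting) imageI lessThan_iff norm_eq_1)
  qed
  then have "(\<Sum>j<card B. (u j \<bullet> x)\<^sup>2) \<le> (norm x)\<^sup>2" by (rule orthonormal_bessel)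
  then show ?thesis using sum.reindex_bij_betw[OF u, of "\<lambda>y. (y \<bullet> x)\<^sup>2"] by simp
qed

lemma norm_power2_rows: "(norm (B :: real^'n^'m))\<^sup>2 = (\<Sum>i\<in>UNIV. (norm (B $ i))\<^sup>2)"
  by (simp add: power2_norm_eq_inner inner_vec_def[of B])

lemma norm_power2_vec: "(norm (x :: real^'n))\<^sup>2 = (\<Sum>i\<in>UNIV. (x $ i)\<^sup>2)"
  unfolding power2_norm_eq_inner inner_vec_def by (simp add: power2_eq_square)

text \<open>Bessel's inequality for each row of \<open>E\<close>.\<close>

lemma sum_norm_mult_orthonormal_le:
  fixes E :: "real^'n^'m"
  assumes "finite B" "pairwise orthogonal B" "\<And>x. x \<in> B \<Longrightarrow> norm x = 1"
  shows "(\<Sum>y\<in>B. (norm (E *v y))\<^sup>2) \<le> (norm E)\<^sup>2"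
proof -
  have "(\<Sum>y\<in>B. (norm (E *v y))\<^sup>2) = (\<Sum>y\<in>B. \<Sum>i\<in>UNIV. (y \<bullet> E $ i)\<^sup>2)"
    by (simp add: norm_power2_vec matrix_vector_mul_component inner_commute)
  also have "\<dots> = (\<Sum>i\<in>UNIV. \<Sum>y\<in>B. (y \<bullet> E $ i)\<^sup>2)" by (rule sum.swap)
  also have "\<dots> \<le> (\<Sum>i\<in>UNIV. (norm (E $ i))\<^sup>2)"
    by (intro sum_mono bessel_finite assms)
  finally show ?thesis by (simp add: norm_power2_rows)
qed

lemma subspace_ker: "subspace {x. M *v x = 0}" for M :: "real^'n^'m"
  by (rule linear_subspace_kernel) simp

lemma dim_ker: "dim {x. M *v x = 0} + rank M = CARD('n)" for M :: "real^'n^'m"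
proof -
  let ?R = "range ((*v) (transpose M))"
  have "subspace ?R"
    by (metis linear_subspace_image matrix_vector_mul_linear subspace_UNIV)
  then have "dim {y \<in> UNIV. \<forall>x\<in>?R. orthogonal x y} + dim ?R = dim (UNIV :: (real^'n) set)"
    by (intro dim_subspace_orthogonal_to_vectors) auto
  moreover have "{y \<in> UNIV. \<forall>x\<in>?R. orthogonal x y} = {x. M *v x = 0}"
    using vector_eq_ldot[of "M *v _" 0]
    by (auto simp: orthogonal_def inner_matrix_mult_vec[symmetric])
  ultimately show ?thesis
    by (simp add: rank_dim_range[symmetric] rank_transpose)
qed

lemma dim_Int_ker:
  fixes M :: "real^'n^'m"
  assumes "subspace S"
  shows "dim S \<le> dim (S \<inter> {x. M *v x = 0}) + rank M"
proof -
  let ?K = "{x. M *v x = 0}"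
  have K: "subspace ?K" by (rule subspace_ker)
  have "dim {x + y |x y. x \<in> S \<and> y \<in> ?K} \<le> CARD('n)"
    using dim_subset_UNIV[of "{x + y |x y. x \<in> S \<and> y \<in> ?K}"] by simp
  then show ?thesis
    using dim_sums_Int[OF assms K] dim_ker[of M] by linarith
qed

text \<open>The Eckart-Young argument: on the span of the \<open>v i\<close> intersected with the
  kernel of \<open>M\<close>, of dimension at least \<open>n - k\<close>, the difference acts as the
  sum alone and stretches every unit vector by at least \<open>\<sigma>\<close>.\<close>

lemma norm_diff_low_rank_ge:
  fixes M :: "real^'n^'m"
  assumes u: "orthonormal_upto n u" and v: "orthonormal_upto n v"
    and t: "\<And>i. i < n \<Longrightarrow> \<sigma> \<le> t i" and "0 \<le> \<sigma>" and "rank M \<le> k"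
  shows "(real n - real k) * \<sigma>\<^sup>2 \<le> (norm ((\<Sum>i<n. t i *\<^sub>R outer (u i) (v i)) - M))\<^sup>2"
proof -
  let ?N = "\<Sum>i<n. t i *\<^sub>R outer (u i) (v i)"
  let ?S = "span (v ` {..<n}) \<inter> {x. M *v x = 0}"
  have "subspace ?S" by (intro subspace_inter subspace_span subspace_ker)
  then obtain B where B: "B \<subseteq> ?S" "pairwise orthogonal B" "\<And>x. x \<in> B \<Longrightarrow> norm x = 1"
    "independent B" "card B = dim ?S" "span B = ?S"
    by (rule orthonormal_basis_subspace) (rule that)
  have fin: "finite B" using B(4) independent_imp_finite by blast
  have "n \<le> card B + k"
    using dim_Int_ker[of "span (v ` {..<n})" M] assms(5) orthonormal_dim_span[OF v]
    by (simp add: B(5))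
  then have "(real n - real k) * \<sigma>\<^sup>2 \<le> real (card B) * \<sigma>\<^sup>2"
    by (intro mult_right_mono) auto
  also have "\<dots> = (\<Sum>y\<in>B. \<sigma>\<^sup>2)" by simp
  also have "\<dots> \<le> (\<Sum>y\<in>B. (norm ((?N - M) *v y))\<^sup>2)"
  proof (intro sum_mono)
    fix y assume y: "y \<in> B"
    then have "M *v y = 0" and sp: "y \<in> span (v ` {..<n})" using B(1) by auto
    then have "(?N - M) *v y = (\<Sum>i<n. (t i * (v i \<bullet> y)) *\<^sub>R u i)"
      by (simp add: matrix_vector_mult_diff_rdistrib sum_matrix_vector_mult
          scaleR_matrix_vector_assoc[symmetric])
    then have "(norm ((?N - M) *v y))\<^sup>2 = (\<Sum>i<n. (t i * (v i \<bullet> y))\<^sup>2)"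
      by (simp add: orthonormal_norm_sum[OF u])
    also have "\<dots> \<ge> (\<Sum>i<n. \<sigma>\<^sup>2 * (v i \<bullet> y)\<^sup>2)"
      unfolding power_mult_distrib using t \<open>0 \<le> \<sigma>\<close>
      by (intro sum_mono mult_right_mono power_mono) auto
    also have "(\<Sum>i<n. \<sigma>\<^sup>2 * (v i \<bullet> y)\<^sup>2) = \<sigma>\<^sup>2"
      using orthonormal_parseval[OF v sp] B(3)[OF y] by (simp flip: sum_distrib_left)
    finally show "\<sigma>\<^sup>2 \<le> (norm ((?N - M) *v y))\<^sup>2" .
  qed
  also have "\<dots> \<le> (norm (?N - M))\<^sup>2"
    by (rule sum_norm_mult_orthonormal_le[OF fin B(2,3)])
  finally show ?thesis .
qed

subsection \<open>Second-order conditions for the factored problem\<close>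

text \<open>The Riesz representative of a linear functional, written out so that it can be
  differentiated termwise.\<close>

lemma inner_sum_Basis:
  fixes L :: "'a::euclidean_space \<Rightarrow> real"
  assumes "linear L"
  shows "h \<bullet> (\<Sum>e\<in>Basis. L e *\<^sub>R e) = L h"
proof -
  have "L h = L (\<Sum>e\<in>Basis. (h \<bullet> e) *\<^sub>R e)" by (simp add: euclidean_representation)
  also have "\<dots> = (\<Sum>e\<in>Basis. (h \<bullet> e) * L e)"
    by (simp add: linear_sum[OF assms] linear_scale[OF assms])
  finally show ?thesis by (simp add: inner_sum_right mult.commute)
qed

lemma GDERIV_unique:
  assumes "GDERIV f x :> g" "GDERIV f x :> g'"
  shows "g = g'"
proof -
  have "(\<lambda>h. h \<bullet> g) = (\<lambda>h. h \<bullet> g')"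
    using assms unfolding gderiv_def by (rule has_derivative_unique)
  then show ?thesis by (metis vector_eq_ldot)
qed

text \<open>Gradients and derivatives are unique, so the existentially quantified pair can be
  replaced by a known one.\<close>

lemma second_order_critical_iff:
  assumes "\<And>y. GDERIV f y :> g y" "(g has_derivative H) (at x)"
  shows "second_order_critical f x \<longleftrightarrow> g x = 0 \<and> (\<forall>h. 0 \<le> h \<bullet> H h)"
proof
  assume "second_order_critical f x"
  then obtain g' H' where g': "\<forall>\<^sub>F y in nhds x. GDERIV f y :> g' y" "g' x = 0"
    "(g' has_derivative H') (at x)" "\<forall>h. 0 \<le> h \<bullet> H' h"
    unfolding second_order_critical_def by blast
  have ev: "\<forall>\<^sub>F y in nhds x. g' y = g y"
    using g'(1) by eventually_elim (use assms(1) GDERIV_unique in blast)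
  then have gx: "g' x = g x" by (rule eventually_nhds_x_imp_x)
  have "(g has_derivative H') (at x)"
  proof (rule has_derivative_transform_eventually[where f = g'])
    show "\<forall>\<^sub>F y in at x. g' y = g y"
      using ev by (auto simp: eventually_at_filter elim: eventually_mono)
  qed (use g'(3) gx in auto)
  then have "H' = H" using assms(2) by (rule has_derivative_unique)
  then show "g x = 0 \<and> (\<forall>h. 0 \<le> h \<bullet> H h)" using g' gx by simp
next
  assume "g x = 0 \<and> (\<forall>h. 0 \<le> h \<bullet> H h)"
  then show "second_order_critical f x"
    unfolding second_order_critical_def using assms by (intro exI[of _ g] exI[of _ H]) auto
qed

text \<open>With \<open>U V\<^sup>T\<close> regarded as a bilinear map on the diagonal, both
  derivatives follow from the product rule: \<open>L Q\<close> is the differential at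
  \<open>Q\<close>, and \<open>L'\<close> is the Hessian form at \<open>P\<close>.\<close>

lemma second_order_critical_least_squares_iff:
  fixes T :: "'a::euclidean_space \<Rightarrow> 'a \<Rightarrow> 'b::real_inner"
  assumes T: "bounded_bilinear T"
  shows "second_order_critical (\<lambda>P. 1 / 2 * (norm (T P P - b))\<^sup>2 + lam * ((norm P)\<^sup>2 / 2)) P \<longleftrightarrow>
    (\<forall>h. (T P P - b) \<bullet> (T P h + T h P) + lam * (P \<bullet> h) = 0) \<and>
    (\<forall>h. 0 \<le> (norm (T P h + T h P))\<^sup>2 + 2 * ((T P P - b) \<bullet> T h h) + lam * (norm h)\<^sup>2)"
proof -
  interpret T: bounded_bilinear T by (rule T)
  define L where "L Q e = (T Q Q - b) \<bullet> (T Q e + T e Q) + lam * (Q \<bullet> e)" for Q e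
  define L' where "L' h e = (T P h + T h P) \<bullet> (T P e + T e P) + (T P P - b) \<bullet> (T h e + T e h)
      + lam * (h \<bullet> e)" for h e
  define g where "g Q = (\<Sum>e\<in>Basis. L Q e *\<^sub>R e)" for Q
  define H where "H h = (\<Sum>e\<in>Basis. L' h e *\<^sub>R e)" for h
  have g: "h \<bullet> g Q = L Q h" for h Q
    unfolding g_def
    by (rule inner_sum_Basis, rule linearI)
      (simp_all add: L_def T.add_left T.add_right T.scaleR_left T.scaleR_right algebra_simps inner_simps)
  have H: "k \<bullet> H h = L' h k" for h k
    unfolding H_def
    by (rule inner_sum_Basis, rule linearI)
      (simp_all add: L'_def T.add_left T.add_right T.scaleR_left T.scaleR_right algebra_simps inner_simps)
  have 1: "GDERIV (\<lambda>P. 1 / 2 * (norm (T P P - b))\<^sup>2 + lam * ((norm P)\<^sup>2 / 2)) Q :> g Q" for Q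
  proof -
    have "((\<lambda>P. 1 / 2 * ((T P P - b) \<bullet> (T P P - b)) + lam / 2 * (P \<bullet> P)) has_derivative
        (\<lambda>h. L Q h)) (at Q)"
      unfolding L_def
      by (rule derivative_eq_intros T.FDERIV refl)+
        (simp add: fun_eq_iff inner_simps inner_commute algebra_simps)
    then show ?thesis
      unfolding gderiv_def g power2_norm_eq_inner by simp
  qed
  have 2: "(g has_derivative H) (at P)"
    unfolding g_def[abs_def] H_def[abs_def] L_def L'_def
    by (rule derivative_eq_intros T.FDERIV refl)+
      (simp add: fun_eq_iff T.zero_left T.zero_right inner_simps algebra_simps)
  have "g P = 0 \<longleftrightarrow> (\<forall>h. L P h = 0)"
    unfolding g[symmetric] by (metis inner_eq_zero_iff inner_zero_right)
  moreover have "L' h h = (norm (T P h + T h P))\<^sup>2 + 2 * ((T P P - b) \<bullet> T h h) + lam * (norm h)\<^sup>2" for h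
    unfolding L'_def power2_norm_eq_inner by (simp add: inner_add_right)
  ultimately show ?thesis
    unfolding second_order_critical_iff[OF 1 2] H by (simp add: L_def)
qed

lemma bounded_bilinear_factor:
  fixes A :: "real^'n^'m \<Rightarrow> 'b::euclidean_space"
  assumes "linear A"
  shows "bounded_bilinear (\<lambda>(P :: (real^'r^'m) \<times> (real^'r^'n)) (Q :: (real^'r^'m) \<times> (real^'r^'n)). A (fst P ** transpose (snd Q)))"
proof (rule bilinear_conv_bounded_bilinear[THEN iffD1])
  show "bilinear (\<lambda>(P :: (real^'r^'m) \<times> (real^'r^'n)) (Q :: (real^'r^'m) \<times> (real^'r^'n)). A (fst P ** transpose (snd Q)))"
    unfolding bilinear_def
  proof (intro conjI allI linearI)
  qed (simp_all add: linear_add[OF assms, symmetric] linear_scale[OF assms, symmetric],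
    (rule arg_cong[of _ _ A],
     simp add: matrix_matrix_mult_def transpose_def vec_eq_iff sum.distrib sum_distrib_left
      algebra_simps)+)
qed

theorem second_order_critical_objective_iff:
  fixes A :: "real^'n^'m \<Rightarrow> real^'k" and U :: "real^'r^'m" and V :: "real^'r^'n"
    and b :: "real^'k"
  assumes A: "linear A"
  defines "R \<equiv> A (U ** transpose V) - b"
  shows "second_order_critical (objective A b lam) (U, V) \<longleftrightarrow>
    (\<forall>C B. R \<bullet> A (U ** transpose B + C ** transpose V) + lam * (U \<bullet> C + V \<bullet> B) = 0) \<and>
    (\<forall>C B. 0 \<le> (norm (A (U ** transpose B + C ** transpose V)))\<^sup>2
      + 2 * (R \<bullet> A (C ** transpose B)) + lam * ((norm C)\<^sup>2 + (norm B)\<^sup>2))"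
proof -
  have "objective A b lam =
    (\<lambda>P :: (real^'r^'m) \<times> (real^'r^'n). 1 / 2 * (norm (A (fst P ** transpose (snd P)) - b))\<^sup>2
      + lam * ((norm P)\<^sup>2 / 2))"
    by (simp add: objective_def fun_eq_iff norm_prod_def)
  then show ?thesis
    using second_order_critical_least_squares_iff[OF bounded_bilinear_factor[OF A], of b lam "(U, V)"]
    by (simp add: R_def linear_add[OF A] norm_prod_def split_paired_all)
qed

subsection \<open>The error bound\<close>

text \<open>The lower bound is applied to \<open>P\<close> and the upper one to \<open>N\<close>.
  Scaling each vector by the norm of the other makes the error term
  \<open>\<delta> * norm z * norm h\<close>, the best that polarisation gives.\<close>

lemma RIP_polarization:
  fixes A :: "real^'n^'m \<Rightarrow> real^'k"
  assumes A: "linear A" and RIP: "RIP k \<delta> A"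
    and rk: "\<And>c1 c2. rank (c1 *\<^sub>R z + c2 *\<^sub>R h) \<le> k"
  shows "z \<bullet> h - \<delta> * (norm z * norm h) \<le> A z \<bullet> A h"
proof (cases "z = 0 \<or> h = 0")
  case True
  then show ?thesis by (auto simp: linear_0[OF A])
next
  case False
  define P N where "P = norm h *\<^sub>R z + norm z *\<^sub>R h" and "N = norm h *\<^sub>R z + (- norm z) *\<^sub>R h"
  have "(1 - \<delta>) * (norm P)\<^sup>2 \<le> (norm (A P))\<^sup>2" "(norm (A N))\<^sup>2 \<le> (1 + \<delta>) * (norm N)\<^sup>2"
    using RIP rk[of "norm h" "norm z"] rk[of "norm h" "- norm z"] by (auto simp: RIP_def P_def N_def)
  then have "((norm P)\<^sup>2 - (norm N)\<^sup>2) - \<delta> * ((norm P)\<^sup>2 + (norm N)\<^sup>2)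
      \<le> (norm (A P))\<^sup>2 - (norm (A N))\<^sup>2"
    by (simp add: algebra_simps)
  moreover have "(norm (A P))\<^sup>2 - (norm (A N))\<^sup>2 = 4 * (norm h * norm z) * (A z \<bullet> A h)"
    unfolding P_def N_def power2_norm_eq_inner linear_add[OF A] linear_scale[OF A]
    by (simp add: inner_simps inner_commute algebra_simps)
  moreover have "(norm P)\<^sup>2 - (norm N)\<^sup>2 = 4 * (norm h * norm z) * (z \<bullet> h)"
    unfolding P_def N_def power2_norm_eq_inner by (simp add: inner_simps inner_commute algebra_simps)
  moreover have "(norm P)\<^sup>2 + (norm N)\<^sup>2 = 4 * (norm h * norm z) * (norm z * norm h)"
    unfolding P_def N_def power2_norm_eq_inner
    by (simp add: inner_simps inner_commute algebra_simps)
      (simp add: power2_norm_eq_inner[symmetric] power2_eq_square)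
  ultimately have "4 * (norm h * norm z) * (z \<bullet> h) - \<delta> * (4 * (norm h * norm z) * (norm z * norm h))
      \<le> 4 * (norm h * norm z) * (A z \<bullet> A h)"
    by simp
  then have "4 * (norm h * norm z) * (z \<bullet> h - \<delta> * (norm z * norm h)) \<le> 4 * (norm h * norm z) * (A z \<bullet> A h)"
    by (simp only: right_diff_distrib mult.left_commute)
  moreover have "0 < 4 * (norm h * norm z)" using False by simp
  ultimately show ?thesis by (rule mult_left_le_imp_le)
qed

text \<open>Adding the three ranks would count \<open>M\<close> twice; but all columns lie in the
  span of the \<open>q i\<close> and the range of \<open>M\<close>.\<close>

lemma rank_tangent:
  fixes X M :: "real^'n^'m"
  assumes X: "svd n \<tau> q p X"
  shows "rank (c1 *\<^sub>R X + c2 *\<^sub>R M + c3 *\<^sub>R (perp n q ** M ** perp n p)) \<le> n + rank M"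
proof (rule rank_le_dim_subspace)
  let ?S = "span (q ` {..<n} \<union> range ((*v) M))"
  have q: "q i \<in> ?S" if "i < n" for i using that by (auto intro: span_base)
  have Mx: "M *v x \<in> ?S" for x by (auto intro: span_base)
  have "X *v x \<in> ?S" for x
    unfolding svd_mult_vec[OF X] by (intro span_sum span_scale q) simp
  moreover have "(perp n q ** M ** perp n p) *v x \<in> ?S" for x
    unfolding matrix_vector_mul_assoc[symmetric] perp_mult_vec[of n q]
    by (intro span_diff span_sum span_scale q Mx) simp
  ultimately show "(c1 *\<^sub>R X + c2 *\<^sub>R M + c3 *\<^sub>R (perp n q ** M ** perp n p)) *v x \<in> ?S" for x
    unfolding matrix_vector_mult_add_rdistrib scaleR_matrix_vector_assoc[symmetric]
    by (intro span_add span_scale Mx)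
  have "dim ?S \<le> dim (q ` {..<n}) + dim (range ((*v) M))" by (simp add: dim_Un_le)
  also have "dim (q ` {..<n}) \<le> n"
    using dim_le_card'[of "q ` {..<n}"] card_image_le[of "{..<n}" q] by simp
  finally show "dim ?S \<le> n + rank M" by (simp add: rank_dim_range)
qed

text \<open>Both parts are multiples of \<open>\<Xi>\<close>.\<close>

lemma op_le_split:
  assumes "op_le \<Xi> \<nu>" "0 \<le> lam"
  obtains \<Xi>1 \<Xi>2 where "\<Xi> = \<Xi>1 + \<Xi>2" "op_le \<Xi>1 lam" "op_le \<Xi>2 (max (\<nu> - lam) 0)"
proof (cases "\<nu> \<le> lam")
  case True
  then show ?thesis
    using that[of \<Xi> 0] assms op_le_mono op_le_0[of "max (\<nu> - lam) 0"] by auto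
next
  case False
  then have \<nu>: "\<nu> > 0" "lam / \<nu> \<le> 1" using assms(2) by auto
  show ?thesis
  proof (rule that)
    show "\<Xi> = (lam / \<nu>) *\<^sub>R \<Xi> + (1 - lam / \<nu>) *\<^sub>R \<Xi>" by (simp add: algebra_simps)
    show "op_le ((lam / \<nu>) *\<^sub>R \<Xi>) lam"
      using op_le_scaleR[OF assms(1), of "lam / \<nu>"] assms(2) \<nu> by simp
    have "(1 - lam / \<nu>) * \<nu> = max (\<nu> - lam) 0" using \<nu> False by (simp add: field_simps)
    then show "op_le ((1 - lam / \<nu>) *\<^sub>R \<Xi>) (max (\<nu> - lam) 0)"
      using op_le_scaleR[OF assms(1), of "1 - lam / \<nu>"] \<nu> by simp
  qed
qed

lemma delta_crit_less_1:
  assumes "1 \<le> k" "k \<le> n"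
  shows "delta_crit n k < 1"
proof -
  define t where "t = sqrt (real k / real n)"
  have "t > 0" using assms by (simp add: t_def)
  then show ?thesis by (simp add: delta_crit_def flip: t_def)
qed

text \<open>Here \<open>- G\<close> is itself a subgradient at \<open>X\<close> up to the factor
  \<open>lam\<close>, so \<open>lasso_cone_bound\<close> and the lower RIP bound at
  \<open>X - M\<close> suffice. The denominator would even be \<open>1 - \<delta>\<close>.\<close>

lemma error_bound_rank_deficient:
  fixes X M :: "real^'n^'m" and A :: "real^'n^'m \<Rightarrow> real^'k"
  assumes A: "linear A" and RIP: "RIP k \<delta> A" and k: "n + rank M \<le> k" and rX: "rank X \<le> n"
    and rM: "1 \<le> rank M" "rank M \<le> n"
    and G: "\<And>E. G \<bullet> E = A (X - M) \<bullet> A E - \<Xi> \<bullet> E"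
    and GX: "op_le G lam" "\<And>Z. op_le Z lam \<Longrightarrow> Z \<bullet> X \<le> - (G \<bullet> X)"
    and lam: "0 \<le> lam" and \<Xi>: "op_le \<Xi> \<nu>"
    and \<delta>: "\<delta> < delta_crit n (rank M)"
  shows "norm (X - M) \<le> error_bound n (rank M) \<delta> lam \<nu>"
proof -
  obtain \<Xi>1 \<Xi>2 where \<Xi>_eq: "\<Xi> = \<Xi>1 + \<Xi>2" and \<Xi>1: "op_le \<Xi>1 lam"
    and \<Xi>2: "op_le \<Xi>2 (max (\<nu> - lam) 0)"
    using op_le_split[OF \<Xi> lam] by blast
  let ?H = "X - M" and ?mu = "max (\<nu> - lam) 0" and ?d = "delta_crit n (rank M)"
  have rH: "rank ?H \<le> n + rank M" using rank_diff[of X M] rX by simp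
  have "(1 - \<delta>) * (norm ?H)\<^sup>2 \<le> (norm (A ?H))\<^sup>2" using RIP rH k by (simp add: RIP_def)
  also have "\<dots> = \<Xi>2 \<bullet> ?H + (\<Xi>1 - (- G)) \<bullet> ?H"
    using G[of ?H] by (simp add: power2_norm_eq_inner \<Xi>_eq inner_simps)
  also have "\<dots> \<le> ?mu * sqrt (n + rank M) * norm ?H + 2 * lam * sqrt (2 * rank M) * norm ?H"
    using GX by (intro add_mono inner_le_op_rank lasso_cone_bound \<Xi>1 \<Xi>2 lam rH op_le_minus) auto
  finally have "((1 - \<delta>) * norm ?H) * norm ?H \<le> (?mu * sqrt (n + rank M) + 2 * lam * sqrt (2 * rank M)) * norm ?H"
    by (simp add: power2_eq_square algebra_simps)
  then have "(1 - \<delta>) * norm ?H \<le> ?mu * sqrt (n + rank M) + 2 * lam * sqrt (2 * rank M)"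
    using lam by (cases "norm ?H = 0") auto
  moreover have "sqrt 2 \<le> 2" by (rule real_le_lsqrt) auto
  then have "lam * sqrt (rank M) * sqrt 2 \<le> lam * sqrt (rank M) * 3"
    using lam by (intro mult_left_mono) auto
  moreover have "(?d - \<delta>) * norm ?H \<le> (1 - \<delta>) * norm ?H"
    using delta_crit_less_1[OF rM] by (intro mult_right_mono) auto
  ultimately have "(?d - \<delta>) * norm ?H \<le> 6 * sqrt (rank M) * lam + sqrt (n + rank M) * ?mu"
    by (simp add: real_sqrt_mult algebra_simps)
  then show ?thesis
    using \<delta> by (simp add: error_bound_def pos_le_divide_eq mult.commute)
qed

lemma sum_lessThan_add:
  fixes f :: "nat \<Rightarrow> 'a::comm_monoid_add"
  shows "(\<Sum>i<n + j. f i) = (\<Sum>i<n. f i) + (\<Sum>i<j. f (n + i))"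
  by (induction j) (simp_all add: add.assoc)

lemma orthonormal_append:
  assumes "orthonormal_upto n u" "orthonormal_upto j v" "\<And>i l. i < n \<Longrightarrow> l < j \<Longrightarrow> u i \<bullet> v l = 0"
  shows "orthonormal_upto (n + j) (\<lambda>i. if i < n then u i else v (i - n))"
  unfolding orthonormal_upto_def
proof (intro allI impI)
  fix i l assume "i < n + j" "l < n + j"
  then show "(if i < n then u i else v (i - n)) \<bullet> (if l < n then u l else v (l - n)) = (if i = l then 1 else 0)"
    using assms(3)[of i "l - n"] assms(3)[of l "i - n"]
    by (auto simp: orthonormal_uptoD[OF assms(1)] orthonormal_uptoD[OF assms(2)] inner_commute)
qed

text \<open>
  Raising the singular values of the normal block of \<open>M\<close> to at least \<open>\<sigma>\<close> produces, together
  with \<open>X\<close>, a matrix all of whose \<open>n + j\<close> singular values are at least \<open>\<sigma>\<close>; it differs from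
  \<open>M\<close> by the tangent part \<open>a\<close> and the amount of the raise.
\<close>

lemma tangent_distance_ge:
  fixes X M :: "real^'n^'m"
  assumes X: "svd n \<tau> q p X" and \<sigma>: "0 \<le> \<sigma>" "\<And>i. i < n \<Longrightarrow> \<sigma> \<le> \<tau> i"
    and Mn: "svd j s u v (perp n q ** M ** perp n p)"
    and a: "a = X - M + perp n q ** M ** perp n p"
    and rM: "rank M \<le> k"
  shows "(real (n + j) - real k) * \<sigma>\<^sup>2 \<le> (norm a)\<^sup>2 + (\<Sum>i<j. (max (s i) \<sigma> - s i)\<^sup>2)"
    and "\<And>x y. (\<And>i. i < n \<Longrightarrow> q i \<bullet> x = 0) \<Longrightarrow> (\<And>i. i < n \<Longrightarrow> p i \<bullet> y = 0) \<Longrightarrow> x \<bullet> (a *v y) = 0"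
    and "\<And>i l. i < j \<Longrightarrow> l < n \<Longrightarrow> q l \<bullet> u i = 0"
    and "\<And>i l. i < j \<Longrightarrow> l < n \<Longrightarrow> p l \<bullet> v i = 0"
proof -
  let ?M2 = "perp n q ** M ** perp n p"
  have q: "orthonormal_upto n q" and p: "orthonormal_upto n p" using X by (auto simp: svd_def)
  have u: "orthonormal_upto j u" and v: "orthonormal_upto j v" and s: "\<And>i. i < j \<Longrightarrow> s i > 0"
    and M2: "?M2 = (\<Sum>i<j. s i *\<^sub>R outer (u i) (v i))"
    using Mn by (auto simp: svd_def)
  show qu: "q l \<bullet> u i = 0" if "i < j" "l < n" for i l
  proof -
    have "q l \<bullet> (s i *\<^sub>R u i) = 0"
      unfolding svd_right[OF Mn that(1), symmetric] matrix_vector_mul_assoc[symmetric]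
      by (rule inner_perp[OF q that(2)])
    then show ?thesis using s[OF that(1)] by simp
  qed
  show pv: "p l \<bullet> v i = 0" if "i < j" "l < n" for i l
  proof -
    have "transpose ?M2 = perp n p ** transpose M ** perp n q"
      by (simp add: matrix_transpose_mul matrix_mul_assoc)
    then have "p l \<bullet> (s i *\<^sub>R v i) = 0"
      unfolding svd_left[OF Mn that(1), symmetric]
      by (simp add: matrix_vector_mul_assoc[symmetric] inner_perp[OF p that(2)])
    then show ?thesis using s[OF that(1)] by simp
  qed
  show a_perp: "x \<bullet> (a *v y) = 0"
    if x: "\<And>i. i < n \<Longrightarrow> q i \<bullet> x = 0" and y: "\<And>i. i < n \<Longrightarrow> p i \<bullet> y = 0" for x y
  proof -
    have "X *v y = 0" unfolding svd_mult_vec[OF X] using y by simp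
    moreover have "x \<bullet> (?M2 *v y) = x \<bullet> (M *v y)"
      using inner_matrix_mult_vec[of x "perp n q" "M *v y"] perp_fixes[OF x] perp_fixes[OF y]
      by (simp add: matrix_vector_mul_assoc[symmetric])
    ultimately show ?thesis
      by (simp add: a matrix_vector_mult_add_rdistrib matrix_vector_mult_diff_rdistrib inner_simps)
  qed
  let ?t = "\<lambda>i. if i < n then \<tau> i else max (s (i - n)) \<sigma>"
  let ?u = "\<lambda>i. if i < n then q i else u (i - n)" and ?v = "\<lambda>i. if i < n then p i else v (i - n)"
  let ?N = "\<Sum>i<n + j. ?t i *\<^sub>R outer (?u i) (?v i)"
  let ?D = "\<Sum>i<j. (max (s i) \<sigma> - s i) *\<^sub>R outer (u i) (v i)"
  have "?N = X + (\<Sum>i<j. max (s i) \<sigma> *\<^sub>R outer (u i) (v i))"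
    using X by (simp add: sum_lessThan_add svd_def)
  then have N: "?N - M = a + ?D"
    by (simp add: a M2 scaleR_diff_left sum_subtractf)
  have "orthonormal_upto j (\<lambda>i. outer (u i) (v i))"
    using orthonormal_uptoD[OF u] orthonormal_uptoD[OF v]
    by (simp add: orthonormal_upto_def inner_outer_outer)
  then have D: "(norm ?D)\<^sup>2 = (\<Sum>i<j. (max (s i) \<sigma> - s i)\<^sup>2)"
    by (rule orthonormal_norm_sum)
  \<comment> \<open>The \<open>u i\<close> and \<open>v i\<close> are orthogonal to the singular
    vectors of \<open>X\<close>, where the form of \<open>a\<close> vanishes, so there is no cross
    term.\<close>
  have "a \<bullet> ?D = (\<Sum>i<j. (max (s i) \<sigma> - s i) * (u i \<bullet> (a *v v i)))"
    by (simp add: inner_sum_right inner_outer_right)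
  also have "\<dots> = 0" by (intro sum.neutral) (auto simp: a_perp qu pv)
  finally have "(norm (a + ?D))\<^sup>2 = (norm a)\<^sup>2 + (norm ?D)\<^sup>2"
    by (simp add: power2_norm_eq_inner inner_simps inner_commute)
  moreover have "(real (n + j) - real k) * \<sigma>\<^sup>2 \<le> (norm (?N - M))\<^sup>2"
    using \<sigma> qu pv
    by (intro norm_diff_low_rank_ge orthonormal_append q u p v rM) auto
  ultimately show "(real (n + j) - real k) * \<sigma>\<^sup>2 \<le> (norm a)\<^sup>2 + (\<Sum>i<j. (max (s i) \<sigma> - s i)\<^sup>2)"
    unfolding N D by simp
qed

text \<open>The share of one normal singular value \<open>s\<close> in the bound on
  \<open>Y\<close>: Eckart-Young gain, minus the cost of raising \<open>s\<close> to
  \<open>\<sigma>\<close>, plus the part of \<open>d\<^sup>2 (norm M2)\<^sup>2\<close>. Without a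
  raise it is a square; otherwise it is split into three nonnegative terms.\<close>

lemma normal_block_scalar:
  fixes c d s \<sigma> :: real
  assumes "1 \<le> c" "d = c / (c + 1)" "0 \<le> s" "0 \<le> \<sigma>"
  shows "2 * d * c * \<sigma> * s \<le> c\<^sup>2 * \<sigma>\<^sup>2 - (max s \<sigma> - s)\<^sup>2 + d\<^sup>2 * s\<^sup>2"
proof (cases "\<sigma> \<le> s")
  case True
  then show ?thesis
    using zero_le_power2[of "c * \<sigma> - d * s"] by (simp add: power2_eq_square algebra_simps max_def)
next
  case False
  have "0 \<le> d" "d \<le> 1" using assms by auto
  then have "0 \<le> \<sigma> * (\<sigma> - s) * (c\<^sup>2 - 1) + s * \<sigma> * (c - d)\<^sup>2 + (1 - d\<^sup>2) * s * (\<sigma> - s)"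
    using assms False by (intro add_nonneg_nonneg mult_nonneg_nonneg) (auto simp: power_le_one)
  also have "\<dots> = c\<^sup>2 * \<sigma>\<^sup>2 - (\<sigma> - s)\<^sup>2 + d\<^sup>2 * s\<^sup>2 - 2 * d * c * \<sigma> * s"
    by (simp add: power2_eq_square algebra_simps)
  finally show ?thesis using False by (simp add: max_def)
qed

text \<open>In terms of \<open>c = sqrt (n / k)\<close> the threshold satisfies
  \<open>(1 - d) * c = d\<close>, the only form in which it is used.\<close>

lemma delta_crit_eq:
  assumes "1 \<le> k" "k \<le> n"
  obtains c where "1 \<le> c" "real n = c\<^sup>2 * real k" "delta_crit n k = c / (c + 1)"
proof -
  define c where "c = sqrt (real n / real k)"
  have "1 \<le> real n / real k" using assms by simp
  then have c: "1 \<le> c" unfolding c_def by (simp only: real_sqrt_ge_1_iff)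
  have "c\<^sup>2 = real n / real k" by (simp add: c_def)
  moreover have "sqrt (real k / real n) = 1 / c" by (simp add: c_def real_sqrt_divide)
  then have "delta_crit n k = c / (c + 1)"
    unfolding delta_crit_def using c by (simp only:) (simp add: field_simps)
  ultimately show ?thesis using that[OF c] assms by simp
qed

text \<open>Makes the facts about \<open>svd\<close> available for the polar factor.\<close>

lemma svd_ones:
  assumes "orthonormal_upto n u" "orthonormal_upto n v"
  shows "svd n (\<lambda>_. 1) u v (\<Sum>i<n. outer (u i) (v i))"
  using assms by (simp add: svd_def)

text \<open>The combination \<open>z = a - d\<^sup>2 M2\<close> is the one for which the RIP loses nothing at the threshold.\<close>

lemma error_bound_full_rank:
  fixes X M :: "real^'n^'m" and A :: "real^'n^'m \<Rightarrow> real^'k"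
  assumes A: "linear A" and RIP: "RIP k \<delta> A" and k: "n + rank M \<le> k"
    and X: "svd n \<tau> q p X"
    and rM: "1 \<le> rank M" "rank M \<le> n"
    and G: "\<And>E. G \<bullet> E = A (X - M) \<bullet> A E - \<Xi> \<bullet> E"
    and first: "\<And>i. i < n \<Longrightarrow> G *v p i = - lam *\<^sub>R q i"
      "\<And>i. i < n \<Longrightarrow> transpose G *v q i = - lam *\<^sub>R p i"
    and second: "\<And>i x y. i < n \<Longrightarrow> norm x = 1 \<Longrightarrow> norm y = 1 \<Longrightarrow>
      0 \<le> (norm (A (sqrt (\<tau> i) *\<^sub>R (outer (q i) y + outer x (p i)))))\<^sup>2 + 2 * (x \<bullet> (G *v y)) + 2 * lam"
    and lam: "0 \<le> lam" and \<Xi>: "op_le \<Xi> \<nu>"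
    and \<delta>: "\<delta> < delta_crit n (rank M)"
  shows "norm (X - M) \<le> error_bound n (rank M) \<delta> lam \<nu>"
proof -
  let ?rs = "rank M" and ?mu = "max (\<nu> - lam) 0"
  obtain c where c: "1 \<le> c" "real n = c\<^sup>2 * real ?rs" "delta_crit n ?rs = c / (c + 1)"
    by (rule delta_crit_eq[OF rM])
  define d where "d = delta_crit n ?rs"
  have d_eq: "d = c / (c + 1)" by (simp only: d_def c(3))
  have d: "0 < d" "d < 1" "d = c / (c + 1)" "(1 - d) * c = d"
    unfolding d_eq using c(1) by (simp_all add: field_simps)
  have dd: "d\<^sup>2 \<le> 1" using d by (simp add: power_le_one)
  have q: "orthonormal_upto n q" and p: "orthonormal_upto n p" and \<tau>: "\<And>i. i < n \<Longrightarrow> \<tau> i > 0"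
    using X by (auto simp: svd_def)
  have n: "0 < n" using rM by linarith
  obtain \<Xi>1 \<Xi>2 where \<Xi>_eq: "\<Xi> = \<Xi>1 + \<Xi>2" and \<Xi>1: "op_le \<Xi>1 lam" and \<Xi>2: "op_le \<Xi>2 ?mu"
    using op_le_split[OF \<Xi> lam] by blast
  have "Min (\<tau> ` {..<n}) \<in> \<tau> ` {..<n}" using n by (intro Min_in) auto
  then obtain i0 where i0: "i0 < n" and "Min (\<tau> ` {..<n}) = \<tau> i0" by auto
  then have min: "\<tau> i0 \<le> \<tau> i" if "i < n" for i
    using Min_le[of "\<tau> ` {..<n}" "\<tau> i"] that by simp
  define \<sigma> where "\<sigma> = \<tau> i0"
  have \<sigma>: "0 < \<sigma>" using \<tau>[OF i0] by (simp add: \<sigma>_def)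
  define M2 where "M2 = perp n q ** M ** perp n p"
  define a where "a = X - M + M2"
  define z where "z = a - d\<^sup>2 *\<^sub>R M2"
  define h where "h = X - M"
  define j where "j = rank M2"
  obtain s u v where Mn: "svd j s u v M2" unfolding j_def by (rule svd_exists)
  have u: "orthonormal_upto j u" and v: "orthonormal_upto j v" and s: "\<And>i. i < j \<Longrightarrow> s i > 0"
    using Mn by (auto simp: svd_def)
  have rM2: "j \<le> ?rs"
    unfolding j_def M2_def using rank_mul_le_left rank_mul_le_right order_trans by blast
  note dist = tangent_distance_ge[OF X less_imp_le[OF \<sigma>] _ Mn[unfolded M2_def] a_def[unfolded M2_def] order_refl]
  have \<tau>\<sigma>: "\<And>i. i < n \<Longrightarrow> \<sigma> \<le> \<tau> i" using min by (simp add: \<sigma>_def)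
  define S where "S = (\<Sum>i<j. s i)"
  define \<alpha> \<beta> where "\<alpha> = norm a" and "\<beta> = norm M2"
  have \<beta>: "\<beta>\<^sup>2 = (\<Sum>i<j. (s i)\<^sup>2)" by (simp add: \<beta>_def svd_norm[OF Mn])
  have S0: "0 \<le> S" unfolding S_def using s by (intro sum_nonneg) (auto intro: less_imp_le)
  have "M2 \<bullet> a = 0"
    unfolding svd_inner[OF Mn] using dist(2-4)[OF \<tau>\<sigma>] by (intro sum.neutral) simp
  then have orth: "a \<bullet> M2 = 0" "M2 \<bullet> a = 0" by (auto simp: inner_commute)
  have h: "h = a - M2" by (simp add: h_def a_def)
  have nh: "(norm h)\<^sup>2 = \<alpha>\<^sup>2 + \<beta>\<^sup>2" and nz: "(norm z)\<^sup>2 = \<alpha>\<^sup>2 + d^4 * \<beta>\<^sup>2"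
    and zh: "z \<bullet> h = \<alpha>\<^sup>2 + d\<^sup>2 * \<beta>\<^sup>2"
    unfolding h z_def \<alpha>_def \<beta>_def power2_norm_eq_inner
    by (simp_all add: inner_simps orth power2_eq_square power4_eq_xxxx algebra_simps)

  define Y where "Y = \<alpha>\<^sup>2 + d\<^sup>2 * \<beta>\<^sup>2"
  have Y: "2 * d * c * \<sigma> * S \<le> Y"
  proof -
    have "2 * d * c * \<sigma> * S = (\<Sum>i<j. 2 * d * c * \<sigma> * s i)"
      by (simp add: S_def sum_distrib_left)
    also have "\<dots> \<le> (\<Sum>i<j. c\<^sup>2 * \<sigma>\<^sup>2 - (max (s i) \<sigma> - s i)\<^sup>2 + d\<^sup>2 * (s i)\<^sup>2)"
      using s \<sigma> by (intro sum_mono normal_block_scalar c(1) d(3)) (auto intro: less_imp_le)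
    also have "\<dots> = j * c\<^sup>2 * \<sigma>\<^sup>2 - (\<Sum>i<j. (max (s i) \<sigma> - s i)\<^sup>2) + d\<^sup>2 * \<beta>\<^sup>2"
      by (simp add: \<beta> sum.distrib sum_subtractf sum_distrib_left)
    \<comment> \<open>After division by \<open>\<sigma>\<^sup>2\<close> the two sides differ by
      \<open>(c\<^sup>2 - 1) * (rank M - j)\<close>, because
      \<open>n = c\<^sup>2 * rank M\<close>.\<close>
    also have "j * c\<^sup>2 * \<sigma>\<^sup>2 \<le> (real (n + j) - real ?rs) * \<sigma>\<^sup>2"
    proof (rule mult_right_mono)
      have "0 \<le> (c\<^sup>2 - 1) * (real ?rs - real j)" using c(1) rM2 by (intro mult_nonneg_nonneg) auto
      then show "j * c\<^sup>2 \<le> real (n + j) - real ?rs" by (simp add: c(2) algebra_simps)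
    qed simp
    finally show ?thesis using dist(1)[OF \<tau>\<sigma>] by (simp add: Y_def \<alpha>_def)
  qed

  define W where "W = (\<Sum>i<n. outer (q i) (p i))"
  have W: "svd n (\<lambda>_. 1) q p W" unfolding W_def by (rule svd_ones[OF q p])
  have Ga: "G \<bullet> a = - lam * (W \<bullet> a)"
  proof -
    \<comment> \<open>The first-order conditions say that \<open>E\<close> kills the singular
      vectors of \<open>X\<close> on both sides. Its own singular vectors are then normal to those
      of \<open>X\<close>, where \<open>a\<close> vanishes.\<close>
    define E where "E = G + lam *\<^sub>R W"
    have Ep: "E *v p i = 0" and Eq: "transpose E *v q i = 0" if "i < n" for i
      using svd_right[OF W that] svd_left[OF W that] first[OF that]
      by (simp_all add: E_def matrix_vector_mult_add_rdistrib scaleR_matrix_vector_assoc[symmetric]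
          transpose_add transpose_scaleR)
    obtain e x y where E: "svd (rank E) e x y E" by (rule svd_exists)
    have "x i \<bullet> (a *v y i) = 0" if i: "i < rank E" for i
    proof (rule dist(2)[OF \<tau>\<sigma>])
      have e: "e i > 0" using E i by (simp add: svd_def)
      fix l assume l: "l < n"
      have "q l \<bullet> (e i *\<^sub>R x i) = 0"
        unfolding svd_right[OF E i, symmetric] by (simp add: inner_matrix_mult_vec Eq[OF l])
      then show "q l \<bullet> x i = 0" using e by simp
      have "p l \<bullet> (e i *\<^sub>R y i) = 0"
        unfolding svd_left[OF E i, symmetric] by (simp add: inner_transpose_mult Ep[OF l])
      then show "p l \<bullet> y i = 0" using e by simp
    qed simp
    then have "E \<bullet> a = 0" unfolding svd_inner[OF E] by simp
    then show ?thesis by (simp add: E_def inner_simps)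
  qed
  have GM2: "- (G \<bullet> M2) \<le> ((1 + \<delta>) * \<sigma> + lam) * S"
  proof -
    have "- (u i \<bullet> (G *v v i)) \<le> (1 + \<delta>) * \<sigma> + lam" if i: "i < j" for i
    proof -
      \<comment> \<open>The smallest singular value gives the strongest bound. As
        \<open>q i0\<close> is orthogonal to \<open>u i\<close>, the two outer products are
        orthogonal and the squared norm is exactly \<open>2 * \<sigma>\<close>.\<close>
      let ?E = "sqrt \<sigma> *\<^sub>R (outer (q i0) (v i) + outer (u i) (p i0))"
      have nrm: "norm (u i) = 1" "norm (v i) = 1" "norm (q i0) = 1" "norm (p i0) = 1"
        using u v q p i i0 orthonormal_upto_norm by blast+
      have "(norm (outer (q i0) (v i) + outer (u i) (p i0)))\<^sup>2 = 2"
        using dist(3)[OF \<tau>\<sigma> i i0] nrm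
        by (simp add: power2_norm_eq_inner inner_simps inner_outer_outer inner_commute norm_eq_1)
      then have nE: "(norm ?E)\<^sup>2 = 2 * \<sigma>" using \<sigma> by (simp add: power_mult_distrib)
      have "rank ?E \<le> 2"
        using rank_add[of "outer (q i0) (v i)" "outer (u i) (p i0)"]
          rank_outer[of "q i0" "v i"] rank_outer[of "u i" "p i0"]
          rank_scaleR[of "sqrt \<sigma>" "outer (q i0) (v i) + outer (u i) (p i0)"] by linarith
      then have "rank ?E \<le> k" using k rM n by linarith
      then have "(norm (A ?E))\<^sup>2 \<le> (1 + \<delta>) * (2 * \<sigma>)" using RIP nE by (auto simp: RIP_def)
      then show ?thesis
        using second[OF i0 nrm(1,2)] by (simp add: \<sigma>_def)
    qed
    then have "(\<Sum>i<j. s i * (- (u i \<bullet> (G *v v i)))) \<le> (\<Sum>i<j. s i * ((1 + \<delta>) * \<sigma> + lam))"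
      using s by (intro sum_mono mult_left_mono) (auto intro: less_imp_le)
    also have "\<dots> = ((1 + \<delta>) * \<sigma> + lam) * S"
      by (simp add: S_def mult.commute flip: sum_distrib_right)
    finally show ?thesis by (simp add: inner_commute[of G] svd_inner[OF Mn] sum_negf)
  qed

  have rank_comb: "rank (c1 *\<^sub>R z + c2 *\<^sub>R h) \<le> n + ?rs" for c1 c2
  proof -
    have "c1 *\<^sub>R z + c2 *\<^sub>R h
        = (c1 + c2) *\<^sub>R X + (- (c1 + c2)) *\<^sub>R M + (c1 * (1 - d\<^sup>2)) *\<^sub>R (perp n q ** M ** perp n p)"
      by (simp add: z_def a_def h_def algebra_simps flip: M2_def)
    then show ?thesis using rank_tangent[OF X] by simp
  qed
  have rz: "rank z \<le> n + ?rs" using rank_comb[of 1 0] by simp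
  have "z \<bullet> h - \<delta> * (norm z * norm h) \<le> A z \<bullet> A h"
    using rank_comb k by (intro RIP_polarization[OF A RIP]) (meson order_trans)
  also have "\<dots> = G \<bullet> z + \<Xi> \<bullet> z" using G[of z] by (simp add: h_def inner_commute)
  also have "G \<bullet> z = - lam * (W \<bullet> a) + d\<^sup>2 * (- (G \<bullet> M2))"
    by (simp add: z_def inner_simps Ga)
  also have "\<dots> \<le> - lam * (W \<bullet> a) + d\<^sup>2 * (((1 + \<delta>) * \<sigma> + lam) * S)"
    using GM2 by (intro add_left_mono mult_left_mono) auto
  finally have 1: "Y - \<delta> * (norm z * norm h) \<le>
      - lam * (W \<bullet> a) + d\<^sup>2 * (((1 + \<delta>) * \<sigma> + lam) * S) + \<Xi> \<bullet> z"
    by (simp add: zh Y_def)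

  \<comment> \<open>The weighted arithmetic-geometric mean inequality, with equality when
    \<open>norm z = d * norm h\<close>.\<close>
  have "0 \<le> (norm z - d * norm h)\<^sup>2" by simp
  then have "2 * d * (norm z * norm h) \<le> (norm z)\<^sup>2 + d\<^sup>2 * (norm h)\<^sup>2"
    by (simp add: power2_eq_square algebra_simps)
  also have "\<dots> = (1 + d\<^sup>2) * Y"
    unfolding nz nh Y_def by (simp add: power2_eq_square power4_eq_xxxx algebra_simps)
  finally have 2: "2 * d * (norm z * norm h) \<le> (1 + d\<^sup>2) * Y" .
  have "(1 - d\<^sup>2) * (2 * d * c * \<sigma> * S) \<le> (1 - d\<^sup>2) * Y"
    using Y dd by (intro mult_left_mono) auto
  moreover have "(1 - d\<^sup>2) * c = (1 + d) * ((1 - d) * c)"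
    by (simp add: power2_eq_square algebra_simps)
  then have "(1 - d\<^sup>2) * c = (1 + d) * d" unfolding d(4) .
  then have "2 * d * \<sigma> * S * ((1 - d\<^sup>2) * c) = 2 * d * \<sigma> * S * ((1 + d) * d)" by simp
  then have "(1 - d\<^sup>2) * (2 * d * c * \<sigma> * S) = 2 * ((1 + d) * (d\<^sup>2 * (\<sigma> * S)))"
    by (simp only: power2_eq_square mult_ac)
  moreover have "(1 + \<delta>) * (d\<^sup>2 * (\<sigma> * S)) \<le> (1 + d) * (d\<^sup>2 * (\<sigma> * S))"
    using \<delta> \<sigma> S0 by (intro mult_right_mono) (auto simp: d_def)
  ultimately have 3: "2 * ((1 + \<delta>) * (d\<^sup>2 * (\<sigma> * S))) \<le> (1 - d\<^sup>2) * Y" by linarith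

  \<comment> \<open>Half of \<open>2\<close> and half of \<open>3\<close> together exhaust
    \<open>Y\<close>: one part covers \<open>d * norm z * norm h\<close>, the other the curvature
    term.\<close>
  have "norm z * norm h * (d - \<delta>) \<le> - lam * (W \<bullet> a) + d\<^sup>2 * lam * S + \<Xi> \<bullet> z"
    using 1 2 3 by (simp add: algebra_simps)
  also have "\<Xi> \<bullet> z = \<Xi>1 \<bullet> a + d\<^sup>2 * (- \<Xi>1 \<bullet> M2) + \<Xi>2 \<bullet> z"
    by (simp add: \<Xi>_eq z_def inner_simps algebra_simps)
  also have "- lam * (W \<bullet> a) + d\<^sup>2 * lam * S + (\<Xi>1 \<bullet> a + d\<^sup>2 * (- \<Xi>1 \<bullet> M2) + \<Xi>2 \<bullet> z)
      = (\<Xi>1 - lam *\<^sub>R W) \<bullet> a + d\<^sup>2 * (lam * S + - \<Xi>1 \<bullet> M2) + \<Xi>2 \<bullet> z"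
    by (simp add: inner_simps algebra_simps)
  \<comment> \<open>Origin of the constant 6: \<open>M - M2\<close> has rank at most
    \<open>2 * rank M\<close>, so the cone bound contributes \<open>4 * \<alpha>\<close>; the normal
    block contributes \<open>2 * d\<^sup>2 * \<beta>\<close>; and both \<open>\<alpha>\<close> and
    \<open>d\<^sup>2 * \<beta>\<close> are at most \<open>norm z\<close>.\<close>
  also have "\<dots> \<le> 2 * lam * sqrt (2 * (2 * ?rs)) * \<alpha> + d\<^sup>2 * (lam * (sqrt ?rs * \<beta>) + lam * sqrt ?rs * \<beta>)
      + ?mu * sqrt (n + ?rs) * norm z"
  proof (intro add_mono mult_left_mono)
    have "a = X - (M - M2)" by (simp add: a_def)
    moreover have "rank (M - M2) \<le> 2 * ?rs" using rank_diff[of M M2] rM2 by (simp add: j_def)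
    moreover have "Z \<bullet> X \<le> (lam *\<^sub>R W) \<bullet> X" if "op_le Z lam" for Z
    proof -
      have "X \<bullet> Z \<le> (\<Sum>i<n. \<tau> i * lam)"
        unfolding svd_inner[OF X]
      proof (intro sum_mono mult_left_mono)
        fix i assume "i \<in> {..<n}"
        then show "q i \<bullet> (Z *v p i) \<le> lam" "0 \<le> \<tau> i"
          using op_leD[OF that, of "q i" "p i"] orthonormal_upto_norm[OF q] orthonormal_upto_norm[OF p]
            \<tau>[of i] by auto
      qed
      also have "\<dots> = X \<bullet> (lam *\<^sub>R W)"
        unfolding svd_inner[OF X]
        by (intro sum.cong refl) (simp add: scaleR_matrix_vector_assoc[symmetric] svd_right[OF W] orthonormal_uptoD[OF q])
      finally show ?thesis by (simp add: inner_commute)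
    qed
    ultimately show "(\<Xi>1 - lam *\<^sub>R W) \<bullet> a \<le> 2 * lam * sqrt (2 * (2 * ?rs)) * \<alpha>"
      using lasso_cone_bound[OF lam \<Xi>1, of "lam *\<^sub>R W" X "M - M2" "2 * ?rs"] op_le_polar[OF lam q p]
      by (simp add: \<alpha>_def W_def)
    show "S \<le> sqrt ?rs * \<beta>"
      using svd_sum_le[OF Mn] mult_right_mono[of "sqrt j" "sqrt ?rs" "norm M2"] rM2
      by (simp add: S_def \<beta>_def)
    show "- \<Xi>1 \<bullet> M2 \<le> lam * sqrt ?rs * \<beta>"
      using inner_le_op_rank[OF op_le_minus[OF \<Xi>1] lam, of M2 ?rs] rM2 by (simp add: \<beta>_def j_def)
    show "\<Xi>2 \<bullet> z \<le> ?mu * sqrt (n + ?rs) * norm z"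
      by (rule inner_le_op_rank[OF \<Xi>2 _ rz]) simp
  qed (use lam in auto)
  also have "\<dots> = lam * sqrt ?rs * (4 * \<alpha> + 2 * (d\<^sup>2 * \<beta>)) + ?mu * sqrt (n + ?rs) * norm z"
    by (simp add: real_sqrt_mult algebra_simps)
  also have "\<dots> \<le> lam * sqrt ?rs * (4 * norm z + 2 * norm z) + ?mu * sqrt (n + ?rs) * norm z"
  proof (intro add_right_mono mult_left_mono add_mono)
    show "\<alpha> \<le> norm z" by (rule power2_le_imp_le) (simp_all add: nz)
    show "d\<^sup>2 * \<beta> \<le> norm z"
      by (rule power2_le_imp_le) (simp_all add: nz power_mult_distrib)
  qed (use lam in auto)
  finally have "norm z * ((d - \<delta>) * norm h) \<le> norm z * (6 * sqrt ?rs * lam + sqrt (n + ?rs) * ?mu)"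
    by (simp add: algebra_simps)
  moreover have "h = 0" if "norm z = 0"
  proof -
    have "\<alpha>\<^sup>2 + d^4 * \<beta>\<^sup>2 = 0" using nz that by simp
    then have "\<alpha> = 0" "\<beta> = 0" using d by (auto simp: add_nonneg_eq_0_iff)
    then show ?thesis using nh by simp
  qed
  ultimately have "(d - \<delta>) * norm h \<le> 6 * sqrt ?rs * lam + sqrt (n + ?rs) * ?mu"
    using lam by (cases "norm z = 0") auto
  then show ?thesis
    using \<delta> by (simp add: error_bound_def pos_le_divide_eq mult.commute h_def flip: d_def)
qed

section \<open>From critical factors to conditions on their product\<close>

lemma mult_transpose_eq_sum_outer:
  "U ** transpose V = (\<Sum>k\<in>UNIV. outer (column k U) (column k (V :: real^'r^'n)))"
  by (simp add: vec_eq_iff matrix_matrix_mult_def transpose_def outer_def column_def)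

lemma norm_power2_columns: "(norm (U :: real^'r^'m))\<^sup>2 = (\<Sum>k\<in>UNIV. (norm (column k U))\<^sup>2)"
  unfolding norm_power2_rows norm_power2_vec column_def by simp (rule sum.swap)

text \<open>The easy half of the variational formula for the nuclear norm, proved column by
  column.\<close>

lemma inner_mult_transpose_le:
  fixes U :: "real^'r^'m" and V :: "real^'r^'n"
  assumes "op_le Z c" "0 \<le> c"
  shows "Z \<bullet> (U ** transpose V) \<le> c * (((norm U)\<^sup>2 + (norm V)\<^sup>2) / 2)"
proof -
  have "Z \<bullet> (U ** transpose V) = (\<Sum>k\<in>UNIV. column k U \<bullet> (Z *v column k V))"
    by (simp add: mult_transpose_eq_sum_outer inner_sum_right inner_outer_right)
  also have "\<dots> \<le> (\<Sum>k\<in>UNIV. c * (((norm (column k U))\<^sup>2 + (norm (column k V))\<^sup>2) / 2))"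
  proof (intro sum_mono order_trans[OF op_leD[OF assms(1)]] mult_left_mono assms(2))
    fix k
    show "norm (column k U) * norm (column k V) \<le> ((norm (column k U))\<^sup>2 + (norm (column k V))\<^sup>2) / 2"
      using zero_le_power2[of "norm (column k U) - norm (column k V)"]
      by (simp add: power2_eq_square algebra_simps)
  qed
  also have "\<dots> = c * (((norm U)\<^sup>2 + (norm V)\<^sup>2) / 2)"
    by (simp add: norm_power2_columns[of U] norm_power2_columns[of V] sum.distrib
        flip: sum_distrib_left sum_divide_distrib)
  finally show ?thesis .
qed

text \<open>For balanced factors \<open>S = U U\<^sup>T\<close> is the positive semidefinite square
  root of \<open>X X\<^sup>T\<close>. The defect \<open>e\<close> satisfies
  \<open>S e = - \<tau> i e\<close>, which positivity of \<open>S\<close> allows only for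
  \<open>e = 0\<close>.\<close>

lemma balanced_left_singular:
  fixes U :: "real^'r^'m" and V :: "real^'r^'n"
  assumes bal: "\<And>z w. (U *v z) \<bullet> (U *v w) = (V *v z) \<bullet> (V *v w)"
    and X: "svd n \<tau> q p (U ** transpose V)" and i: "i < n"
  shows "U *v (transpose U *v q i) = \<tau> i *\<^sub>R q i"
proof -
  have \<tau>: "\<tau> i > 0" using X i by (simp add: svd_def)
  have UV: "transpose V *v (V *v z) = transpose U *v (U *v z)" for z
    using bal by (intro vector_eq_ldot[THEN iffD1]) (simp add: inner_transpose_mult)
  define S where "S x = U *v (transpose U *v x)" for x
  have "transpose (U ** transpose V) = V ** transpose U" by (simp add: matrix_transpose_mul)
  then have "V *v (transpose U *v q i) = \<tau> i *\<^sub>R p i"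
    using svd_left[OF X i] by (simp add: matrix_vector_mul_assoc[symmetric])
  then have "U *v (transpose V *v (V *v (transpose U *v q i))) = (\<tau> i * \<tau> i) *\<^sub>R q i"
    using svd_right[OF X i] by (simp add: matrix_vector_mul_assoc[symmetric] matrix_vector_mult_scaleR)
  then have SS: "S (S (q i)) = (\<tau> i * \<tau> i) *\<^sub>R q i" by (simp add: S_def UV)
  define e where "e = S (q i) - \<tau> i *\<^sub>R q i"
  have "S e = S (S (q i)) - \<tau> i *\<^sub>R S (q i)"
    by (simp add: e_def S_def matrix_vector_mult_diff_distrib matrix_vector_mult_scaleR)
  then have "S e = - \<tau> i *\<^sub>R e" by (simp add: SS e_def algebra_simps)
  moreover have "e \<bullet> S e = (transpose U *v e) \<bullet> (transpose U *v e)"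
    unfolding S_def by (rule inner_matrix_mult_vec)
  then have "0 \<le> e \<bullet> S e" by simp
  ultimately have "\<tau> i * (e \<bullet> e) \<le> 0" by simp
  then have "e \<bullet> e \<le> 0" using \<tau> by (simp add: mult_le_0_iff)
  then have "e = 0" by (metis inner_ge_zero inner_eq_zero_iff order_antisym)
  then show ?thesis by (simp add: e_def S_def)
qed

theorem error_bound_second_order_critical:
  fixes A :: "real^'n^'m \<Rightarrow> real^'k" and M :: "real^'n^'m" and U :: "real^'r^'m" and V :: "real^'r^'n"
  assumes A: "linear A" and rM: "1 \<le> rank M" "rank M \<le> CARD('r)"
    and k: "CARD('r) + rank M \<le> k" and RIP: "RIP k \<delta> A"
    and \<delta>: "\<delta> < delta_crit CARD('r) (rank M)" and lam: "0 \<le> lam"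
    and crit: "second_order_critical (objective A (A M + \<xi>) lam) (U, V)"
  shows "norm (U ** transpose V - M) \<le> error_bound CARD('r) (rank M) \<delta> lam (op_norm (adjoint A \<xi>))"
proof -
  define X where "X = U ** transpose V"
  define R where "R = A X - (A M + \<xi>)"
  define G where "G = adjoint A R"
  define \<Xi> where "\<Xi> = adjoint A \<xi>"
  have GR: "R \<bullet> A E = G \<bullet> E" for E
    by (metis G_def adjoint_works[OF A] inner_commute)
  have \<Xi>A: "\<xi> \<bullet> A E = \<Xi> \<bullet> E" for E
    by (metis \<Xi>_def adjoint_works[OF A] inner_commute)
  have G: "G \<bullet> E = A (X - M) \<bullet> A E - \<Xi> \<bullet> E" for E
    unfolding GR[symmetric] \<Xi>A[symmetric] R_def linear_diff[OF A] by (simp add: inner_simps)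
  have \<Xi>: "op_le \<Xi> (op_norm \<Xi>)" by (rule op_le_op_norm)
  have F: "G \<bullet> (U ** transpose B + C ** transpose V) + lam * (U \<bullet> C + V \<bullet> B) = 0" for B C
    using crit[unfolded second_order_critical_objective_iff[OF A]]
    by (simp add: X_def[symmetric] R_def[symmetric] GR)
  have H: "0 \<le> (norm (A (U ** transpose B + C ** transpose V)))\<^sup>2 + 2 * (G \<bullet> (C ** transpose B))
      + lam * ((norm C)\<^sup>2 + (norm B)\<^sup>2)" for B C
    using crit[unfolded second_order_critical_objective_iff[OF A]]
    by (simp add: X_def[symmetric] R_def[symmetric] GR)
  have F1: "G *v (V *v z) = - lam *\<^sub>R (U *v z)" for z
  proof (rule vector_eq_ldot[THEN iffD1], intro allI)
    fix x
    show "x \<bullet> (G *v (V *v z)) = x \<bullet> (- lam *\<^sub>R (U *v z))"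
      using F[of 0 "outer x z"]
      by (simp add: outer_matrix_mult inner_outer_right transpose_def[of 0] zero_vec_def[symmetric])
  qed
  have F2: "transpose G *v (U *v z) = - lam *\<^sub>R (V *v z)" for z
  proof (rule vector_eq_ldot[THEN iffD1], intro allI)
    fix x
    show "x \<bullet> (transpose G *v (U *v z)) = x \<bullet> (- lam *\<^sub>R (V *v z))"
      using F[of "outer x z" 0]
      by (simp add: matrix_mult_outer inner_outer_right inner_transpose_mult inner_commute)
  qed
  \<comment> \<open>Rank-one perturbations \<open>x z\<^sup>T\<close> of \<open>U\<close> and
    \<open>y w\<^sup>T\<close> of \<open>V\<close>. Keeping \<open>z\<close> and \<open>w\<close>
    apart allows different scalings of the two factors.\<close>
  have S: "0 \<le> (norm (A (outer (U *v w) y + outer x (V *v z))))\<^sup>2 + 2 * ((z \<bullet> w) * (x \<bullet> (G *v y)))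
      + lam * ((norm x)\<^sup>2 * (norm z)\<^sup>2 + (norm y)\<^sup>2 * (norm w)\<^sup>2)" for w x y z
    using H[of "outer y w" "outer x z"]
    by (simp add: matrix_mult_outer outer_matrix_mult inner_outer_right norm_outer power_mult_distrib
        matrix_vector_mult_scaleR inner_commute)
  \<comment> \<open>Both first-order conditions evaluate the same bilinear form; a positive
    \<open>lam\<close> can be cancelled.\<close>
  have bal: "(U *v z) \<bullet> (U *v w) = (V *v z) \<bullet> (V *v w)" if "lam > 0" for z w
  proof -
    have "(U *v z) \<bullet> (G *v (V *v w)) = (transpose G *v (U *v z)) \<bullet> (V *v w)"
      by (rule inner_matrix_mult_vec)
    then show ?thesis using that by (simp add: F1 F2)
  qed
  have GX: "Z \<bullet> X \<le> - (G \<bullet> X)" if "op_le Z lam" for Z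
  proof -
    have "- (G \<bullet> X) = lam * (((norm U)\<^sup>2 + (norm V)\<^sup>2) / 2)"
      using F[of V 0] F[of 0 U] by (simp add: X_def power2_norm_eq_inner transpose_def[of 0] zero_vec_def[symmetric]
          distrib_left)
    then show ?thesis using inner_mult_transpose_le[OF that lam, of U V] by (simp add: X_def)
  qed
  have rX: "rank X \<le> CARD('r)"
    unfolding X_def using rank_mul_le_left[of U "transpose V"] rank_bound[of U] by simp
  show ?thesis
  proof (cases "rank X = CARD('r)")
    case True
    obtain \<tau> q p where sv: "svd (CARD('r)) \<tau> q p X" using svd_exists[of X] True by metis
    have \<tau>: "\<tau> i > 0" and nq: "norm (q i) = 1" and np: "norm (p i) = 1"
      if "i < CARD('r)" for i
      using sv that orthonormal_upto_norm by (auto simp: svd_def)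
    have Xt: "transpose X = V ** transpose U" by (simp add: X_def matrix_transpose_mul)
    have VU: "V *v (transpose U *v q i) = \<tau> i *\<^sub>R p i" and UV: "U *v (transpose V *v p i) = \<tau> i *\<^sub>R q i"
      if "i < CARD('r)" for i
      using svd_left[OF sv that] svd_right[OF sv that]
      by (simp_all add: Xt matrix_vector_mul_assoc) (simp add: X_def)
    \<comment> \<open>For \<open>lam = 0\<close> the factors need not be balanced; the prefactor
      \<open>lam\<close> makes the identities hold in either case, and they are needed only with
      it.\<close>
    have UU: "lam *\<^sub>R (U *v (transpose U *v q i)) = (lam * \<tau> i) *\<^sub>R q i"
      and VV: "lam *\<^sub>R (V *v (transpose V *v p i)) = (lam * \<tau> i) *\<^sub>R p i" if "i < CARD('r)" for i
    proof -
      show "lam *\<^sub>R (U *v (transpose U *v q i)) = (lam * \<tau> i) *\<^sub>R q i"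
        using balanced_left_singular[OF bal sv[unfolded X_def] that] lam
        by (cases "lam = 0") (auto simp flip: scaleR_scaleR)
      show "lam *\<^sub>R (V *v (transpose V *v p i)) = (lam * \<tau> i) *\<^sub>R p i"
        using balanced_left_singular[OF bal[symmetric] svd_transpose[OF sv, unfolded Xt] that] lam
        by (cases "lam = 0") (auto simp flip: scaleR_scaleR)
    qed
    show ?thesis
      unfolding X_def[symmetric] \<Xi>_def[symmetric]
    proof (rule error_bound_full_rank[OF A RIP k sv rM G _ _ _ lam \<Xi> \<delta>])
      fix i assume i: "i < CARD('r)"
      have "\<tau> i *\<^sub>R (G *v p i) = \<tau> i *\<^sub>R (- lam *\<^sub>R q i)"
        using F1[of "transpose U *v q i"] UU[OF i]
        by (simp add: VU[OF i] matrix_vector_mult_scaleR mult.commute)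
      then show "G *v p i = - lam *\<^sub>R q i"
        using \<tau>[OF i] by (metis less_irrefl scaleR_cancel_left)
      have "\<tau> i *\<^sub>R (transpose G *v q i) = \<tau> i *\<^sub>R (- lam *\<^sub>R p i)"
        using F2[of "transpose V *v p i"] VV[OF i]
        by (simp add: UV[OF i] matrix_vector_mult_scaleR mult.commute)
      then show "transpose G *v q i = - lam *\<^sub>R p i"
        using \<tau>[OF i] by (metis less_irrefl scaleR_cancel_left)
      fix x :: "real^'m" and y :: "real^'n" assume x: "norm x = 1" and y: "norm y = 1"
      define t where "t = sqrt (\<tau> i)"
      have t: "t > 0" "t * t = \<tau> i" "t\<^sup>2 = \<tau> i" using \<tau>[OF i] by (simp_all add: t_def)
      \<comment> \<open>Factor-space vectors with \<open>U ?w = t q i\<close>,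
        \<open>V ?z = t p i\<close> and \<open>?z \<bullet> ?w = 1\<close>. Without balance their
        norms are unknown, but then \<open>lam = 0\<close> removes them.\<close>
      let ?z = "(1 / t) *\<^sub>R (transpose U *v q i)" and ?w = "(1 / t) *\<^sub>R (transpose V *v p i)"
      have 1: "U *v ?w = t *\<^sub>R q i" "V *v ?z = t *\<^sub>R p i"
        using t by (simp_all add: matrix_vector_mult_scaleR VU[OF i] UV[OF i]) (simp_all add: field_simps)
      have "(transpose U *v q i) \<bullet> (transpose V *v p i) = \<tau> i"
        using inner_transpose_mult[of "transpose V *v p i" U "q i"] nq[OF i]
        by (simp add: UV[OF i] inner_commute norm_eq_1)
      then have 2: "?z \<bullet> ?w = 1" using t \<tau>[OF i] by (simp add: field_simps)
      have "(transpose U *v q i) \<bullet> (transpose U *v q i) = (U *v (transpose U *v q i)) \<bullet> q i"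
        by (rule inner_transpose_mult)
      then have "lam * ((transpose U *v q i) \<bullet> (transpose U *v q i)) = lam * \<tau> i"
        using UU[OF i] nq[OF i] by (metis inner_scaleR_left mult.right_neutral norm_eq_1)
      then have 3: "lam * (norm ?z)\<^sup>2 = lam"
        using t \<tau>[OF i] by (simp add: power2_norm_eq_inner field_simps)
      have "(transpose V *v p i) \<bullet> (transpose V *v p i) = (V *v (transpose V *v p i)) \<bullet> p i"
        by (rule inner_transpose_mult)
      then have "lam * ((transpose V *v p i) \<bullet> (transpose V *v p i)) = lam * \<tau> i"
        using VV[OF i] np[OF i] by (metis inner_scaleR_left mult.right_neutral norm_eq_1)
      then have 4: "lam * (norm ?w)\<^sup>2 = lam"
        using t \<tau>[OF i] by (simp add: power2_norm_eq_inner field_simps)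
      have "outer (t *\<^sub>R q i) y + outer x (t *\<^sub>R p i) = t *\<^sub>R (outer (q i) y + outer x (p i))"
        by (simp add: outer_def vec_eq_iff algebra_simps)
      then show "0 \<le> (norm (A (sqrt (\<tau> i) *\<^sub>R (outer (q i) y + outer x (p i)))))\<^sup>2 + 2 * (x \<bullet> (G *v y)) + 2 * lam"
        using S[of ?w y x ?z] unfolding 1 2 x y power_one mult_1 distrib_left 3 4
        by (simp add: t_def[symmetric])
    qed
  next
    case False
    \<comment> \<open>A unit vector \<open>e\<close> killed by one factor lets that factor be
      perturbed along \<open>e\<close> at little or no cost in curvature.\<close>
    have "\<not> (inj ((*v) U) \<and> inj ((*v) V))"
    proof
      assume inj: "inj ((*v) U) \<and> inj ((*v) V)"
      have "range ((*v) X) = (*v) U ` range ((*v) (transpose V))"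
        by (auto simp: X_def matrix_vector_mul_assoc[symmetric] image_iff)
      moreover have "inj_on ((*v) U) (span (range ((*v) (transpose V))))"
        using inj inj_on_subset by blast
      then have "dim ((*v) U ` range ((*v) (transpose V))) = dim (range ((*v) (transpose V)))"
        by (intro dim_image_eq) simp_all
      ultimately have "rank X = rank (transpose V)" by (simp add: rank_dim_range)
      also have "\<dots> = CARD('r)" using inj by (simp add: rank_transpose full_rank_injective)
      finally show False using False by simp
    qed
    then obtain w where w: "w \<noteq> 0" "U *v w = 0 \<or> V *v w = 0"
      by (meson linear_injective_0 matrix_vector_mul_linear)
    define e where "e = w /\<^sub>R norm w"
    have e: "norm e = 1" "U *v e = 0 \<or> V *v e = 0"
      using w by (auto simp: e_def matrix_vector_mult_scaleR)
    have "op_le G lam"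
    proof (rule op_le_unitI)
      fix x :: "real^'m" and y :: "real^'n" assume x: "norm x = 1" and y: "norm y = 1"
      let ?g = "x \<bullet> (G *v y)"
      have S': "2 * (t * s * ?g) \<le> (norm (A (outer (U *v (s *\<^sub>R e)) y + outer (- x) (V *v (t *\<^sub>R e)))))\<^sup>2
          + lam * (t\<^sup>2 + s\<^sup>2)" for t s
        using S[of "s *\<^sub>R e" y "- x" "t *\<^sub>R e"] x y e(1)
        by (simp add: norm_eq_1 power_mult_distrib mult_ac)
      show "?g \<le> lam"
      proof (cases "lam = 0")
        case False
        then have "U *v e = 0" "V *v e = 0"
          using e(2) bal[of e e] lam by auto
        then show ?thesis
          using S'[of 1 1] by (simp add: outer_def zero_vec_def[symmetric] linear_0[OF A])
      next
        case True
        show ?thesis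
        proof (rule ccontr)
          assume "\<not> ?g \<le> lam"
          then have g: "?g > 0" using True by simp
          \<comment> \<open>Only one factor is known to kill \<open>e\<close>. Scaling the
            perturbation by \<open>s\<close> then leaves the curvature term unchanged, while the
            cross term grows linearly in \<open>s\<close>.\<close>
          have "\<exists>K. \<forall>s. s * ?g \<le> K"
            using e(2)
          proof
            assume "U *v e = 0"
            then have "2 * (s * ?g) \<le> (norm (A (outer (- x) (V *v e))))\<^sup>2" for s
              using S'[of 1 s] True by (simp add: matrix_vector_mult_scaleR outer_def zero_vec_def[symmetric])
            then show ?thesis by (intro exI[of _ "(norm (A (outer (- x) (V *v e))))\<^sup>2 / 2"]) (simp add: mult.commute)
          next
            assume "V *v e = 0"
            then have "2 * (s * ?g) \<le> (norm (A (outer (U *v e) y)))\<^sup>2" for s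
              using S'[of s 1] True by (simp add: matrix_vector_mult_scaleR outer_def zero_vec_def[symmetric])
            then show ?thesis by (intro exI[of _ "(norm (A (outer (U *v e) y)))\<^sup>2 / 2"]) (simp add: mult.commute)
          qed
          then obtain K where "\<And>s. s * ?g \<le> K" by blast
          from this[of "(K + 1) / ?g"] g show False by simp
        qed
      qed
    qed
    then show ?thesis
      unfolding X_def[symmetric] \<Xi>_def[symmetric]
      by (intro error_bound_rank_deficient[OF A RIP k rX rM G _ GX lam \<Xi> \<delta>])
  qed
qed

subsection \<open>Sharpness\<close>

text \<open>\<open>T\<close> stretches by \<open>sqrt (1 - \<delta>)\<close> along \<open>w\<close>
  and by \<open>sqrt (1 + \<delta>)\<close> on its complement, up to \<open>sqrt \<gamma>\<close>;
  the isometry \<open>J\<close> moves this into measurement space, which is where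
  \<open>card\<close> is needed.\<close>

lemma measurement_exists:
  fixes w :: "real^'n^'m"
  assumes card: "CARD('m) * CARD('n) \<le> CARD('k)" and w: "norm w = 1"
    and \<gamma>: "0 \<le> \<gamma>" and \<delta>: "0 \<le> \<delta>" "\<delta> \<le> 1"
  obtains A :: "real^'n^'m \<Rightarrow> real^'k"
  where "linear A" "\<And>E F. A E \<bullet> A F = \<gamma> * ((1 + \<delta>) * (E \<bullet> F) - 2 * \<delta> * (w \<bullet> E) * (w \<bullet> F))"
proof -
  have "dim (UNIV :: (real^'n^'m) set) \<le> dim (UNIV :: (real^'k) set)"
    using card by (simp add: mult.commute)
  then obtain J :: "real^'n^'m \<Rightarrow> real^'k"
    where J: "linear J" and Jn: "\<And>x. x \<in> UNIV \<Longrightarrow> norm (J x) = norm x"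
    using isometry_subset_subspace[OF subspace_UNIV subspace_UNIV] by metis
  have Ji: "J x \<bullet> J y = x \<bullet> y" for x y
    using Jn by (simp add: dot_norm linear_add[OF J, symmetric])
  define b where "b = sqrt (1 - \<delta>) - sqrt (1 + \<delta>)"
  define T where "T E = sqrt \<gamma> *\<^sub>R (sqrt (1 + \<delta>) *\<^sub>R E + (b * (w \<bullet> E)) *\<^sub>R w)" for E
  have T: "linear T"
    by (rule linearI) (simp_all add: T_def inner_simps algebra_simps)
  have b: "2 * (sqrt (1 + \<delta>) * b) + b * b = - 2 * \<delta>"
    using \<delta> by (simp add: b_def algebra_simps)
  have TT: "T E \<bullet> T F = \<gamma> * ((1 + \<delta>) * (E \<bullet> F) - 2 * \<delta> * (w \<bullet> E) * (w \<bullet> F))" for E F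
  proof -
    have "T E \<bullet> T F = sqrt \<gamma> * sqrt \<gamma> * (sqrt (1 + \<delta>) * sqrt (1 + \<delta>) * (E \<bullet> F)
        + (2 * (sqrt (1 + \<delta>) * b) + b * b * (w \<bullet> w)) * ((w \<bullet> E) * (w \<bullet> F)))"
      by (simp add: T_def inner_simps inner_commute algebra_simps del: real_sqrt_mult_self)
    also have "\<dots> = \<gamma> * ((1 + \<delta>) * (E \<bullet> F) + (2 * (sqrt (1 + \<delta>) * b) + b * b) * ((w \<bullet> E) * (w \<bullet> F)))"
      using w \<gamma> \<delta> by (simp add: norm_eq_1)
    finally show ?thesis by (simp add: b)
  qed
  show ?thesis
    using that[of "J \<circ> T"] linear_compose[OF T J] Ji TT by simp
qed

lemma op_norm_le: "op_le B c \<Longrightarrow> 0 \<le> c \<Longrightarrow> op_norm B \<le> c"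
  unfolding op_norm_def
proof (rule onorm_bound)
  fix x assume B: "op_le B c" and c: "0 \<le> c"
  have "norm (B *v x) * norm (B *v x) \<le> norm (B *v x) * (c * norm x)"
    using op_leD[OF B, of "B *v x" x] by (simp add: power2_norm_eq_inner[symmetric] power2_eq_square mult_ac)
  then show "norm (B *v x) \<le> c * norm x"
    using c by (cases "norm (B *v x) = 0") (auto simp: mult_le_cancel_left)
qed

text \<open>
  \<open>X\<close> is supported on the positions \<open>(a k, a' k)\<close> and \<open>M\<close> on the positions \<open>(c t, c' t)\<close>. Indexing
  the latter by a set \<open>S\<close> of factor columns lets \<open>M\<close> be factored through the same type \<open>'r\<close>.
\<close>

locale block_model =
  fixes a :: "'r::finite \<Rightarrow> 'm::finite" and a' :: "'r \<Rightarrow> 'n::finite"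
    and c :: "'r \<Rightarrow> 'm" and c' :: "'r \<Rightarrow> 'n" and S :: "'r set"
  assumes inj: "inj a" "inj a'" "inj_on c S" "inj_on c' S"
    and disj: "range a \<inter> c ` S = {}" "range a' \<inter> c' ` S = {}"
    and ne: "S \<noteq> {}"
begin

definition PX :: "real^'n^'m" where
  "PX = (\<Sum>k\<in>UNIV. outer (axis (a k) 1) (axis (a' k) 1))"

definition PM :: "real^'n^'m" where
  "PM = (\<Sum>t\<in>S. outer (axis (c t) 1) (axis (c' t) 1))"

text \<open>The ratio of the norms of \<open>PM\<close> and \<open>PX\<close>.\<close>

definition rho :: real where
  "rho = sqrt (real (card S) / real CARD('r))"

definition w :: "real^'n^'m" where
  "w = (1 / sqrt (2 * CARD('r))) *\<^sub>R PX - (1 / sqrt (2 * card S)) *\<^sub>R PM"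

definition U :: "real \<Rightarrow> real^'r^'m" where
  "U \<sigma> = (\<chi> i k. if i = a k then sqrt \<sigma> else 0)"

definition V :: "real \<Rightarrow> real^'r^'n" where
  "V \<sigma> = (\<chi> i k. if i = a' k then sqrt \<sigma> else 0)"

text \<open>With \<open>V0\<close>, an exact factorisation of \<open>PM\<close> whose columns
  outside \<open>S\<close> are zero: the competitor that rules out global minimality.\<close>

definition U0 :: "real^'r^'m" where
  "U0 = (\<chi> i k. if k \<in> S \<and> i = c k then 1 else 0)"

definition V0 :: "real^'r^'n" where
  "V0 = (\<chi> i k. if k \<in> S \<and> i = c' k then 1 else 0)"

lemma card_S: "0 < card S" "card S \<le> CARD('r)"
  using ne by (auto simp: card_gt_0_iff card_mono)

lemma rho: "0 < rho" "rho \<le> 1"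
  using card_S by (auto simp: rho_def)

lemma ac: "a k = a l \<longleftrightarrow> k = l" "a' k = a' l \<longleftrightarrow> k = l"
  "t \<in> S \<Longrightarrow> a k \<noteq> c t" "t \<in> S \<Longrightarrow> a' k \<noteq> c' t"
  "t \<in> S \<Longrightarrow> u \<in> S \<Longrightarrow> c t = c u \<longleftrightarrow> t = u" "t \<in> S \<Longrightarrow> u \<in> S \<Longrightarrow> c' t = c' u \<longleftrightarrow> t = u"
proof -
  show "a k \<noteq> c t" if "t \<in> S" using disj(1) that by blast
  show "a' k \<noteq> c' t" if "t \<in> S" using disj(2) that by blast
qed (use inj in \<open>auto simp: inj_def inj_on_def\<close>)

lemma sum_blocks_le:
  fixes f :: "'m \<Rightarrow> real"
  assumes "\<And>i. 0 \<le> f i"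
  shows "(\<Sum>k\<in>UNIV. f (a k)) + (\<Sum>t\<in>S. f (c t)) \<le> (\<Sum>i\<in>UNIV. f i)"
proof -
  have "(\<Sum>k\<in>UNIV. f (a k)) + (\<Sum>t\<in>S. f (c t)) = sum f (range a) + sum f (c ` S)"
    using inj by (simp add: sum.reindex)
  also have "\<dots> = sum f (range a \<union> c ` S)" using disj by (simp add: sum.union_disjoint)
  also have "\<dots> \<le> sum f UNIV" using assms by (intro sum_mono2) auto
  finally show ?thesis .
qed

lemma sum_blocks_le':
  fixes f :: "'n \<Rightarrow> real"
  assumes "\<And>i. 0 \<le> f i"
  shows "(\<Sum>k\<in>UNIV. f (a' k)) + (\<Sum>t\<in>S. f (c' t)) \<le> (\<Sum>i\<in>UNIV. f i)"
proof -
  have "(\<Sum>k\<in>UNIV. f (a' k)) + (\<Sum>t\<in>S. f (c' t)) = sum f (range a') + sum f (c' ` S)"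
    using inj by (simp add: sum.reindex)
  also have "\<dots> = sum f (range a' \<union> c' ` S)" using disj by (simp add: sum.union_disjoint)
  also have "\<dots> \<le> sum f UNIV" using assms by (intro sum_mono2) auto
  finally show ?thesis .
qed

lemma axis_mult_axis: "axis i 1 \<bullet> (D *v axis j 1) = D $ i $ j" for D :: "real^'n^'m"
  by (simp add: inner_axis' matrix_vector_mult_basis column_def)

lemma inner_PX: "PX \<bullet> D = (\<Sum>k\<in>UNIV. D $ a k $ a' k)"
  by (simp add: PX_def inner_sum_left inner_outer axis_mult_axis)

lemma inner_PM: "PM \<bullet> D = (\<Sum>t\<in>S. D $ c t $ c' t)"
  by (simp add: PM_def inner_sum_left inner_outer axis_mult_axis)

lemma PX_nth: "PX $ i $ j = (\<Sum>k\<in>UNIV. if i = a k \<and> j = a' k then 1 else 0)"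
  by (simp add: PX_def outer_def axis_def if_distrib cong: if_cong) (intro sum.cong, auto)

lemma PM_nth: "PM $ i $ j = (\<Sum>t\<in>S. if i = c t \<and> j = c' t then 1 else 0)"
  by (simp add: PM_def outer_def axis_def if_distrib cong: if_cong) (intro sum.cong, auto)

lemma PX_PX: "PX \<bullet> PX = CARD('r)"
  by (simp add: inner_PX PX_nth ac)

lemma PX_PM: "PX \<bullet> PM = 0" "PM \<bullet> PX = 0"
  by (simp_all add: inner_PX inner_PM PM_nth PX_nth ac ac(3)[THEN not_sym] cong: sum.cong)

lemma PM_PM: "PM \<bullet> PM = card S"
proof -
  have "PM $ c t $ c' t = 1" if "t \<in> S" for t
  proof -
    have "PM $ c t $ c' t = (\<Sum>u\<in>S. if t = u then 1 else 0)"
      unfolding PM_nth using that by (intro sum.cong) (auto simp: ac)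
    then show ?thesis using that by simp
  qed
  then show ?thesis by (simp add: inner_PM)
qed

lemma norm_w: "norm w = 1"
  using card_S ne
  by (simp add: norm_eq_1 w_def inner_simps PX_PX PX_PM PM_PM)

text \<open>Of the two pure blocks only the diagonals are kept, since \<open>w\<close> sees nothing
  else there; the mixed blocks are kept entirely.\<close>

lemma block_norm_le:
  fixes D :: "real^'n^'m"
  shows "(\<Sum>k\<in>UNIV. (D $ a k $ a' k)\<^sup>2) + (\<Sum>t\<in>S. (D $ c t $ c' t)\<^sup>2)
    + (\<Sum>t\<in>S. (\<Sum>k\<in>UNIV. (D $ a k $ c' t)\<^sup>2) + (\<Sum>k\<in>UNIV. (D $ c t $ a' k)\<^sup>2)) \<le> (norm D)\<^sup>2"
proof -
  have row: "(\<Sum>k\<in>UNIV. (D $ i $ a' k)\<^sup>2) + (\<Sum>t\<in>S. (D $ i $ c' t)\<^sup>2) \<le> (norm (D $ i))\<^sup>2" for i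
    unfolding norm_power2_vec by (rule sum_blocks_le') simp
  have "(D $ a k $ a' k)\<^sup>2 + (\<Sum>t\<in>S. (D $ a k $ c' t)\<^sup>2) \<le> (norm (D $ a k))\<^sup>2" for k
    using row[of "a k"] member_le_sum[of k UNIV "\<lambda>k'. (D $ a k $ a' k')\<^sup>2"] by simp
  then have 1: "(\<Sum>k\<in>UNIV. (D $ a k $ a' k)\<^sup>2 + (\<Sum>t\<in>S. (D $ a k $ c' t)\<^sup>2)) \<le> (\<Sum>k\<in>UNIV. (norm (D $ a k))\<^sup>2)"
    by (intro sum_mono) simp
  have "(D $ c t $ c' t)\<^sup>2 + (\<Sum>k\<in>UNIV. (D $ c t $ a' k)\<^sup>2) \<le> (norm (D $ c t))\<^sup>2" if "t \<in> S" for t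
    using row[of "c t"] member_le_sum[of t S "\<lambda>t'. (D $ c t $ c' t')\<^sup>2"] that by simp
  then have 2: "(\<Sum>t\<in>S. (D $ c t $ c' t)\<^sup>2 + (\<Sum>k\<in>UNIV. (D $ c t $ a' k)\<^sup>2)) \<le> (\<Sum>t\<in>S. (norm (D $ c t))\<^sup>2)"
    by (intro sum_mono) simp
  have 3: "(\<Sum>k\<in>UNIV. \<Sum>t\<in>S. (D $ a k $ c' t)\<^sup>2) = (\<Sum>t\<in>S. \<Sum>k\<in>UNIV. (D $ a k $ c' t)\<^sup>2)"
    by (rule sum.swap)
  show ?thesis
    using 1 2 3 sum_blocks_le[of "\<lambda>i. (norm (D $ i))\<^sup>2"]
    unfolding norm_power2_rows by (simp add: sum.distrib)
qed

end

text \<open>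
  The measurement operators of the counterexamples: \<open>A\<^sup>*A\<close> is a multiple of the identity except
  in the direction \<open>w\<close>, so it leaves the plane spanned by \<open>PX\<close> and \<open>PM\<close> invariant.
\<close>

locale block_measurement = block_model a a' c c' S
  for a :: "'r::finite \<Rightarrow> 'm::finite" and a' :: "'r \<Rightarrow> 'n::finite" and c c' S +
  fixes A :: "real^'n^'m \<Rightarrow> real^'k" and \<gamma> \<delta> :: real
  assumes A: "linear A" and \<gamma>: "0 < \<gamma>" and \<delta>: "0 \<le> \<delta>" "\<delta> < 1"
    and AA: "\<And>E F. A E \<bullet> A F = \<gamma> * ((1 + \<delta>) * (E \<bullet> F) - 2 * \<delta> * (w \<bullet> E) * (w \<bullet> F))"
begin

lemma norm_A: "(norm (A E))\<^sup>2 = \<gamma> * ((1 + \<delta>) * (norm E)\<^sup>2 - 2 * \<delta> * (w \<bullet> E)\<^sup>2)"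
  by (simp add: power2_norm_eq_inner AA) (simp add: power2_eq_square)

lemma w_le: "(w \<bullet> E)\<^sup>2 \<le> (norm E)\<^sup>2"
  using Cauchy_Schwarz_ineq2[of w E] norm_w by (simp add: abs_le_square_iff[symmetric])

lemma norm_A_bounds:
  "\<gamma> * (1 - \<delta>) * (norm E)\<^sup>2 \<le> (norm (A E))\<^sup>2" "(norm (A E))\<^sup>2 \<le> \<gamma> * (1 + \<delta>) * (norm E)\<^sup>2"
proof -
  have "\<gamma> * (2 * \<delta> * (w \<bullet> E)\<^sup>2) \<le> \<gamma> * (2 * \<delta> * (norm E)\<^sup>2)"
    using \<gamma> \<delta> w_le by (intro mult_left_mono) auto
  then show "\<gamma> * (1 - \<delta>) * (norm E)\<^sup>2 \<le> (norm (A E))\<^sup>2"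
    by (simp add: norm_A algebra_simps)
  show "(norm (A E))\<^sup>2 \<le> \<gamma> * (1 + \<delta>) * (norm E)\<^sup>2"
    using \<gamma> \<delta> by (simp add: norm_A algebra_simps)
qed

lemma A_pos: "E \<noteq> 0 \<Longrightarrow> 0 < norm (A E)"
proof -
  assume "E \<noteq> 0"
  then have "0 < \<gamma> * (1 - \<delta>) * (norm E)\<^sup>2" using \<gamma> \<delta> by simp
  also note norm_A_bounds(1)
  finally show ?thesis by simp
qed

text \<open>The matrix of \<open>A\<^sup>*A / \<gamma>\<close> on this plane has diagonal entries 1;
  the off-diagonal \<open>\<delta>\<close> becomes \<open>\<delta> * rho\<close> and
  \<open>\<delta> / rho\<close> because \<open>PX\<close> and \<open>PM\<close> are not
  normalised.\<close>

lemma AA_plane: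
  "A (f1 *\<^sub>R PX + f2 *\<^sub>R PM) \<bullet> A D
    = \<gamma> * ((f1 + \<delta> * rho * f2) * (PX \<bullet> D) + (\<delta> * f1 / rho + f2) * (PM \<bullet> D))"
proof -
  define r m where "r = sqrt (CARD('r))" and "m = sqrt (card S)"
  have r: "r > 0" "m > 0" "real CARD('r) = r * r" "real (card S) = m * m" "rho = m / r"
    using card_S by (simp_all add: r_def m_def rho_def real_sqrt_divide)
  have w: "w \<bullet> E = (1 / sqrt 2) * ((PX \<bullet> E) / r - (PM \<bullet> E) / m)" for E
    by (simp add: w_def inner_simps r_def m_def real_sqrt_mult field_simps)
  have wF: "2 * \<delta> * (w \<bullet> (f1 *\<^sub>R PX + f2 *\<^sub>R PM)) * (w \<bullet> D)
      = \<delta> * (f1 * r - f2 * m) * ((PX \<bullet> D) / r - (PM \<bullet> D) / m)"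
    unfolding w using r(1,2) by (simp add: inner_simps PX_PX PX_PM PM_PM r(3,4))
  have F: "(f1 *\<^sub>R PX + f2 *\<^sub>R PM) \<bullet> D = f1 * (PX \<bullet> D) + f2 * (PM \<bullet> D)"
    by (simp add: inner_simps)
  show ?thesis
    unfolding AA wF F r(5) using r(1,2) by (simp add: field_simps)
qed

text \<open>The mixed blocks are orthogonal to \<open>w\<close> and are stretched by the full
  \<open>1 + \<delta>\<close>, while the rest contributes a nonnegative amount.\<close>

lemma norm_A_ge:
  "\<gamma> * (1 + \<delta>) * (\<Sum>t\<in>S. (\<Sum>k\<in>UNIV. (D $ a k $ c' t)\<^sup>2) + (\<Sum>k\<in>UNIV. (D $ c t $ a' k)\<^sup>2)) \<le> (norm (A D))\<^sup>2"
proof -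
  define x y where "x = (PX \<bullet> D) / sqrt (CARD('r))" and "y = (PM \<bullet> D) / sqrt (card S)"
  have w: "w \<bullet> D = (1 / sqrt 2) * (x - y)"
    by (simp add: w_def inner_simps x_def y_def real_sqrt_mult field_simps)
  then have wD: "2 * (w \<bullet> D)\<^sup>2 = (x - y)\<^sup>2" by (simp add: power_mult_distrib power_divide)
  have "(PX \<bullet> D)\<^sup>2 \<le> (\<Sum>k\<in>UNIV. (D $ a k $ a' k)\<^sup>2) * CARD('r)"
    unfolding inner_PX by (rule sum_squared_le_sum_of_squares)
  then have x: "x\<^sup>2 \<le> (\<Sum>k\<in>UNIV. (D $ a k $ a' k)\<^sup>2)"
    using card_S by (simp add: x_def power_divide divide_le_eq)
  have "(PM \<bullet> D)\<^sup>2 \<le> (\<Sum>t\<in>S. (D $ c t $ c' t)\<^sup>2) * card S"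
    unfolding inner_PM by (rule sum_squared_le_sum_of_squares)
  then have y: "y\<^sup>2 \<le> (\<Sum>t\<in>S. (D $ c t $ c' t)\<^sup>2)"
    using card_S by (simp add: y_def power_divide divide_le_eq)
  let ?o = "\<Sum>t\<in>S. (\<Sum>k\<in>UNIV. (D $ a k $ c' t)\<^sup>2) + (\<Sum>k\<in>UNIV. (D $ c t $ a' k)\<^sup>2)"
  have "\<delta> * (x - y)\<^sup>2 \<le> (1 + \<delta>) * (x\<^sup>2 + \<delta> * y\<^sup>2)"
    using zero_le_power2[of "x + \<delta> * y"] by (simp add: power2_eq_square algebra_simps)
  also have "\<dots> \<le> (1 + \<delta>) * (x\<^sup>2 + y\<^sup>2)"
    using \<delta> mult_right_mono[of \<delta> 1 "y\<^sup>2"] by (intro mult_left_mono) auto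
  also have "\<dots> \<le> (1 + \<delta>) * ((norm D)\<^sup>2 - ?o)"
    using x y block_norm_le[of D] \<delta> by (intro mult_left_mono) auto
  finally have "(1 + \<delta>) * ?o \<le> (1 + \<delta>) * (norm D)\<^sup>2 - \<delta> * (2 * (w \<bullet> D)\<^sup>2)"
    by (simp add: wD algebra_simps)
  then have "\<gamma> * ((1 + \<delta>) * ?o) \<le> \<gamma> * ((1 + \<delta>) * (norm D)\<^sup>2 - \<delta> * (2 * (w \<bullet> D)\<^sup>2))"
    using \<gamma> by (intro mult_left_mono) auto
  then show ?thesis by (simp add: norm_A mult_ac)
qed

end

context block_model
begin

lemma U_mult_nth: "(U \<sigma> ** transpose B) $ a k $ j = sqrt \<sigma> * B $ j $ k"
  "(\<And>k. i \<noteq> a k) \<Longrightarrow> (U \<sigma> ** transpose B) $ i $ j = 0"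
proof -
  have "(U \<sigma> ** transpose B) $ a k $ j = (\<Sum>l\<in>UNIV. if l = k then sqrt \<sigma> * B $ j $ k else 0)"
    unfolding matrix_matrix_mult_def transpose_def vec_lambda_beta
    by (intro sum.cong) (auto simp: U_def ac)
  then show "(U \<sigma> ** transpose B) $ a k $ j = sqrt \<sigma> * B $ j $ k" by simp
  show "(\<And>k. i \<noteq> a k) \<Longrightarrow> (U \<sigma> ** transpose B) $ i $ j = 0"
    by (simp add: matrix_matrix_mult_def transpose_def U_def)
qed

lemma V_mult_nth: "(C ** transpose (V \<sigma>)) $ i $ a' k = sqrt \<sigma> * C $ i $ k"
  "(\<And>k. j \<noteq> a' k) \<Longrightarrow> (C ** transpose (V \<sigma>)) $ i $ j = 0"
proof -
  have "(C ** transpose (V \<sigma>)) $ i $ a' k = (\<Sum>l\<in>UNIV. if l = k then sqrt \<sigma> * C $ i $ k else 0)"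
    unfolding matrix_matrix_mult_def transpose_def vec_lambda_beta
    by (intro sum.cong) (auto simp: V_def ac)
  then show "(C ** transpose (V \<sigma>)) $ i $ a' k = sqrt \<sigma> * C $ i $ k" by simp
  show "(\<And>k. j \<noteq> a' k) \<Longrightarrow> (C ** transpose (V \<sigma>)) $ i $ j = 0"
    by (simp add: matrix_matrix_mult_def transpose_def V_def)
qed

lemma UV: "0 \<le> \<sigma> \<Longrightarrow> U \<sigma> ** transpose (V \<sigma>) = \<sigma> *\<^sub>R PX"
  by (simp add: vec_eq_iff matrix_matrix_mult_def transpose_def U_def V_def PX_nth sum_distrib_left)
    (intro allI sum.cong, auto)

lemma U0V0: "U0 ** transpose V0 = PM"
proof -
  have "(U0 ** transpose V0) $ i $ j = (\<Sum>k\<in>UNIV. if k \<in> S then (if i = c k \<and> j = c' k then 1 else 0) else 0)"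
    for i j
    by (simp add: matrix_matrix_mult_def transpose_def U0_def V0_def) (intro sum.cong, auto)
  then show ?thesis
    by (simp add: vec_eq_iff PM_nth sum.If_cases)
qed

lemma rank_PM: "s \<noteq> 0 \<Longrightarrow> rank (s *\<^sub>R PM) = card S"
proof -
  assume s: "s \<noteq> 0"
  let ?B = "(\<lambda>t. axis (c t) 1 :: real^'m) ` S"
  have PM: "(s *\<^sub>R PM) *v x = (\<Sum>t\<in>S. (s * x $ c' t) *\<^sub>R axis (c t) 1)" for x
    by (simp add: PM_def sum_matrix_vector_mult scaleR_matrix_vector_assoc[symmetric] inner_axis'
        scaleR_sum_right)
  have "axis (c t) 1 \<in> range ((*v) (s *\<^sub>R PM))" if t: "t \<in> S" for t
  proof (rule range_eqI)
    have "(s *\<^sub>R PM) *v axis (c' t) (1 / s) = (\<Sum>u\<in>S. if u = t then axis (c t) 1 else 0)"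
      unfolding PM using t s by (intro sum.cong) (auto simp: axis_def ac)
    then show "axis (c t) 1 = (s *\<^sub>R PM) *v axis (c' t) (1 / s)" using t by simp
  qed
  then have "?B \<subseteq> range ((*v) (s *\<^sub>R PM))" by auto
  moreover have "range ((*v) (s *\<^sub>R PM)) \<subseteq> span ?B"
  proof (intro subsetI, elim rangeE)
    fix y x assume y: "y = (s *\<^sub>R PM) *v x"
    show "y \<in> span ?B" unfolding y PM by (intro span_sum span_scale span_base) auto
  qed
  moreover have "independent ?B"
    by (rule independent_mono[OF independent_Basis]) (auto simp: Basis_vec_def)
  ultimately have "dim (range ((*v) (s *\<^sub>R PM))) = card ?B"
    by (metis dim_unique)
  moreover have "card ?B = card S"
    using inj(3) by (intro card_image) (auto simp: inj_on_def axis_eq_axis)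
  ultimately show ?thesis by (simp add: rank_dim_range)
qed

lemma norm_axis_1: "norm (axis i 1 :: real^'q) = 1"
  by (simp add: norm_eq_1 inner_axis_axis)

lemma PX_axis: "PX *v axis (a' k) 1 = axis (a k) 1"
proof -
  have "PX *v axis (a' k) 1 = (\<Sum>l\<in>UNIV. if l = k then axis (a k) 1 else 0)"
    unfolding PX_def sum_matrix_vector_mult
    by (intro sum.cong) (auto simp: inner_axis_axis ac)
  then show ?thesis by simp
qed

lemma PM_axis: "PM *v axis (a' k) 1 = 0"
  unfolding PM_def sum_matrix_vector_mult
  by (intro sum.neutral) (auto simp: inner_axis_axis ac ac(4)[THEN not_sym])

text \<open>\<open>PX - PM\<close> is a partial isometry: the upper bound is the mean inequality on
  disjoint coordinates, and a coordinate vector attains it.\<close>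

lemma op_norm_plane: 
  assumes "0 \<le> \<nu>"
  shows "op_norm (\<nu> *\<^sub>R PX - \<nu> *\<^sub>R PM) = \<nu>"
proof (rule antisym)
  show "op_norm (\<nu> *\<^sub>R PX - \<nu> *\<^sub>R PM) \<le> \<nu>"
  proof (intro op_norm_le op_le_unitI assms)
    fix x :: "real^'m" and y :: "real^'n" assume xy: "norm x = 1" "norm y = 1"
    have "x \<bullet> ((\<nu> *\<^sub>R PX - \<nu> *\<^sub>R PM) *v y) = \<nu> * ((\<Sum>k\<in>UNIV. x $ a k * y $ a' k) + (\<Sum>t\<in>S. - (x $ c t * y $ c' t)))"
      unfolding inner_outer_right[symmetric] inner_diff_left inner_scaleR_left inner_PX inner_PM
      by (simp add: outer_def sum_negf right_diff_distrib)
    also have "\<dots> \<le> \<nu> * ((\<Sum>k\<in>UNIV. ((x $ a k)\<^sup>2 + (y $ a' k)\<^sup>2) / 2) + (\<Sum>t\<in>S. ((x $ c t)\<^sup>2 + (y $ c' t)\<^sup>2) / 2))"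
    proof (intro mult_left_mono add_mono sum_mono assms)
      have *: "p * q \<le> (p\<^sup>2 + q\<^sup>2) / 2" "- (p * q) \<le> (p\<^sup>2 + q\<^sup>2) / 2" for p q :: real
        using zero_le_power2[of "p - q"] zero_le_power2[of "p + q"]
        unfolding power2_sum power2_diff by simp_all
      show "x $ a k * y $ a' k \<le> ((x $ a k)\<^sup>2 + (y $ a' k)\<^sup>2) / 2" for k by (rule *)
      show "- (x $ c k * y $ c' k) \<le> ((x $ c k)\<^sup>2 + (y $ c' k)\<^sup>2) / 2" for k by (rule *)
    qed
    also have "\<dots> = \<nu> * (((\<Sum>k\<in>UNIV. (x $ a k)\<^sup>2) + (\<Sum>t\<in>S. (x $ c t)\<^sup>2)
        + ((\<Sum>k\<in>UNIV. (y $ a' k)\<^sup>2) + (\<Sum>t\<in>S. (y $ c' t)\<^sup>2))) / 2)"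
      by (simp add: sum.distrib add_divide_distrib flip: sum_divide_distrib)
    also have "\<dots> \<le> \<nu> * (((norm x)\<^sup>2 + (norm y)\<^sup>2) / 2)"
      unfolding norm_power2_vec using assms
      by (intro mult_left_mono divide_right_mono add_mono sum_blocks_le sum_blocks_le') auto
    also have "\<dots> = \<nu>" using xy by simp
    finally show "x \<bullet> ((\<nu> *\<^sub>R PX - \<nu> *\<^sub>R PM) *v y) \<le> \<nu>" .
  qed
  have "norm ((\<nu> *\<^sub>R PX - \<nu> *\<^sub>R PM) *v axis (a' k) 1) \<le> op_norm (\<nu> *\<^sub>R PX - \<nu> *\<^sub>R PM) * norm (axis (a' k) 1 :: real^'n)" for k
    unfolding op_norm_def by (intro onorm matrix_vector_mul_bounded_linear)
  then show "\<nu> \<le> op_norm (\<nu> *\<^sub>R PX - \<nu> *\<^sub>R PM)"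
    using assms
    by (simp add: matrix_vector_mult_diff_rdistrib scaleR_matrix_vector_assoc[symmetric] PX_axis PM_axis
        norm_axis_1)
qed

text \<open>A matrix of rank below \<open>CARD('r) + card S\<close> kills a vector on which \<open>w\<close> is not small.\<close>

lemma w_low_rank:
  fixes E :: "real^'n^'m"
  assumes "rank E < CARD('r) + card S"
  shows "(w \<bullet> E)\<^sup>2 \<le> (1 - 1 / (2 * CARD('r))) * (norm E)\<^sup>2"
proof -
  let ?J = "range a' \<union> c' ` S"
  let ?B = "(\<lambda>j. axis j 1 :: real^'n) ` ?J"
  have "card ?J = card (range a') + card (c' ` S)" using disj by (intro card_Un_disjoint) auto
  also have "\<dots> = CARD('r) + card S" using inj by (simp add: card_image)
  finally have cJ: "card ?J = CARD('r) + card S" .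
  have "independent ?B"
    by (rule independent_mono[OF independent_Basis]) (auto simp: Basis_vec_def)
  moreover have "card ?B = card ?J" by (intro card_image) (auto simp: inj_on_def axis_eq_axis)
  ultimately have "dim (span ?B) = CARD('r) + card S"
    using cJ by (metis dim_span dim_eq_card_independent)
  \<comment> \<open>The span has dimension \<open>CARD('r) + card S\<close>, which exceeds the rank
    of \<open>E\<close>.\<close>
  then have "0 < dim (span ?B \<inter> {x. E *v x = 0})"
    using dim_Int_ker[OF subspace_span, of ?B E] assms by linarith
  then obtain y0 where y0: "y0 \<in> span ?B" "E *v y0 = 0" "y0 \<noteq> 0"
    using dim_eq_0[of "span ?B \<inter> {x. E *v x = 0}"] by fastforce
  define y where "y = y0 /\<^sub>R norm y0"
  have y: "y \<in> span ?B" "E *v y = 0" "norm y = 1"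
    using y0 by (auto simp: y_def span_scale matrix_vector_mult_scaleR)
  have y_out: "y $ j = 0" if "j \<notin> ?J" for j
    using y(1)
  proof (induction rule: span_induct_alt)
    case (step r x z)
    then show ?case using that by (auto simp: axis_def split: if_splits)
  qed simp
  have wy1: "(w *v y) $ a k = (1 / sqrt (2 * CARD('r))) * y $ a' k" for k
  proof -
    have "(PX *v y) $ a k = (\<Sum>l\<in>UNIV. y $ a' l * (axis (a l) 1 :: real^'m) $ a k)"
      by (simp add: PX_def sum_matrix_vector_mult inner_axis')
    also have "\<dots> = (\<Sum>l\<in>UNIV. if l = k then y $ a' k else 0)"
      by (intro sum.cong) (auto simp: axis_def ac)
    finally have "(PX *v y) $ a k = y $ a' k" by simp
    moreover have "(PM *v y) $ a k = 0"
      unfolding PM_def sum_matrix_vector_mult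
      by simp (intro sum.neutral, auto simp: inner_axis' axis_def ac ac(3)[THEN not_sym])
    ultimately show ?thesis
      by (simp add: w_def matrix_vector_mult_diff_rdistrib scaleR_matrix_vector_assoc[symmetric])
  qed
  have wy2: "(w *v y) $ c t = - (1 / sqrt (2 * card S)) * y $ c' t" if t: "t \<in> S" for t
  proof -
    have "(PM *v y) $ c t = (\<Sum>u\<in>S. y $ c' u * (axis (c u) 1 :: real^'m) $ c t)"
      by (simp add: PM_def sum_matrix_vector_mult inner_axis')
    also have "\<dots> = (\<Sum>u\<in>S. if u = t then y $ c' t else 0)"
      using t by (intro sum.cong) (auto simp: axis_def ac)
    finally have "(PM *v y) $ c t = y $ c' t" using t by simp
    moreover have "(PX *v y) $ c t = 0"
      unfolding PX_def sum_matrix_vector_mult using t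
      by simp (intro sum.neutral, auto simp: inner_axis' axis_def ac ac(3)[THEN not_sym])
    ultimately show ?thesis
      using t by (simp add: w_def matrix_vector_mult_diff_rdistrib scaleR_matrix_vector_assoc[symmetric])
  qed
  have "1 / (2 * real CARD('r)) = (1 / (2 * real CARD('r))) * (norm y)\<^sup>2" using y by simp
  also have "(norm y)\<^sup>2 = (\<Sum>j\<in>?J. (y $ j)\<^sup>2)"
    unfolding norm_power2_vec using y_out by (intro sum.mono_neutral_right) auto
  also have "\<dots> = (\<Sum>j\<in>range a'. (y $ j)\<^sup>2) + (\<Sum>j\<in>c' ` S. (y $ j)\<^sup>2)"
    using disj by (intro sum.union_disjoint) auto
  also have "\<dots> = (\<Sum>k\<in>UNIV. (y $ a' k)\<^sup>2) + (\<Sum>t\<in>S. (y $ c' t)\<^sup>2)"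
    using inj by (simp add: sum.reindex)
  also have "(1 / (2 * real CARD('r))) * \<dots> = (\<Sum>k\<in>UNIV. (1 / (2 * real CARD('r))) * (y $ a' k)\<^sup>2)
      + (\<Sum>t\<in>S. (1 / (2 * real CARD('r))) * (y $ c' t)\<^sup>2)"
    by (simp add: distrib_left sum_distrib_left)
  also have "\<dots> \<le> (\<Sum>k\<in>UNIV. ((w *v y) $ a k)\<^sup>2) + (\<Sum>t\<in>S. ((w *v y) $ c t)\<^sup>2)"
  proof (intro add_mono sum_mono)
    fix k
    show "(1 / (2 * real CARD('r))) * (y $ a' k)\<^sup>2 \<le> ((w *v y) $ a k)\<^sup>2"
      unfolding wy1 by (simp add: power_mult_distrib power_divide)
  next
    fix t assume t: "t \<in> S"
    have "(1 / (2 * real CARD('r))) * (y $ c' t)\<^sup>2 \<le> (1 / (2 * real (card S))) * (y $ c' t)\<^sup>2"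
      using card_S by (intro mult_right_mono divide_left_mono) auto
    also have "\<dots> = ((w *v y) $ c t)\<^sup>2"
      unfolding wy2[OF t] by (simp add: power_mult_distrib power_divide)
    finally show "(1 / (2 * real CARD('r))) * (y $ c' t)\<^sup>2 \<le> ((w *v y) $ c t)\<^sup>2" .
  qed
  also have "\<dots> \<le> (norm (w *v y))\<^sup>2" unfolding norm_power2_vec by (rule sum_blocks_le) simp
  finally have wy: "1 / (2 * real CARD('r)) \<le> (norm (w *v y))\<^sup>2" .
  \<comment> \<open>Since \<open>E\<close> kills \<open>y\<close>, the action of \<open>w\<close> on
    \<open>y\<close> can be removed without changing the product with \<open>E\<close>. This lowers
    the squared norm by \<open>(norm (w *v y))\<^sup>2\<close>.\<close>
  define w' where "w' = w - outer (w *v y) y"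
  have "(norm w')\<^sup>2 = 1 - (norm (w *v y))\<^sup>2"
  proof -
    let ?o = "outer (w *v y) y"
    have "(norm w')\<^sup>2 = w \<bullet> w - 2 * (w \<bullet> ?o) + ?o \<bullet> ?o"
      by (simp add: w'_def power2_norm_eq_inner inner_diff_left inner_diff_right inner_commute)
    then show ?thesis
      unfolding inner_outer_outer inner_outer_right using norm_w y(3)
      by (simp add: norm_eq_1 power2_norm_eq_inner)
  qed
  then have w': "(norm w')\<^sup>2 \<le> 1 - 1 / (2 * CARD('r))" using wy by simp
  have "w \<bullet> E = w' \<bullet> E" by (simp add: w'_def inner_simps inner_outer y(2))
  then have "(w \<bullet> E)\<^sup>2 \<le> (norm w')\<^sup>2 * (norm E)\<^sup>2"
    using Cauchy_Schwarz_ineq[of w' E] by (simp add: power2_norm_eq_inner)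
  also have "\<dots> \<le> (1 - 1 / (2 * CARD('r))) * (norm E)\<^sup>2"
    by (rule mult_right_mono[OF w']) simp
  finally show ?thesis .
qed

lemma inner_PX_mult: "PX \<bullet> (U \<sigma> ** transpose B) = V \<sigma> \<bullet> B" "PX \<bullet> (C ** transpose (V \<sigma>)) = U \<sigma> \<bullet> C"
proof -
  have "V \<sigma> \<bullet> B = (\<Sum>k\<in>UNIV. \<Sum>i\<in>UNIV. if i = a' k then sqrt \<sigma> * B $ i $ k else 0)"
    unfolding inner_vec_def inner_real_def by (subst sum.swap) (auto simp: V_def intro!: sum.cong)
  then show "PX \<bullet> (U \<sigma> ** transpose B) = V \<sigma> \<bullet> B"
    by (simp add: inner_PX U_mult_nth)
  have "U \<sigma> \<bullet> C = (\<Sum>k\<in>UNIV. \<Sum>i\<in>UNIV. if i = a k then sqrt \<sigma> * C $ i $ k else 0)"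
    unfolding inner_vec_def inner_real_def by (subst sum.swap) (auto simp: U_def intro!: sum.cong)
  then show "PX \<bullet> (C ** transpose (V \<sigma>)) = U \<sigma> \<bullet> C"
    by (simp add: inner_PX V_mult_nth)
qed

lemma inner_PM_mult: "PM \<bullet> (U \<sigma> ** transpose B) = 0" "PM \<bullet> (C ** transpose (V \<sigma>)) = 0"
  by (auto simp: inner_PM U_mult_nth V_mult_nth ac ac(3,4)[THEN not_sym] intro!: sum.neutral)

lemma mult_transpose_nth: "(C ** transpose B) $ i $ j = C $ i \<bullet> B $ j" for C :: "real^'q^'x" and B :: "real^'q^'y"
  by (simp add: matrix_matrix_mult_def transpose_def inner_vec_def)

lemma two_inner_le: "2 * (x \<bullet> y) \<le> (norm x)\<^sup>2 + (norm y)\<^sup>2" "- 2 * (x \<bullet> y) \<le> (norm x)\<^sup>2 + (norm y)\<^sup>2"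
  using inner_ge_zero[of "x - y"] inner_ge_zero[of "x + y"]
  by (simp_all add: power2_norm_eq_inner inner_simps inner_commute)

end

section \<open>Critical points and local minima in the block examples\<close>

context block_measurement
begin

lemma tangent_norm_ge:
  assumes "0 \<le> \<sigma>"
  shows "\<gamma> * (1 + \<delta>) * (\<sigma> * (\<Sum>t\<in>S. (norm (C $ c t))\<^sup>2 + (norm (B $ c' t))\<^sup>2))
    \<le> (norm (A (U \<sigma> ** transpose B + C ** transpose (V \<sigma>))))\<^sup>2"
proof -
  let ?D = "U \<sigma> ** transpose B + C ** transpose (V \<sigma>)"
  have 1: "?D $ a k $ c' t = sqrt \<sigma> * B $ c' t $ k" and 2: "?D $ c t $ a' k = sqrt \<sigma> * C $ c t $ k"
    if "t \<in> S" for t k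
    using that by (simp_all add: U_mult_nth V_mult_nth ac ac(3,4)[THEN not_sym])
  have "\<sigma> * (\<Sum>t\<in>S. (norm (C $ c t))\<^sup>2 + (norm (B $ c' t))\<^sup>2)
      = (\<Sum>t\<in>S. (\<Sum>k\<in>UNIV. (?D $ a k $ c' t)\<^sup>2) + (\<Sum>k\<in>UNIV. (?D $ c t $ a' k)\<^sup>2))"
    unfolding sum_distrib_left norm_power2_vec
    using assms by (intro sum.cong refl)
      (simp only: 1 2, simp add: power_mult_distrib sum_distrib_left distrib_left)
  then show ?thesis using norm_A_ge[of ?D] by simp
qed

text \<open>\<open>x\<close> and \<open>y\<close> are the coordinates of
  \<open>A\<^sup>* \<xi>\<close>, and the pulled-back residual is
  \<open>- lam PX - \<theta> PM\<close>. Its first coordinate is what the first-order condition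
  demands. In the Hessian the regulariser pays for the rows \<open>a k\<close>, \<open>a' k\<close>,
  and the curvature \<open>(1 + \<delta>) * \<sigma>\<close> plus \<open>lam\<close> pays for
  \<open>\<theta>\<close> on the rows \<open>c t\<close>, \<open>c' t\<close>.\<close>

lemma second_order_critical_block:
  assumes \<sigma>: "0 \<le> \<sigma>" and \<gamma>1: "\<gamma> = 1" and lam: "0 \<le> lam"
    and \<xi>: "\<And>E. \<xi> \<bullet> A E = x * (PX \<bullet> E) + y * (PM \<bullet> E)"
    and x: "\<sigma> - \<delta> * rho * s - x = - lam"
    and \<theta>: "\<theta> = s - \<delta> * \<sigma> / rho + y" "\<bar>\<theta>\<bar> \<le> (1 + \<delta>) * \<sigma> + lam"
  shows "second_order_critical (objective A (A (s *\<^sub>R PM) + \<xi>) lam) (U \<sigma>, V \<sigma>)"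
proof -
  define R where "R = A (U \<sigma> ** transpose (V \<sigma>)) - (A (s *\<^sub>R PM) + \<xi>)"
  have R: "R \<bullet> A E = - lam * (PX \<bullet> E) - \<theta> * (PM \<bullet> E)" for E
  proof -
    have "R \<bullet> A E = A (\<sigma> *\<^sub>R PX + (- s) *\<^sub>R PM) \<bullet> A E - \<xi> \<bullet> A E"
      by (simp add: R_def UV[OF \<sigma>] inner_simps linear_diff[OF A])
    also have "\<dots> = (\<sigma> - \<delta> * rho * s - x) * (PX \<bullet> E) - \<theta> * (PM \<bullet> E)"
      unfolding AA_plane \<xi> \<theta>(1) \<gamma>1 by (simp add: algebra_simps)
    finally show ?thesis by (simp only: x)
  qed
  show ?thesis
    unfolding second_order_critical_objective_iff[OF A] R_def[symmetric]
  proof (intro conjI allI)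
    fix C :: "real^'r^'m" and B :: "real^'r^'n"
    let ?D = "U \<sigma> ** transpose B + C ** transpose (V \<sigma>)"
    show "R \<bullet> A ?D + lam * (U \<sigma> \<bullet> C + V \<sigma> \<bullet> B) = 0"
      unfolding R inner_add_right inner_PX_mult inner_PM_mult by (simp add: algebra_simps)
    let ?n = "\<lambda>i j. (norm (C $ i))\<^sup>2 + (norm (B $ j))\<^sup>2"
    have 1: "lam * (\<Sum>k\<in>UNIV. 2 * (C $ a k \<bullet> B $ a' k)) \<le> lam * (\<Sum>k\<in>UNIV. ?n (a k) (a' k))"
      by (intro mult_left_mono sum_mono two_inner_le lam)
    have "(\<Sum>t\<in>S. 2 * \<theta> * (C $ c t \<bullet> B $ c' t)) \<le> (\<Sum>t\<in>S. ((1 + \<delta>) * \<sigma> + lam) * ?n (c t) (c' t))"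
    proof (rule sum_mono)
      fix t
      have "2 * \<theta> * (C $ c t \<bullet> B $ c' t) \<le> \<bar>\<theta>\<bar> * ?n (c t) (c' t)"
      proof (cases "0 \<le> \<theta>")
        case True
        then show ?thesis
          using mult_left_mono[OF two_inner_le(1)[of "C $ c t" "B $ c' t"], of \<theta>] by (simp add: mult_ac)
      next
        case False
        then show ?thesis
          using mult_left_mono[OF two_inner_le(2)[of "C $ c t" "B $ c' t"], of "- \<theta>"] by (simp add: mult_ac)
      qed
      also have "\<dots> \<le> ((1 + \<delta>) * \<sigma> + lam) * ?n (c t) (c' t)"
        using \<theta>(2) by (intro mult_right_mono) auto
      finally show "2 * \<theta> * (C $ c t \<bullet> B $ c' t) \<le> ((1 + \<delta>) * \<sigma> + lam) * ?n (c t) (c' t)" .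
    qed
    also have "\<dots> = (1 + \<delta>) * (\<sigma> * (\<Sum>t\<in>S. ?n (c t) (c' t))) + lam * (\<Sum>t\<in>S. ?n (c t) (c' t))"
      unfolding sum_distrib_left[symmetric] by (simp only: distrib_right mult.assoc)
    finally have 2: "(\<Sum>t\<in>S. 2 * \<theta> * (C $ c t \<bullet> B $ c' t))
        \<le> (1 + \<delta>) * (\<sigma> * (\<Sum>t\<in>S. ?n (c t) (c' t))) + lam * (\<Sum>t\<in>S. ?n (c t) (c' t))" .
    have 3: "(1 + \<delta>) * (\<sigma> * (\<Sum>t\<in>S. ?n (c t) (c' t))) \<le> (norm (A ?D))\<^sup>2"
      using tangent_norm_ge[OF \<sigma>, of C B] \<gamma>1 by simp
    have 4: "lam * ((\<Sum>k\<in>UNIV. ?n (a k) (a' k)) + (\<Sum>t\<in>S. ?n (c t) (c' t))) \<le> lam * ((norm C)\<^sup>2 + (norm B)\<^sup>2)"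
    proof (rule mult_left_mono[OF _ lam])
      have "(\<Sum>k\<in>UNIV. (norm (C $ a k))\<^sup>2) + (\<Sum>t\<in>S. (norm (C $ c t))\<^sup>2) \<le> (norm C)\<^sup>2"
        unfolding norm_power2_rows by (rule sum_blocks_le) simp
      moreover have "(\<Sum>k\<in>UNIV. (norm (B $ a' k))\<^sup>2) + (\<Sum>t\<in>S. (norm (B $ c' t))\<^sup>2) \<le> (norm B)\<^sup>2"
        unfolding norm_power2_rows by (rule sum_blocks_le') simp
      ultimately show "(\<Sum>k\<in>UNIV. ?n (a k) (a' k)) + (\<Sum>t\<in>S. ?n (c t) (c' t)) \<le> (norm C)\<^sup>2 + (norm B)\<^sup>2"
        by (simp add: sum.distrib)
    qed
    have 5: "2 * (R \<bullet> A (C ** transpose B)) = - lam * (\<Sum>k\<in>UNIV. 2 * (C $ a k \<bullet> B $ a' k))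
        - (\<Sum>t\<in>S. 2 * \<theta> * (C $ c t \<bullet> B $ c' t))"
      unfolding R inner_PX inner_PM mult_transpose_nth by (simp add: sum_distrib_left mult_ac)
    show "0 \<le> (norm (A ?D))\<^sup>2 + 2 * (R \<bullet> A (C ** transpose B)) + lam * ((norm C)\<^sup>2 + (norm B)\<^sup>2)"
      using 1 2 3 4[unfolded distrib_left[of lam "sum _ UNIV"]] 5 by linarith
  qed
qed

lemma not_global_minimum_block:
  assumes "0 \<le> \<sigma>"
  shows "\<not> global_minimum (objective A (A PM) 0) (U \<sigma>, V \<sigma>)"
proof -
  let ?X = "U \<sigma> ** transpose (V \<sigma>)"
  have "PM \<bullet> ?X \<noteq> PM \<bullet> PM"
    unfolding inner_PM_mult PM_PM using card_S ne by simp
  then have "?X - PM \<noteq> 0" by auto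
  then have "0 < norm (A ?X - A PM)"
    using A_pos by (simp only: linear_diff[OF A, symmetric])
  then have "objective A (A PM) 0 (U0, V0) < objective A (A PM) 0 (U \<sigma>, V \<sigma>)"
    by (simp add: objective_def U0V0)
  then show ?thesis
    unfolding global_minimum_def not_all not_le by (rule exI)
qed

text \<open>
  With \<open>\<sigma> = \<delta> rho\<close> the residual is a multiple of \<open>PM\<close>, so only the products of the rows
  \<open>c t\<close> and \<open>c' t\<close> of the perturbation can decrease the objective.
\<close>

lemma local_minimum_block:
  assumes \<sigma>: "\<sigma> = \<delta> * rho" and gt: "1 - \<delta> < \<sigma>"
  shows "local_minimum (objective A (A PM) 0) (U \<sigma>, V \<sigma>)"
proof -
  have \<sigma>0: "0 \<le> \<sigma>" using \<delta> rho by (simp add: \<sigma>)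
  \<comment> \<open>The radius within which \<open>sqrt \<sigma>\<close>, reduced by a perturbation,
    still exceeds or equals \<open>sqrt (1 - \<delta>)\<close>.\<close>
  define \<epsilon> where "\<epsilon> = sqrt \<sigma> - sqrt (1 - \<delta>)"
  have \<epsilon>: "0 < \<epsilon>" using gt by (simp add: \<epsilon>_def)
  have step: "objective A (A PM) 0 (U \<sigma>, V \<sigma>) \<le> objective A (A PM) 0 (U \<sigma> + C, V \<sigma> + B)"
    if C: "norm C \<le> \<epsilon>" and B: "norm B \<le> \<epsilon>" for C B
  proof -
    define D where "D = U \<sigma> ** transpose B + C ** transpose (V \<sigma>) + C ** transpose B"
    have X: "(U \<sigma> + C) ** transpose (V \<sigma> + B) = U \<sigma> ** transpose (V \<sigma>) + D"
      by (simp add: D_def matrix_matrix_mult_def transpose_def vec_eq_iff sum.distrib algebra_simps)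
    let ?n = "\<lambda>t. (norm (C $ c t))\<^sup>2 + (norm (B $ c' t))\<^sup>2"
    \<comment> \<open>In the mixed blocks the quadratic term \<open>C B\<^sup>T\<close> merely
      perturbs the multiplication by \<open>sqrt \<sigma>\<close> by a small matrix, so no Taylor
      remainder has to be estimated.\<close>
    have shift: "(1 - \<delta>) * (norm z)\<^sup>2 \<le> (norm (sqrt \<sigma> *\<^sub>R z + E *v z))\<^sup>2" if "norm E \<le> \<epsilon>"
      for E :: "real^'r^'r" and z
    proof -
      have "norm (E *v z) \<le> \<epsilon> * norm z"
        using norm_matrix_vec_le[of E z] mult_right_mono[OF that, of "norm z"] by simp
      moreover have "norm (sqrt \<sigma> *\<^sub>R z) \<le> norm (sqrt \<sigma> *\<^sub>R z + E *v z) + norm (E *v z)"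
        using norm_triangle_ineq4[of "sqrt \<sigma> *\<^sub>R z + E *v z" "E *v z"] by simp
      ultimately have "sqrt (1 - \<delta>) * norm z \<le> norm (sqrt \<sigma> *\<^sub>R z + E *v z)"
        using \<sigma>0 by (simp add: \<epsilon>_def algebra_simps)
      then have "(sqrt (1 - \<delta>) * norm z)\<^sup>2 \<le> (norm (sqrt \<sigma> *\<^sub>R z + E *v z))\<^sup>2"
        using \<delta> by (intro power_mono) auto
      then show ?thesis using \<delta> by (simp add: power_mult_distrib)
    qed
    have "(1 - \<delta>) * ?n t \<le> (\<Sum>k\<in>UNIV. (D $ a k $ c' t)\<^sup>2) + (\<Sum>k\<in>UNIV. (D $ c t $ a' k)\<^sup>2)"
      if t: "t \<in> S" for t
    proof -
      define C1 B1 :: "real^'r^'r" where "C1 = (\<chi> k. C $ a k)" and "B1 = (\<chi> k. B $ a' k)"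
      have "(norm C1)\<^sup>2 \<le> (norm C)\<^sup>2"
        using sum_blocks_le[of "\<lambda>i. (norm (C $ i))\<^sup>2"] sum_nonneg[of S "\<lambda>t. (norm (C $ c t))\<^sup>2"]
        unfolding norm_power2_rows[of C1] norm_power2_rows[of C] by (simp add: C1_def)
      then have C1: "norm C1 \<le> \<epsilon>" using C power2_le_imp_le by force
      have "(norm B1)\<^sup>2 \<le> (norm B)\<^sup>2"
        using sum_blocks_le'[of "\<lambda>i. (norm (B $ i))\<^sup>2"] sum_nonneg[of S "\<lambda>t. (norm (B $ c' t))\<^sup>2"]
        unfolding norm_power2_rows[of B1] norm_power2_rows[of B] by (simp add: B1_def)
      then have B1: "norm B1 \<le> \<epsilon>" using B power2_le_imp_le by force
      have 1: "D $ a k $ c' t = (sqrt \<sigma> *\<^sub>R B $ c' t + C1 *v (B $ c' t)) $ k" for k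
      proof -
        have "(C ** transpose (V \<sigma>)) $ a k $ c' t = 0"
          by (rule V_mult_nth(2)) (use t ac(4) in metis)
        then show ?thesis
          unfolding D_def vector_add_component U_mult_nth(1) mult_transpose_nth[of C B]
          by (simp add: C1_def matrix_vector_mul_component)
      qed
      have 2: "D $ c t $ a' k = (sqrt \<sigma> *\<^sub>R C $ c t + B1 *v (C $ c t)) $ k" for k
      proof -
        have "(U \<sigma> ** transpose B) $ c t $ a' k = 0"
          by (rule U_mult_nth(2)) (use t ac(3) in metis)
        then show ?thesis
          unfolding D_def vector_add_component V_mult_nth(1) mult_transpose_nth[of C B]
          by (simp add: B1_def matrix_vector_mul_component inner_commute)
      qed
      show ?thesis
        using shift[OF C1, of "B $ c' t"] shift[OF B1, of "C $ c t"]
        unfolding 1 2 norm_power2_vec[symmetric] by (simp add: distrib_left)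
    qed
    then have "\<gamma> * (1 + \<delta>) * (\<Sum>t\<in>S. (1 - \<delta>) * ?n t) \<le> \<gamma> * (1 + \<delta>) *
        (\<Sum>t\<in>S. (\<Sum>k\<in>UNIV. (D $ a k $ c' t)\<^sup>2) + (\<Sum>k\<in>UNIV. (D $ c t $ a' k)\<^sup>2))"
      using \<gamma> \<delta> by (intro mult_left_mono sum_mono) auto
    also have "\<dots> \<le> (norm (A D))\<^sup>2" by (rule norm_A_ge)
    finally have AD: "\<gamma> * (1 + \<delta>) * (\<Sum>t\<in>S. (1 - \<delta>) * ?n t) \<le> (norm (A D))\<^sup>2" .
    have "PM \<bullet> D = PM \<bullet> (C ** transpose B)"
      by (simp only: D_def inner_add_right inner_PM_mult add_0_left)
    then have PMD: "PM \<bullet> D = (\<Sum>t\<in>S. C $ c t \<bullet> B $ c' t)"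
      by (simp only: inner_PM mult_transpose_nth)
    have "2 * (PM \<bullet> D) = (\<Sum>t\<in>S. 2 * (C $ c t \<bullet> B $ c' t))"
      unfolding PMD by (rule sum_distrib_left)
    also have "\<dots> \<le> (\<Sum>t\<in>S. ?n t)" by (intro sum_mono two_inner_le)
    finally have "2 * (PM \<bullet> D) \<le> (\<Sum>t\<in>S. ?n t)" .
    then have "\<gamma> * (1 + \<delta>) * (1 - \<delta>) * (2 * (PM \<bullet> D)) \<le> \<gamma> * (1 + \<delta>) * (1 - \<delta>) * (\<Sum>t\<in>S. ?n t)"
      using \<gamma> \<delta> by (intro mult_left_mono) auto
    also have "\<dots> \<le> (norm (A D))\<^sup>2" using AD by (simp only: sum_distrib_left[symmetric] mult.assoc)
    finally have le: "\<gamma> * (1 + \<delta>) * (1 - \<delta>) * (2 * (PM \<bullet> D)) \<le> (norm (A D))\<^sup>2" .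
    define Y where "Y = A (U \<sigma> ** transpose (V \<sigma>)) - A PM"
    \<comment> \<open>For \<open>\<sigma> = \<delta> * rho\<close> the \<open>PX\<close> coordinate
      \<open>\<sigma> - \<delta> * rho\<close> vanishes and the \<open>PM\<close> coordinate is
      \<open>\<delta>\<^sup>2 - 1\<close>.\<close>
    have "Y \<bullet> A D = A (\<sigma> *\<^sub>R PX + (-1) *\<^sub>R PM) \<bullet> A D"
      by (simp add: Y_def UV[OF \<sigma>0] linear_diff[OF A] inner_simps)
    also have "\<dots> = - (\<gamma> * (1 + \<delta>) * (1 - \<delta>) * (PM \<bullet> D))"
      unfolding AA_plane \<sigma> using rho by (simp add: algebra_simps)
    finally have YD: "Y \<bullet> A D = - (\<gamma> * (1 + \<delta>) * (1 - \<delta>) * (PM \<bullet> D))" .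
    have "(norm (Y + A D))\<^sup>2 = (norm Y)\<^sup>2 + 2 * (Y \<bullet> A D) + (norm (A D))\<^sup>2"
      by (simp add: power2_norm_eq_inner inner_simps inner_commute)
    then have Y: "(norm Y)\<^sup>2 \<le> (norm (Y + A D))\<^sup>2" using le YD by simp
    have YX: "A (U \<sigma> ** transpose (V \<sigma>) + D) - A PM = Y + A D"
      by (simp add: Y_def linear_add[OF A])
    show ?thesis
      unfolding objective_def prod.case X YX Y_def[symmetric] using Y by simp
  qed
  have "\<forall>\<^sub>F P in nhds (U \<sigma>, V \<sigma>). dist P (U \<sigma>, V \<sigma>) < \<epsilon>"
    unfolding eventually_nhds_metric using \<epsilon> by blast
  then show ?thesis
    unfolding local_minimum_def
  proof eventually_elim
    case (elim P)
    have "norm (fst P - U \<sigma>) \<le> \<epsilon>" "norm (snd P - V \<sigma>) \<le> \<epsilon>"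
      using elim dist_fst_le[of P "(U \<sigma>, V \<sigma>)"] dist_snd_le[of P "(U \<sigma>, V \<sigma>)"]
      by (simp_all add: dist_norm)
    from step[OF this] show ?case by simp
  qed
qed

end

section \<open>Choice of parameters for the sharpness claims\<close>

lemma inj_sum_parts:
  assumes h: "inj_on h (Inl ` UNIV \<union> Inr ` S)"
  shows "inj (h \<circ> Inl)" "inj_on (h \<circ> Inr) S" "range (h \<circ> Inl) \<inter> (h \<circ> Inr) ` S = {}"
proof -
  show "inj (h \<circ> Inl)"
  proof (rule injI)
    fix x y assume "(h \<circ> Inl) x = (h \<circ> Inl) y"
    then show "x = y" using inj_onD[OF h, of "Inl x" "Inl y"] by simp
  qed
  show "inj_on (h \<circ> Inr) S"
  proof (rule inj_onI)
    fix x y assume "x \<in> S" "y \<in> S" "(h \<circ> Inr) x = (h \<circ> Inr) y"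
    then show "x = y" using inj_onD[OF h, of "Inr x" "Inr y"] by simp
  qed
  have "h (Inl x) \<noteq> h (Inr y)" if "y \<in> S" for x y
    using inj_onD[OF h, of "Inl x" "Inr y"] that by auto
  then show "range (h \<circ> Inl) \<inter> (h \<circ> Inr) ` S = {}" by auto
qed

text \<open>A single injection of a disjoint sum into each index type yields both position maps,
  with disjoint images for free.\<close>

lemma block_model_exists:
  assumes "CARD('r::finite) + m \<le> CARD('m::finite)" "CARD('r::finite) + m \<le> CARD('n::finite)"
    and "1 \<le> m" "m \<le> CARD('r::finite)"
  obtains a :: "'r::finite \<Rightarrow> 'm::finite" and a' :: "'r \<Rightarrow> 'n::finite" and c c' S where "block_model a a' c c' S" "card S = m"
proof -
  obtain S :: "'r set" where S: "card S = m"
    using obtain_subset_with_card_n[OF assms(4)] by metis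
  let ?D = "Inl ` UNIV \<union> Inr ` S :: ('r + 'r) set"
  have "card ?D = card (Inl ` UNIV :: ('r + 'r) set) + card (Inr ` S :: ('r + 'r) set)"
    by (intro card_Un_disjoint) auto
  then have D: "card ?D = CARD('r) + m" by (simp add: card_image S)
  obtain f :: "'r + 'r \<Rightarrow> 'm" where f: "inj_on f ?D"
    using card_le_inj[of ?D "UNIV :: 'm set"] D assms(1) by auto
  obtain g :: "'r + 'r \<Rightarrow> 'n" where g: "inj_on g ?D"
    using card_le_inj[of ?D "UNIV :: 'n set"] D assms(2) by auto
  have "S \<noteq> {}" using S assms(3) by auto
  have "block_model (f \<circ> Inl) (g \<circ> Inl) (f \<circ> Inr) (g \<circ> Inr) S"
    using inj_sum_parts[OF f] inj_sum_parts[OF g] \<open>S \<noteq> {}\<close> by (intro block_model.intro)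
  then show ?thesis by (rule that) (rule S)
qed

context block_model
begin

lemma delta_crit_rho: "delta_crit CARD('r) (card S) = 1 / (1 + rho)"
  unfolding delta_crit_def rho_def ..

lemma delta_crit_props:
  defines "d \<equiv> delta_crit CARD('r) (card S)"
  shows "1 / 2 \<le> d" "d < 1" "d * rho = 1 - d"
proof -
  have "0 < 1 + rho" using rho by simp
  then show "1 / 2 \<le> d" "d < 1" "d * rho = 1 - d"
    unfolding d_def delta_crit_rho using rho by (simp_all add: le_divide_eq) (simp add: field_simps)
qed

text \<open>At \<open>\<delta> = d\<close> and \<open>\<sigma> = d * rho = 1 - d\<close> the
  \<open>PM\<close> coordinate \<open>1 - d\<^sup>2\<close> of the residual equals the curvature
  \<open>(1 + d) * \<sigma>\<close>, so the second-order condition holds with equality.\<close>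

lemma sharp_RIP_constant:
  assumes card: "CARD('m) * CARD('n) \<le> CARD('k::finite)"
  obtains A :: "real^'n^'m \<Rightarrow> real^'k" and M and P :: "real^'r^'m" and Q :: "real^'r^'n"
  where "linear A" "rank M = card S" "\<And>k. RIP k (delta_crit CARD('r) (card S)) A"
    "second_order_critical (objective A (A M) 0) (P, Q)"
    "\<not> global_minimum (objective A (A M) 0) (P, Q)" "P ** transpose Q \<noteq> M"
proof -
  define d where "d = delta_crit CARD('r) (card S)"
  note d = delta_crit_props[folded d_def]
  obtain A :: "real^'n^'m \<Rightarrow> real^'k" where A: "linear A"
    "\<And>E F. A E \<bullet> A F = 1 * ((1 + d) * (E \<bullet> F) - 2 * d * (w \<bullet> E) * (w \<bullet> F))"
    by (rule measurement_exists[OF card norm_w zero_le_one, of d]) (use d that in auto)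
  interpret block_measurement a a' c c' S A 1 d
    by (intro block_measurement.intro block_measurement_axioms.intro block_model_axioms)
      (use A d in auto)
  define \<sigma> where "\<sigma> = d * rho"
  have \<sigma>: "0 \<le> \<sigma>" using d by (simp add: \<sigma>_def)
  have "second_order_critical (objective A (A (1 *\<^sub>R PM) + 0) 0) (U \<sigma>, V \<sigma>)"
  proof (rule second_order_critical_block[OF \<sigma>, where x = 0 and y = 0 and \<theta> = "1 - d * \<sigma> / rho"])
    have "1 - d * \<sigma> / rho = (1 + d) * (1 - d)"
      using rho by (simp add: \<sigma>_def algebra_simps)
    then show "\<bar>1 - d * \<sigma> / rho\<bar> \<le> (1 + d) * \<sigma> + 0" using d by (simp add: \<sigma>_def)
  qed (simp_all add: \<sigma>_def)
  moreover have "PM \<bullet> (U \<sigma> ** transpose (V \<sigma>)) \<noteq> PM \<bullet> PM"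
    unfolding inner_PM_mult PM_PM using card_S ne by simp
  then have "U \<sigma> ** transpose (V \<sigma>) \<noteq> PM" by auto
  moreover have "RIP k d A" for k
    unfolding RIP_def using norm_A_bounds by simp
  ultimately show ?thesis
    using that[of A PM "U \<sigma>" "V \<sigma>"] A(1) rank_PM[of 1] not_global_minimum_block[OF \<sigma>]
    by (simp add: d_def)
qed

text \<open>At these ranks \<open>w\<close> cannot be matched completely, so the RIP constant seen
  there is strictly below the distortion \<open>e\<close> of \<open>A\<close>. Hence
  \<open>e\<close> may exceed the threshold, which yields a genuine local minimum, while
  \<open>\<delta>\<close> stays below it.\<close>

lemma sharp_RIP_rank:
  assumes card: "CARD('m) * CARD('n) \<le> CARD('k::finite)" and k: "k < CARD('r) + card S"
  obtains A :: "real^'n^'m \<Rightarrow> real^'k" and M \<delta> and P :: "real^'r^'m" and Q :: "real^'r^'n"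
  where "linear A" "rank M = card S" "0 \<le> \<delta>" "\<delta> < delta_crit CARD('r) (card S)" "RIP k \<delta> A"
    "spurious_local_optimum (objective A (A M) 0) (P, Q)"
proof -
  define d where "d = delta_crit CARD('r) (card S)"
  note d = delta_crit_props[folded d_def]
  define r where "r = real CARD('r)"
  have r: "1 \<le> r" using card_S by (simp add: r_def)
  have pos: "0 < 2 * r - 1 - d" using r d by simp
  \<comment> \<open>The right side is the largest \<open>e\<close> for which the constant
    \<open>\<delta>\<close> chosen below does not exceed \<open>d\<close>.\<close>
  have "d < 2 * r * d / (2 * r - 1 - d)"
  proof -
    have "0 < d * (1 + d)" using d by simp
    then have "d * (2 * r - 1 - d) < 2 * r * d" by (simp add: algebra_simps)
    then show ?thesis using pos by (simp add: pos_less_divide_eq)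
  qed
  then have "d < min 1 (2 * r * d / (2 * r - 1 - d))" using d by simp
  then obtain e where e: "d < e" "e < 1" "e < 2 * r * d / (2 * r - 1 - d)"
    using dense[of d "min 1 (2 * r * d / (2 * r - 1 - d))"] by auto
  have e0: "0 < e" using e d by linarith
  \<comment> \<open>\<open>\<gamma>\<close> and \<open>\<delta>\<close> solve the two equations
    \<open>upper\<close> and \<open>lower\<close>: the rescaling centres the attainable range of
    \<open>(norm (A E))\<^sup>2\<close> around \<open>(norm E)\<^sup>2\<close>.\<close>
  define \<gamma> where "\<gamma> = 2 * r / (2 * r + e)"
  define \<delta> where "\<delta> = e * (2 * r - 1) / (2 * r + e)"
  have \<gamma>: "0 < \<gamma>" using r e0 by (simp add: \<gamma>_def)
  have upper: "\<gamma> * (1 + e) = 1 + \<delta>"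
    using r e0 by (simp add: \<gamma>_def \<delta>_def field_simps)
  have "2 * r * (1 + e - 2 * e * (1 - 1 / (2 * r))) = (2 * r + e) - e * (2 * r - 1)"
    using r by (simp add: field_simps)
  then have "\<gamma> * (1 + e - 2 * e * (1 - 1 / (2 * r))) = ((2 * r + e) - e * (2 * r - 1)) / (2 * r + e)"
    unfolding \<gamma>_def times_divide_eq_left by (simp only:)
  then have lower: "\<gamma> * (1 + e - 2 * e * (1 - 1 / (2 * r))) = 1 - \<delta>"
    using r e0 by (simp add: \<delta>_def diff_divide_distrib)
  have "e * (2 * r - 1 - d) < 2 * r * d" using e(3) pos by (simp add: pos_less_divide_eq)
  then have "e * (2 * r - 1) < d * (2 * r + e)" by (simp add: algebra_simps)
  then have \<delta>d: "\<delta> < d" using r e0 by (simp add: \<delta>_def pos_divide_less_eq)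
  have \<delta>0: "0 \<le> \<delta>" using r e0 by (simp add: \<delta>_def)
  obtain A :: "real^'n^'m \<Rightarrow> real^'k" where A: "linear A"
    "\<And>E F. A E \<bullet> A F = \<gamma> * ((1 + e) * (E \<bullet> F) - 2 * e * (w \<bullet> E) * (w \<bullet> F))"
    by (rule measurement_exists[OF card norm_w, of \<gamma> e]) (use \<gamma> e e0 that in auto)
  interpret block_measurement a a' c c' S A \<gamma> e
    by (intro block_measurement.intro block_measurement_axioms.intro block_model_axioms)
      (use A \<gamma> e e0 in auto)
  have "RIP k \<delta> A"
    unfolding RIP_def
  proof (intro allI impI conjI)
    fix E :: "real^'n^'m" assume "rank E \<le> k"
    then have "(w \<bullet> E)\<^sup>2 \<le> (1 - 1 / (2 * r)) * (norm E)\<^sup>2"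
      using w_low_rank[of E] k by (simp add: r_def)
    then have "\<gamma> * ((1 + e) * (norm E)\<^sup>2 - 2 * e * ((1 - 1 / (2 * r)) * (norm E)\<^sup>2)) \<le> (norm (A E))\<^sup>2"
      unfolding norm_A using \<gamma> e0 by (intro mult_left_mono diff_left_mono) auto
    moreover have "\<gamma> * ((1 + e) * (norm E)\<^sup>2 - 2 * e * ((1 - 1 / (2 * r)) * (norm E)\<^sup>2))
        = \<gamma> * (1 + e - 2 * e * (1 - 1 / (2 * r))) * (norm E)\<^sup>2"
      by (simp only: left_diff_distrib mult.assoc)
    ultimately show "(1 - \<delta>) * (norm E)\<^sup>2 \<le> (norm (A E))\<^sup>2" by (simp only: lower)
    show "(norm (A E))\<^sup>2 \<le> (1 + \<delta>) * (norm E)\<^sup>2"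
      using norm_A_bounds(2) by (simp only: upper)
  qed
  moreover have "0 < (e - d) * (1 + rho)" using e rho by simp
  then have "1 - e < e * rho" using d(3) by (simp add: algebra_simps)
  then have "local_minimum (objective A (A PM) 0) (U (e * rho), V (e * rho))"
    by (intro local_minimum_block) auto
  then have "spurious_local_optimum (objective A (A PM) 0) (U (e * rho), V (e * rho))"
    unfolding spurious_local_optimum_def using not_global_minimum_block e0 rho by simp
  ultimately show ?thesis
    using that[of A PM \<delta>] A(1) rank_PM[of 1] \<delta>0 \<delta>d by (simp add: d_def)
qed

lemma sharp_error_bound:
  assumes card: "CARD('m) * CARD('n) \<le> CARD('k::finite)"
    and \<delta>: "0 \<le> \<delta>" "\<delta> < delta_crit CARD('r) (card S)" and lam: "0 \<le> lam" "lam \<le> \<nu>"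
  obtains A :: "real^'n^'m \<Rightarrow> real^'k" and M \<xi> and P :: "real^'r^'m" and Q :: "real^'r^'n"
  where "linear A" "rank M = card S" "\<And>k. RIP k \<delta> A" "op_norm (adjoint A \<xi>) = \<nu>"
    "second_order_critical (objective A (A M + \<xi>) lam) (P, Q)"
    "1 / 200 * error_bound CARD('r) (card S) \<delta> lam \<nu> \<le> norm (P ** transpose Q - M)"
proof -
  define d where "d = delta_crit CARD('r) (card S)"
  note d = delta_crit_props[folded d_def]
  have \<delta>d: "\<delta> < d" using \<delta> by (simp add: d_def)
  obtain A :: "real^'n^'m \<Rightarrow> real^'k" where A: "linear A"
    "\<And>E F. A E \<bullet> A F = 1 * ((1 + \<delta>) * (E \<bullet> F) - 2 * \<delta> * (w \<bullet> E) * (w \<bullet> F))"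
    by (rule measurement_exists[OF card norm_w zero_le_one, of \<delta>]) (use \<delta>(1) \<delta>d d that in auto)
  interpret block_measurement a a' c c' S A 1 \<delta>
    by (intro block_measurement.intro block_measurement_axioms.intro block_model_axioms)
      (use A \<delta>(1) \<delta>d d in auto)
  have RIP: "RIP k \<delta> A" for k unfolding RIP_def using norm_A_bounds by simp
  show ?thesis
  proof (cases "\<nu> = 0")
    case True
    then have lam0: "lam = 0" using lam by simp
    have "linear (adjoint A)" by (rule adjoint_linear[OF A(1)])
    then have "op_norm (adjoint A 0) = 0" using op_norm_plane[of 0] by (simp add: linear_0)
    moreover have "second_order_critical (objective A (A PM + 0) 0) (U0, V0)"
      unfolding second_order_critical_objective_iff[OF A(1)] by (simp add: U0V0)
    ultimately show ?thesis
      using that[of A PM 0 U0 V0] A(1) RIP rank_PM[of 1] True lam0 by (simp add: error_bound_def)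
  next
    case False
    then have \<nu>: "0 < \<nu>" using lam by simp
    \<comment> \<open>Both conditions of \<open>second_order_critical_block\<close> are to hold with
      equality for \<open>x = \<nu>\<close>, \<open>y = - \<nu>\<close>. The first gives
      \<open>\<sigma>\<close>; inserting it in the second leaves a linear equation for
      \<open>s\<close> with right side \<open>K\<close>, whose coefficient times \<open>d\<close> is
      \<open>(1 + \<delta>) * (d - \<delta>)\<close>. Hence the blow-up at the threshold.\<close>
    define K where "K = (1 + \<delta> + \<delta> / rho) * (\<nu> - lam) + \<nu> + lam"
    define s where "s = K * d / ((1 + \<delta>) * (d - \<delta>))"
    define \<sigma> where "\<sigma> = \<delta> * rho * s + \<nu> - lam"
    have K: "0 < K" "2 * lam + \<delta> / rho * (\<nu> - lam) \<le> K"
    proof -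
      have "0 \<le> (1 + \<delta>) * (\<nu> - lam)" "0 \<le> \<delta> / rho * (\<nu> - lam)" using \<delta> lam rho by simp_all
      then show "0 < K" "2 * lam + \<delta> / rho * (\<nu> - lam) \<le> K"
        using \<nu> lam by (simp_all add: K_def distrib_right)
    qed
    have s: "0 < s" using K \<delta>(1) \<delta>d d by (simp add: s_def)
    have "0 \<le> \<delta> * rho * s" using \<delta> rho s by simp
    then have \<sigma>: "\<nu> - lam \<le> \<sigma>" "0 \<le> \<sigma>" using lam by (simp_all add: \<sigma>_def)
    have crit: "s - (1 + \<delta> + \<delta> / rho) * \<sigma> = \<nu> + lam"
    proof -
      have "d * (1 + rho) = 1" using d(3) by (simp add: algebra_simps)
      have "d * (1 - (1 + \<delta> + \<delta> / rho) * (\<delta> * rho)) = (1 + \<delta>) * (d - \<delta> * (d * (1 + rho)))"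
        using rho by (simp add: field_simps)
      then have q: "d * (1 - (1 + \<delta> + \<delta> / rho) * (\<delta> * rho)) = (1 + \<delta>) * (d - \<delta>)"
        unfolding \<open>d * (1 + rho) = 1\<close> by simp
      have "(1 + \<delta>) * (d - \<delta>) \<noteq> 0" using \<delta>(1) \<delta>d by simp
      moreover have "s * (1 - (1 + \<delta> + \<delta> / rho) * (\<delta> * rho))
          = K * (d * (1 - (1 + \<delta> + \<delta> / rho) * (\<delta> * rho))) / ((1 + \<delta>) * (d - \<delta>))"
        unfolding s_def by (simp only: times_divide_eq_left mult.assoc)
      ultimately have "s * (1 - (1 + \<delta> + \<delta> / rho) * (\<delta> * rho)) = K"
        unfolding q by simp
      moreover have "s - x * \<sigma> = \<nu> + lam"
        if "s * (1 - x * (\<delta> * rho)) = x * (\<nu> - lam) + \<nu> + lam" for x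
        using that by (simp add: \<sigma>_def algebra_simps)
      ultimately show ?thesis by (simp only: K_def)
    qed
    \<comment> \<open>The solution of the two-by-two system of \<open>AA_plane\<close>, so that
      \<open>A\<^sup>* \<xi>\<close> becomes \<open>\<nu> PX - \<nu> PM\<close>.\<close>
    define f1 where "f1 = \<nu> * (1 + \<delta> * rho) / (1 - \<delta>\<^sup>2)"
    define f2 where "f2 = - \<nu> - \<delta> * f1 / rho"
    define \<xi> where "\<xi> = A (f1 *\<^sub>R PX + f2 *\<^sub>R PM)"
    have "\<delta>\<^sup>2 < 1" using \<delta>(1) \<delta>d d by (simp add: power_less_one_iff)
    then have "f1 * (1 - \<delta>\<^sup>2) = \<nu> * (1 + \<delta> * rho)" by (simp add: f1_def)
    then have f: "f1 + \<delta> * rho * f2 = \<nu>" "\<delta> * f1 / rho + f2 = - \<nu>"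
      using rho by (simp_all add: f2_def power2_eq_square algebra_simps)
    have \<xi>: "\<xi> \<bullet> A E = \<nu> * (PX \<bullet> E) + (- \<nu>) * (PM \<bullet> E)" for E
      unfolding \<xi>_def AA_plane f by simp
    have "adjoint A \<xi> = \<nu> *\<^sub>R PX - \<nu> *\<^sub>R PM"
    proof (rule vector_eq_ldot[THEN iffD1], intro allI)
      fix E
      have "E \<bullet> adjoint A \<xi> = \<xi> \<bullet> A E" by (simp add: adjoint_works[OF A(1)] inner_commute)
      then show "E \<bullet> adjoint A \<xi> = E \<bullet> (\<nu> *\<^sub>R PX - \<nu> *\<^sub>R PM)"
        unfolding \<xi> by (simp add: inner_simps inner_commute)
    qed
    then have "op_norm (adjoint A \<xi>) = \<nu>" using op_norm_plane \<nu> by simp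
    moreover have "second_order_critical (objective A (A (s *\<^sub>R PM) + \<xi>) lam) (U \<sigma>, V \<sigma>)"
    proof (rule second_order_critical_block[OF \<sigma>(2) _ lam(1) \<xi>])
      show "\<bar>(1 + \<delta>) * \<sigma> + lam\<bar> \<le> (1 + \<delta>) * \<sigma> + lam" using \<sigma> lam \<delta> by simp
      show "(1 + \<delta>) * \<sigma> + lam = s - \<delta> * \<sigma> / rho + - \<nu>" using crit by (simp add: algebra_simps)
    qed (simp_all add: \<sigma>_def)
    moreover have "1 / 200 * error_bound CARD('r) (card S) \<delta> lam \<nu> \<le> norm (U \<sigma> ** transpose (V \<sigma>) - s *\<^sub>R PM)"
    proof -
      define p q where "p = sqrt (CARD('r))" and "q = sqrt (card S)"
      have pq: "0 < p" "0 < q" "q = rho * p" using card_S ne by (simp_all add: p_def q_def rho_def real_sqrt_divide)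
      have nX: "(norm (U \<sigma> ** transpose (V \<sigma>) - s *\<^sub>R PM))\<^sup>2 = (p * \<sigma>)\<^sup>2 + (q * s)\<^sup>2"
        unfolding UV[OF \<sigma>(2)] power2_norm_eq_inner
        by (simp add: inner_simps PX_PX PX_PM PM_PM p_def q_def power_mult_distrib)
          (simp add: power2_eq_square)
      have half: "((x + y) / 2)\<^sup>2 \<le> x\<^sup>2 + y\<^sup>2" for x y :: real
      proof -
        have "0 \<le> (x - y)\<^sup>2 + 2 * x\<^sup>2 + 2 * y\<^sup>2" by simp
        also have "\<dots> = 4 * (x\<^sup>2 + y\<^sup>2) - (x + y)\<^sup>2"
          by (simp add: power2_eq_square algebra_simps)
        finally show ?thesis by (simp add: power_divide)
      qed
      have 1: "(p * \<sigma> + q * s) / 2 \<le> norm (U \<sigma> ** transpose (V \<sigma>) - s *\<^sub>R PM)"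
        using half[of "p * \<sigma>" "q * s", folded nX] by (rule power2_le_imp_le) (rule norm_ge_zero)
      have "(d - \<delta>) * s = K * (d / (1 + \<delta>))" using \<delta>(1) \<delta>d by (simp add: s_def)
      moreover have "1 / 4 \<le> d / (1 + \<delta>)" using \<delta>(1) \<delta>d d(1,2) by (simp add: le_divide_eq)
      ultimately have "K * (1 / 4) \<le> (d - \<delta>) * s"
        using K(1) by (metis less_imp_le mult_left_mono)
      then have "q * ((2 * lam + \<delta> / rho * (\<nu> - lam)) / 4) \<le> q * ((d - \<delta>) * s)"
        using K(2) pq by (intro mult_left_mono) auto
      moreover have "q * ((2 * lam + \<delta> / rho * (\<nu> - lam)) / 4) = q * lam / 2 + \<delta> * (p * (\<nu> - lam)) / 4"
        using rho by (simp add: pq(3) field_simps)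
      moreover have "(d - \<delta>) * (p * (\<nu> - lam)) \<le> (d - \<delta>) * (p * \<sigma>)"
        using \<sigma>(1) pq \<delta>d by (intro mult_left_mono) auto
      moreover have "d * (p * (\<nu> - lam)) / 4 \<le> (d - \<delta>) * (p * (\<nu> - lam)) + \<delta> * (p * (\<nu> - lam)) / 4"
      proof -
        have "0 \<le> (d - \<delta>) * (p * (\<nu> - lam))" using pq \<delta>d lam by simp
        then show ?thesis by (simp add: left_diff_distrib)
      qed
      moreover have "1 / 2 * (p * (\<nu> - lam)) \<le> d * (p * (\<nu> - lam))"
        using d(1) pq lam by (intro mult_right_mono) auto
      \<comment> \<open>The term \<open>q * s\<close> supplies \<open>lam\<close> and a multiple
        \<open>\<delta> / 4\<close> of \<open>p * (\<nu> - lam)\<close>; the term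
        \<open>p * \<sigma>\<close> supplies the multiple \<open>d - \<delta>\<close>. Together they
        give at least \<open>d / 4\<close>, hence \<open>1 / 8\<close>, uniformly in
        \<open>\<delta>\<close>. The constant \<open>1 / 200\<close> is not optimised.\<close>
      ultimately have 2: "q * lam / 2 + p * (\<nu> - lam) / 8 \<le> (d - \<delta>) * (p * \<sigma> + q * s)"
        by (simp add: distrib_left mult.left_commute)
      have "sqrt (real (CARD('r) + card S)) \<le> sqrt (4 * CARD('r))" using card_S by simp
      also have "\<dots> = 2 * p" by (simp add: real_sqrt_mult p_def)
      finally have "sqrt (real (CARD('r) + card S)) * (\<nu> - lam) \<le> 2 * p * (\<nu> - lam)"
        using lam by (intro mult_right_mono) auto
      moreover have "0 \<le> q * lam" "0 \<le> p * (\<nu> - lam)" using pq lam by auto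
      ultimately have "1 / 100 * (6 * q * lam + sqrt (real (CARD('r) + card S)) * (\<nu> - lam))
          \<le> (p * \<sigma> + q * s) * (d - \<delta>)"
        using 2 by (simp add: mult.commute[of "d - \<delta>"])
      then have le: "1 / 100 * (6 * q * lam + sqrt (real (CARD('r) + card S)) * (\<nu> - lam)) / (d - \<delta>) \<le> p * \<sigma> + q * s"
        using \<delta>d by (simp only: pos_divide_le_eq diff_gt_0_iff_gt)
      have eq: "1 / 200 * error_bound CARD('r) (card S) \<delta> lam \<nu>
          = (1 / 100 * (6 * q * lam + sqrt (real (CARD('r) + card S)) * (\<nu> - lam)) / (d - \<delta>)) / 2"
        using lam by (simp add: error_bound_def max_def q_def d_def)
      show ?thesis unfolding eq by (rule order_trans[OF divide_right_mono[OF le] 1]) simp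
    qed
    ultimately show ?thesis
      using that[of A "s *\<^sub>R PM" \<xi> "U \<sigma>" "V \<sigma>"] A(1) RIP rank_PM s by simp
  qed
qed

end

text \<open>The size conditions of the sharpness part give room for orthogonal row and column
  supports and for an isometric embedding of matrix space. Two of the three constructions satisfy
  the RIP for every \<open>k\<close>, so enlarging \<open>k\<close> cannot help there.\<close>

theorem theorem2:
  fixes r_star :: nat
  assumes "1 \<le> r_star" and "r_star \<le> CARD('r::finite)"
  shows
    \<comment> \<open>the error bound\<close>
    "(\<forall>(A :: real^'d2^'d1 \<Rightarrow> real^'n) M \<xi> b k \<delta> lam (U :: real^'r^'d1) (V :: real^'r^'d2).
        linear A \<longrightarrow> rank M = r_star \<longrightarrow> b = A M + \<xi> \<longrightarrow>
        CARD('r) + r_star \<le> k \<longrightarrow> RIP k \<delta> A \<longrightarrow> \<delta> < delta_crit CARD('r) r_star \<longrightarrow>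
        0 \<le> lam \<longrightarrow> second_order_critical (objective A b lam) (U, V) \<longrightarrow>
        norm (U ** transpose V - M)
          \<le> error_bound CARD('r) r_star \<delta> lam (op_norm (adjoint A \<xi>)))
     \<and>
     (CARD('r) + r_star \<le> CARD('d1) \<longrightarrow> CARD('r) + r_star \<le> CARD('d2) \<longrightarrow>
      CARD('d1) * CARD('d2) \<le> CARD('n) \<longrightarrow>
        \<comment> \<open>sharpness of the threshold for the RIP constant\<close>
        (\<exists>(A :: real^'d2^'d1 \<Rightarrow> real^'n) M (U :: real^'r^'d1) (V :: real^'r^'d2).
           linear A \<and> rank M = r_star \<and> (\<forall>k. RIP k (delta_crit CARD('r) r_star) A) \<and>
           second_order_critical (objective A (A M) 0) (U, V) \<and>
           \<not> global_minimum (objective A (A M) 0) (U, V) \<and>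
           U ** transpose V \<noteq> M)
      \<and>
        \<comment> \<open>sharpness of the threshold for the RIP rank\<close>
        (\<forall>k < CARD('r) + r_star.
           \<exists>(A :: real^'d2^'d1 \<Rightarrow> real^'n) M \<delta> (U :: real^'r^'d1) (V :: real^'r^'d2).
             linear A \<and> rank M = r_star \<and>
             0 \<le> \<delta> \<and> \<delta> < delta_crit CARD('r) r_star \<and> RIP k \<delta> A \<and>
             spurious_local_optimum (objective A (A M) 0) (U, V))
      \<and>
        \<comment> \<open>sharpness of the error bound, up to an absolute constant factor\<close>
        (\<forall>\<delta> lam noise.
           0 \<le> \<delta> \<longrightarrow> \<delta> < delta_crit CARD('r) r_star \<longrightarrow> 0 \<le> lam \<longrightarrow> lam \<le> noise \<longrightarrow>
           (\<exists>(A :: real^'d2^'d1 \<Rightarrow> real^'n) M \<xi> (U :: real^'r^'d1) (V :: real^'r^'d2).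
              linear A \<and> rank M = r_star \<and> (\<forall>k. RIP k \<delta> A) \<and>
              op_norm (adjoint A \<xi>) = noise \<and>
              second_order_critical (objective A (A M + \<xi>) lam) (U, V) \<and>
              1 / 200 * error_bound CARD('r) r_star \<delta> lam noise
                \<le> norm (U ** transpose V - M))))"
proof (intro conjI allI impI)
  fix A :: "real^'d2^'d1 \<Rightarrow> real^'n" and M \<xi> b k \<delta> lam and U :: "real^'r^'d1" and V :: "real^'r^'d2"
  assume "linear A" "rank M = r_star" "b = A M + \<xi>" "CARD('r) + r_star \<le> k" "RIP k \<delta> A"
    "\<delta> < delta_crit CARD('r) r_star" "0 \<le> lam" "second_order_critical (objective A b lam) (U, V)"
  then show "norm (U ** transpose V - M) \<le> error_bound CARD('r) r_star \<delta> lam (op_norm (adjoint A \<xi>))"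
    using error_bound_second_order_critical[of A M k \<delta> lam \<xi> U V] assms by blast
next
  assume d: "CARD('r) + r_star \<le> CARD('d1)" "CARD('r) + r_star \<le> CARD('d2)"
    and card: "CARD('d1) * CARD('d2) \<le> CARD('n)"
  obtain a :: "'r \<Rightarrow> 'd1" and a' :: "'r \<Rightarrow> 'd2" and c c' S
    where bm: "block_model a a' c c' S" and S: "card S = r_star"
    using block_model_exists[OF d assms] by metis
  interpret block_model a a' c c' S by (rule bm)
  show "\<exists>(A :: real^'d2^'d1 \<Rightarrow> real^'n) M (U :: real^'r^'d1) (V :: real^'r^'d2).
      linear A \<and> rank M = r_star \<and> (\<forall>k. RIP k (delta_crit CARD('r) r_star) A) \<and>
      second_order_critical (objective A (A M) 0) (U, V) \<and>
      \<not> global_minimum (objective A (A M) 0) (U, V) \<and> U ** transpose V \<noteq> M"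
    by (rule sharp_RIP_constant[OF card, unfolded S]) blast
  {
    fix k assume k: "k < CARD('r) + r_star"
    show "\<exists>(A :: real^'d2^'d1 \<Rightarrow> real^'n) M \<delta> (U :: real^'r^'d1) (V :: real^'r^'d2).
        linear A \<and> rank M = r_star \<and>
        0 \<le> \<delta> \<and> \<delta> < delta_crit CARD('r) r_star \<and> RIP k \<delta> A \<and>
        spurious_local_optimum (objective A (A M) 0) (U, V)"
      by (rule sharp_RIP_rank[OF card, unfolded S, OF k]) blast
  next
    fix \<delta> lam noise :: real
    assume "0 \<le> \<delta>" "\<delta> < delta_crit CARD('r) r_star" "0 \<le> lam" "lam \<le> noise"
    note hyps = this
    show "\<exists>(A :: real^'d2^'d1 \<Rightarrow> real^'n) M \<xi> (U :: real^'r^'d1) (V :: real^'r^'d2).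
        linear A \<and> rank M = r_star \<and> (\<forall>k. RIP k \<delta> A) \<and>
        op_norm (adjoint A \<xi>) = noise \<and>
        second_order_critical (objective A (A M + \<xi>) lam) (U, V) \<and>
        1 / 200 * error_bound CARD('r) r_star \<delta> lam noise \<le> norm (U ** transpose V - M)"
      by (rule sharp_error_bound[OF card, unfolded S, OF hyps]) blast
  }
qed

end
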